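(* Let $(r_i)_{i\ge 1}$ be a strictly increasing sequence of rational numbers with $\lim_{i\to\infty}r_i=1$, let $(\gamma_i)_{i\ge 1}$ be a sequence of nonzero real numbers, and define $z_0=y$ and $z_{i+1}=z_i-\gamma_{i+1}x^{-r_{i+1}}\in R[y;\delta]$ for $i\ge 0$. Then there exists a valuation $v$ on $R[y;\delta]$ with residue field $\mathbb{R}$ such that $v(x)=-1$ and $v(z_i)=r_{i+1}$ for all $i\ge 0$, and this valuation is uniquely determined. Its value group is $\mathbb{Q}$, and it is strongly abelian.
   Context: A valuation on a division ring $D$ is a map $v:D\to\Gamma\cup\{\infty\}$, with $\Gamma$ an additively written totally ordered group and $\infty>\gamma$ for all $\gamma\in\Gamma$, such that $v(a)=\infty\iff a=0$, $v(ab)=v(a)+v(b)$ and $v(a+b)\ge\min\{v(a),v(b)\}$. Its residue division ring is $\{a:v(a)\ge0\}/\{a:v(a)>0\}$. Valuations are trivial on $\mathbb{R}$, and "residue field $\mathbb{R}$" means that the natural map from $\mathbb{R}$ to the residue division ring is an isomorphism. A valuation $v$ on $D$ is strongly abelian if $v(ab-ba)>v(ab)$ for all nonzero $a,b\in D$. $R=\{\sum_{k\ge m}a_kx^{-k/n}\mid a_k\in\mathbb{R},\,m\in\mathbb{Z},\,n\in\mathbb{N}\}$ is the ring of Puiseux series in $x^{-1}$, $\delta(p(x))=p'(x)$ is the derivation $d/dx$ on $R$, and $R[y;\delta]$ is the Ore extension (skew polynomial ring) with $yp=py+\delta(p)$ for $p\in R$ (in particular $yx-xy=1$). $R[y;\delta]$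 is an Ore domain; a valuation on it extends uniquely to its quotient division ring and is identified with this extension. The normalization $v(x)=-1$ fixes the embedding of $\mathbb{Q}$ into the divisible hull of the value group. *)

theory Defs
  imports "HOL-Computational_Algebra.Formal_Laurent_Series" "HOL-Algebra.QuotRing"
begin

(* A Puiseux series in 1/x is given by its coefficient function: pcoeff f q is the
   coefficient of x^(-q). *)
typedef puiseux =
  "{f :: rat \<Rightarrow> real. \<exists>(n::nat) (m::int). n > 0 \<and> (\<forall>q. f q \<noteq> 0 \<longrightarrow> (\<exists>k\<ge>m. q = of_int k / of_nat n))}"
  morphisms pcoeff Abs_puiseux
  by (rule exI[of _ "\<lambda>_. 0"]) auto

lemma puiseux_eqI: "(\<And>q. pcoeff f q = pcoeff g q) \<Longrightarrow> f = g"
  by (metis ext pcoeff_inject)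

instantiation puiseux :: "{zero, one, plus, uminus, minus, times}"
begin

definition "0 = Abs_puiseux (\<lambda>_. 0)"
definition "1 = Abs_puiseux (\<lambda>q. if q = 0 then 1 else 0)"
definition "f + g = Abs_puiseux (\<lambda>q. pcoeff f q + pcoeff g q)"
definition "- f = Abs_puiseux (\<lambda>q. - pcoeff f q)"
definition "f - g = Abs_puiseux (\<lambda>q. pcoeff f q - pcoeff g q)"
definition "f * g = Abs_puiseux (\<lambda>q. \<Sum>p | pcoeff f p \<noteq> 0 \<and> pcoeff g (q - p) \<noteq> 0. pcoeff f p * pcoeff g (q - p))"

instance ..

end

(* c x^(-q) *)
definition pmonom :: "real \<Rightarrow> rat \<Rightarrow> puiseux" where
  "pmonom c q = Abs_puiseux (\<lambda>p. if p = q then c else 0)"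

(* d/dx sends a x^(-p) to (-p) a x^(-p-1), so the coefficient at q is read off with p = q - 1. *)
definition pderivative :: "puiseux \<Rightarrow> puiseux" where
  "pderivative f = Abs_puiseux (\<lambda>q. of_rat (1 - q) * pcoeff f (q - 1))"


(* lau n F is the Laurent series F with x^(-1/n) substituted for its variable.  Every
   Puiseux series has this form, and finitely many share a common n; this transports the
   field axioms and the Leibniz rule from real Laurent series. *)
notation fls_nth (infixl "$$" 75)

definition lau_fun :: "nat \<Rightarrow> real fls \<Rightarrow> rat \<Rightarrow> real" where
  "lau_fun n F q = (if q * of_nat n \<in> \<int> then F $$ \<lfloor>q * of_nat n\<rfloor> else 0)"

definition lau :: "nat \<Rightarrow> real fls \<Rightarrow> puiseux" where
  "lau n F = Abs_puiseux (lau_fun n F)"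

lemma pcoeff_lau: assumes "n > 0" shows "pcoeff (lau n F) = lau_fun n F"
proof -
  obtain m where m: "\<forall>k<m. F $$ k = 0" by (rule fls_nth_vanishes_belowE)
  have "\<exists>k\<ge>m. q = of_int k / of_nat n" if "lau_fun n F q \<noteq> 0" for q
  proof -
    from that have i: "q * of_nat n \<in> \<int>" and nz: "F $$ \<lfloor>q * of_nat n\<rfloor> \<noteq> 0"
      by (auto simp: lau_fun_def split: if_splits)
    from i obtain k where k: "q * of_nat n = of_int k" by (auto elim: Ints_cases)
    with nz have "F $$ k \<noteq> 0" by simp
    with m have "k \<ge> m" by force
    moreover have "q = of_int k / of_nat n" using k assms by (simp add: field_simps)
    ultimately show ?thesis by blast
  qed
  with assms have "lau_fun n F \<in> {f. \<exists>(n::nat) (m::int). n > 0 \<and> (\<forall>q. f q \<noteq> 0 \<longrightarrow> (\<exists>k\<ge>m. q = of_int k / of_nat n))}"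
    by blast
  then show ?thesis unfolding lau_def by (rule Abs_puiseux_inverse)
qed

lemma lau_fun_of_int: "n > 0 \<Longrightarrow> lau_fun n F (of_int k / of_nat n) = F $$ k"
  by (simp add: lau_fun_def)

lemma lau_cases:
  assumes "n > 0"
  obtains k where "q = of_int k / of_nat n" | "\<And>F. lau_fun n F q = 0"
proof (cases "q * of_nat n \<in> \<int>")
  case True
  then obtain k where "q * of_nat n = of_int k" by (auto elim: Ints_cases)
  with assms have "q = of_int k / of_nat n" by (simp add: field_simps)
  with that show ?thesis by blast
next
  case False
  with that show ?thesis by (auto simp: lau_fun_def)
qed

lemma pcoeff_nz_lau:
  obtains n where "n > 0" "\<And>N. N > 0 \<Longrightarrow> n dvd N \<Longrightarrow> \<exists>F. f = lau N F"
proof -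
  from pcoeff[of f] obtain n :: nat and m :: int where n: "n > 0"
    and nm: "\<And>q. pcoeff f q \<noteq> 0 \<Longrightarrow> \<exists>k\<ge>m. q = of_int k / of_nat n" by blast
  have "\<exists>F. f = lau N F" if N: "N > 0" "n dvd N" for N
  proof -
    from N obtain d where d: "N = n * d" by auto
    with N have d0: "d > 0" by simp
    define F where "F = Abs_fls (\<lambda>k. pcoeff f (of_int k / of_nat N))"
    have z: "pcoeff f (of_int k / of_nat N) = 0" if k: "k < - \<bar>m\<bar> * int d" for k
    proof (rule ccontr)
      assume "pcoeff f (of_int k / of_nat N) \<noteq> 0"
      with nm obtain j where j: "j \<ge> m" "of_int k / of_nat N = (of_int j / of_nat n :: rat)" by blast
      hence "of_int k = (of_int j * of_nat d :: rat)" using d n d0 by (simp add: field_simps)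
      hence "k = j * int d" by (metis of_int_eq_iff of_int_mult of_int_of_nat_eq)
      moreover have "j * int d \<ge> - \<bar>m\<bar> * int d" using j d0 by (intro mult_right_mono) auto
      ultimately show False using k by simp
    qed
    have F: "F $$ k = pcoeff f (of_int k / of_nat N)" for k
      unfolding F_def by (rule nth_Abs_fls_lower_bound[of "- \<bar>m\<bar> * int d"]) (use z in auto)
    have "f = lau N F"
    proof (rule puiseux_eqI)
      fix q
      show "pcoeff f q = pcoeff (lau N F) q"
      proof (cases "q * of_nat N \<in> \<int>")
        case True
        then obtain k where "q * of_nat N = of_int k" by (auto elim: Ints_cases)
        with N have "q = of_int k / of_nat N" by (simp add: field_simps)
        with F N show ?thesis by (simp add: pcoeff_lau lau_fun_of_int)
      next
        case False
        have "pcoeff f q = 0"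
        proof (rule ccontr)
          assume "pcoeff f q \<noteq> 0"
          with nm obtain j where "q = of_int j / of_nat n" by blast
          hence "q * of_nat N = of_int (j * int d)" using d n by (simp add: field_simps)
          hence "q * of_nat N \<in> \<int>" by (metis Ints_of_int)
          with False show False by simp
        qed
        with False N show ?thesis by (simp add: pcoeff_lau lau_fun_def)
      qed
    qed
    then show ?thesis by blast
  qed
  with n that show ?thesis by blast
qed

lemma lau1: obtains n F where "n > 0" "f = lau n F"
  by (metis pcoeff_nz_lau[of f] dvd_refl)

lemma lau2: obtains n F G where "n > 0" "f = lau n F" "g = lau n G"
proof -
  obtain a where a: "a > 0" "\<And>N. N > 0 \<Longrightarrow> a dvd N \<Longrightarrow> \<exists>F. f = lau N F" by (rule pcoeff_nz_lau[of f]) blast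
  obtain b where b: "b > 0" "\<And>N. N > 0 \<Longrightarrow> b dvd N \<Longrightarrow> \<exists>F. g = lau N F" by (rule pcoeff_nz_lau[of g]) blast
  from a b have "a * b > 0" "\<exists>F. f = lau (a*b) F" "\<exists>F. g = lau (a*b) F" by auto
  with that show ?thesis by blast
qed

lemma lau3: obtains n F G H where "n > 0" "f = lau n F" "g = lau n G" "h = lau n H"
proof -
  obtain a where a: "a > 0" "\<And>N. N > 0 \<Longrightarrow> a dvd N \<Longrightarrow> \<exists>F. f = lau N F" by (rule pcoeff_nz_lau[of f]) blast
  obtain b where b: "b > 0" "\<And>N. N > 0 \<Longrightarrow> b dvd N \<Longrightarrow> \<exists>F. g = lau N F" by (rule pcoeff_nz_lau[of g]) blast
  obtain c where c: "c > 0" "\<And>N. N > 0 \<Longrightarrow> c dvd N \<Longrightarrow> \<exists>F. h = lau N F" by (rule pcoeff_nz_lau[of h]) blast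
  from a b c have "a * b * c > 0" "\<exists>F. f = lau (a*b*c) F" "\<exists>F. g = lau (a*b*c) F" "\<exists>F. h = lau (a*b*c) F"
    by auto
  with that show ?thesis by blast
qed

lemma lau_inject: "n > 0 \<Longrightarrow> lau n F = lau n G \<longleftrightarrow> F = G"
  by (metis fls_eqI lau_fun_of_int pcoeff_lau)

lemma lau_eqI: "n > 0 \<Longrightarrow> (\<And>q. lau_fun n F q = f q) \<Longrightarrow> Abs_puiseux f = lau n F"
  unfolding lau_def by (metis ext)

lemma zero_lau: "n > 0 \<Longrightarrow> 0 = lau n 0"
  unfolding zero_puiseux_def by (rule lau_eqI) (auto simp: lau_fun_def)

lemma one_lau: "n > 0 \<Longrightarrow> 1 = lau n 1"
  unfolding one_puiseux_def
  by (rule lau_eqI) (auto simp: lau_fun_def elim!: Ints_cases)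

lemma add_lau: "n > 0 \<Longrightarrow> lau n F + lau n G = lau n (F + G)"
  unfolding plus_puiseux_def by (rule lau_eqI) (auto simp: lau_fun_def pcoeff_lau)

lemma minus_lau: "n > 0 \<Longrightarrow> lau n F - lau n G = lau n (F - G)"
  unfolding minus_puiseux_def by (rule lau_eqI) (auto simp: lau_fun_def pcoeff_lau)

lemma uminus_lau: "n > 0 \<Longrightarrow> - lau n F = lau n (- F)"
  unfolding uminus_puiseux_def by (rule lau_eqI) (auto simp: lau_fun_def pcoeff_lau)

lemma lau_fun_mult:
  assumes n: "n > 0"
  shows "lau_fun n (F * G) q = (\<Sum>p | lau_fun n F p \<noteq> 0 \<and> lau_fun n G (q - p) \<noteq> 0. lau_fun n F p * lau_fun n G (q - p))"
proof -
  let ?S = "{p. lau_fun n F p \<noteq> 0 \<and> lau_fun n G (q - p) \<noteq> 0}"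
  show ?thesis
  proof (cases "q * of_nat n \<in> \<int>")
    case False
    have "?S = {}"
    proof (rule ccontr)
      assume "?S \<noteq> {}"
      then obtain p where "lau_fun n F p \<noteq> 0" "lau_fun n G (q - p) \<noteq> 0" by blast
      hence "p * of_nat n \<in> \<int>" "(q - p) * of_nat n \<in> \<int>" by (auto simp: lau_fun_def split: if_splits)
      hence "p * of_nat n + (q - p) * of_nat n \<in> \<int>" by (rule Ints_add)
      with False show False by (simp add: algebra_simps)
    qed
    hence "(\<Sum>p\<in>?S. lau_fun n F p * lau_fun n G (q - p)) = 0" by (simp only: sum.empty)
    moreover have "lau_fun n (F * G) q = 0" using False by (simp add: lau_fun_def)
    ultimately show ?thesis by simp
  next
    case True
    then obtain k where "q * of_nat n = of_int k" by (auto elim: Ints_cases)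
    with n have q: "q = of_int k / of_nat n" by (simp add: field_simps)
    let ?h = "\<lambda>i::int. of_int i / of_nat n :: rat"
    let ?T = "{i. F $$ i \<noteq> 0 \<and> G $$ (k - i) \<noteq> 0}"
    have sub: "q - ?h i = ?h (k - i)" for i by (simp add: q diff_divide_distrib)
    have "?S = ?h ` ?T"
    proof (intro equalityI subsetI)
      fix p assume p: "p \<in> ?S"
      from lau_cases[OF n, of p] p obtain i where i: "p = ?h i" by fastforce
      with p have "i \<in> ?T" unfolding i mem_Collect_eq sub lau_fun_of_int[OF n] by simp
      with i show "p \<in> ?h ` ?T" by blast
    next
      fix p assume "p \<in> ?h ` ?T"
      then obtain i where i: "p = ?h i" "i \<in> ?T" by blast
      then show "p \<in> ?S" unfolding i(1) mem_Collect_eq sub lau_fun_of_int[OF n] by simp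
    qed
    moreover have "inj_on ?h ?T" using n by (auto simp: inj_on_def)
    ultimately have "(\<Sum>p\<in>?S. lau_fun n F p * lau_fun n G (q - p)) = (\<Sum>i\<in>?T. F $$ i * G $$ (k - i))"
      by (simp only: sum.reindex o_def sub lau_fun_of_int[OF n])
    also have "\<dots> = (\<Sum>i=fls_subdegree F..k - fls_subdegree G. F $$ i * G $$ (k - i))"
    proof (rule sum.mono_neutral_left)
      show "?T \<subseteq> {fls_subdegree F..k - fls_subdegree G}"
        by (auto dest!: fls_subdegree_leI)
    qed auto
    also have "\<dots> = lau_fun n (F * G) q"
      by (simp add: q lau_fun_of_int[OF n] fls_times_nth(2))
    finally show ?thesis by simp
  qed
qed

lemma mult_lau: "n > 0 \<Longrightarrow> lau n F * lau n G = lau n (F * G)"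
  unfolding times_puiseux_def by (rule lau_eqI) (simp_all only: pcoeff_lau lau_fun_mult)

lemma lau_fun_deriv:
  assumes n: "n > 0"
  shows "lau_fun n (fls_const (- 1 / of_nat n) * fls_X_intpow (int n + 1) * fls_deriv F) q
    = of_rat (1 - q) * lau_fun n F (q - 1)"
proof -
  let ?G = "fls_const (- 1 / real n) * fls_X_intpow (int n + 1) * fls_deriv F"
  have G: "?G $$ k = (1 - of_int k / real n) * F $$ (k - int n)" for k
  proof -
    have "?G = fls_const (- 1 / real n) * fls_shift (- (int n + 1)) (fls_deriv F)"
      by (simp only: fls_X_intpow_times_conv_shift(1) mult.assoc)
    hence "?G $$ k = (fls_const (- 1 / real n) * fls_shift (- (int n + 1)) (fls_deriv F)) $$ k"
      by (rule arg_cong)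
    also have "\<dots> = (- 1 / real n) * (real_of_int (k - int n) * F $$ (k - int n))"
      by (simp add: algebra_simps)
    also have "\<dots> = (1 - of_int k / real n) * F $$ (k - int n)" using n by (simp add: field_simps)
    finally show ?thesis .
  qed
  show ?thesis
  proof (cases "q * of_nat n \<in> \<int>")
    case True
    then obtain k where "q * of_nat n = of_int k" by (auto elim: Ints_cases)
    with n have q: "q = of_int k / of_nat n" by (simp add: field_simps)
    have q1: "q - 1 = of_int (k - int n) / of_nat n" using n by (simp add: q field_simps)
    show ?thesis unfolding q1 lau_fun_of_int[OF n]
      unfolding q lau_fun_of_int[OF n] G by (simp add: of_rat_diff of_rat_divide)
  next
    case False
    have "(q - 1) * of_nat n \<notin> \<int>"
    proof
      assume "(q - 1) * of_nat n \<in> \<int>"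
      hence "(q - 1) * of_nat n + of_nat n \<in> \<int>" by (intro Ints_add) auto
      with False show False by (simp add: algebra_simps)
    qed
    with False show ?thesis by (simp add: lau_fun_def)
  qed
qed

lemma deriv_lau:
  "n > 0 \<Longrightarrow> pderivative (lau n F) = lau n (fls_const (- 1 / of_nat n) * fls_X_intpow (int n + 1) * fls_deriv F)"
  unfolding pderivative_def by (rule lau_eqI) (simp_all only: pcoeff_lau lau_fun_deriv)

lemma pcoeff_0: "pcoeff 0 q = 0"
  by (simp add: zero_lau[of 1] pcoeff_lau lau_fun_def)

lemma pcoeff_1: "pcoeff 1 q = (if q = 0 then 1 else 0)"
  by (auto simp: one_lau[of 1] pcoeff_lau lau_fun_def elim!: Ints_cases)

lemma pcoeff_add: "pcoeff (f + g) q = pcoeff f q + pcoeff g q"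
  by (rule lau2[of f g]) (simp add: add_lau pcoeff_lau lau_fun_def)

lemma pcoeff_minus: "pcoeff (f - g) q = pcoeff f q - pcoeff g q"
  by (rule lau2[of f g]) (simp add: minus_lau pcoeff_lau lau_fun_def)

lemma pcoeff_uminus: "pcoeff (- f) q = - pcoeff f q"
  by (rule lau1[of f]) (simp add: uminus_lau pcoeff_lau lau_fun_def)

lemma pcoeff_mult:
  "pcoeff (f * g) q = (\<Sum>p | pcoeff f p \<noteq> 0 \<and> pcoeff g (q - p) \<noteq> 0. pcoeff f p * pcoeff g (q - p))"
  by (rule lau2[of f g]) (simp only: mult_lau pcoeff_lau lau_fun_mult)

lemma pcoeff_pderivative: "pcoeff (pderivative f) q = of_rat (1 - q) * pcoeff f (q - 1)"
  by (rule lau1[of f]) (simp only: deriv_lau pcoeff_lau lau_fun_deriv)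

instantiation puiseux :: field
begin

definition "inverse (f :: puiseux) = (if f = 0 then 0 else (THE g. f * g = 1))"

definition "f div (g :: puiseux) = f * inverse g"

instance
proof
  fix a b c :: puiseux
  obtain n A B C where n: "n > 0" and abc: "a = lau n A" "b = lau n B" "c = lau n C" by (rule lau3)
  note s = abc mult_lau[OF n] add_lau[OF n] one_lau[OF n] zero_lau[OF n] uminus_lau[OF n] minus_lau[OF n]
    lau_inject[OF n]
  show "a * b * c = a * (b * c)" by (simp add: s mult.assoc)
  show "a * b = b * a" by (simp add: s mult.commute)
  show "1 * a = a" by (simp add: s)
  show "a + b + c = a + (b + c)" by (simp add: s add.assoc)
  show "a + b = b + a" by (simp add: s add.commute)
  show "0 + a = a" by (simp add: s)
  show "- a + a = 0" by (simp add: s)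
  show "a - b = a + - b" by (simp add: s)
  show "(a + b) * c = a * c + b * c" by (simp add: s distrib_right)
  show "(0::puiseux) \<noteq> 1" by (simp add: s)
next
  fix a :: puiseux assume a: "a \<noteq> 0"
  obtain n A where n: "n > 0" and A: "a = lau n A" by (rule lau1)
  from a have "A \<noteq> 0" by (auto simp: A zero_lau[OF n])
  hence AA: "A * inverse A = 1" by simp
  hence 1: "a * lau n (inverse A) = 1" by (simp add: A mult_lau[OF n] one_lau[OF n])
  have uniq: "g = lau n (inverse A)" if "a * g = 1" for g
  proof -
    obtain m P Q R where m: "m > 0" "a = lau m P" "lau n (inverse A) = lau m Q" "g = lau m R"
      by (rule lau3)
    from 1 m have PQ: "P * Q = 1" by (simp add: mult_lau[OF m(1)] one_lau[OF m(1)] lau_inject[OF m(1)])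
    from that m have PR: "P * R = 1" by (simp add: mult_lau[OF m(1)] one_lau[OF m(1)] lau_inject[OF m(1)])
    have "Q = Q * (P * R)" using PR by simp
    also have "\<dots> = (P * Q) * R" by (simp only: ac_simps)
    also have "\<dots> = R" using PQ by simp
    finally have "Q = R" .
    with m show ?thesis by simp
  qed
  from 1 uniq have "(THE g. a * g = 1) = lau n (inverse A)" by (rule the_equality)
  hence "inverse a = lau n (inverse A)" using a by (simp add: inverse_puiseux_def)
  moreover have "lau n (inverse A) * a = 1"
    using AA by (simp add: A mult_lau[OF n] one_lau[OF n] mult.commute)
  ultimately show "inverse a * a = 1" by simp
next
  fix a b :: puiseux
  show "a div b = a * inverse b" by (simp add: divide_puiseux_def)
  show "inverse (0::puiseux) = 0" by (simp add: inverse_puiseux_def)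
qed

end


class differential_ring = comm_ring_1 +
  fixes pd :: "'a \<Rightarrow> 'a"
  assumes pd_add: "pd (a + b) = pd a + pd b"
    and pd_mult: "pd (a * b) = pd a * b + a * pd b"
begin

lemma pd_0 [simp]: "pd 0 = 0"
proof -
  have "pd 0 + pd 0 = pd 0 + 0" using pd_add[of 0 0] by (simp only: add_0_left add_0_right)
  thus ?thesis by (simp only: add_left_cancel)
qed

lemma pd_1 [simp]: "pd 1 = 0"
proof -
  have "pd 1 + pd 1 = pd 1 + 0" using pd_mult[of 1 1] by (simp only: mult_1_left mult_1_right add_0_right)
  thus ?thesis by (simp only: add_left_cancel)
qed

end

class differential_field = field + differential_ring

instantiation puiseux :: differential_field
begin

definition "pd = pderivative"

instance
proof
  fix a b :: puiseux
  obtain n A B where n: "n > 0" and ab: "a = lau n A" "b = lau n B" by (rule lau2)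
  have d: "pd (lau n F) = lau n (fls_const (- 1 / of_nat n) * fls_X_intpow (int n + 1) * fls_deriv F)" for F
    by (simp only: pd_puiseux_def deriv_lau[OF n])
  show "pd (a + b) = pd a + pd b"
    unfolding ab add_lau[OF n] d fls_deriv_add distrib_left ..
  have c: "C * (A * B' + A' * B) = C * A' * B + A * (C * B')" for C A' B' :: "real fls"
    by (simp only: distrib_left mult.assoc mult.left_commute[of A] add.commute)
  show "pd (a * b) = pd a * b + a * pd b"
    unfolding ab mult_lau[OF n] add_lau[OF n] d fls_deriv_mult c ..
qed

end

no_notation fls_nth (infixl "$$" 75)

(* The Ore extension R[y;pd], for R a commutative ring with derivation pd.  Elements are sums
   of p_i y^i with coefficients on the left; left_coeffs gives the p_i.  The function y_times
   is left multiplication by y, computed from y (p y^i) = p y^(i+1) + pd(p) y^i. *)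
typedef (overloaded) 'a skew_poly = "UNIV :: 'a::zero poly set"
  morphisms left_coeffs Abs_skew_poly ..

definition y_times :: "'a::differential_ring poly \<Rightarrow> 'a poly" where
  "y_times p = pCons 0 p + map_poly pd p"

lemma left_coeffs_inverse' [simp]: "left_coeffs (Abs_skew_poly p) = p"
  by (simp add: Abs_skew_poly_inverse)

lemma skew_poly_eq_iff: "p = q \<longleftrightarrow> left_coeffs p = left_coeffs q"
  by (simp add: left_coeffs_inject)

definition skew_mult :: "'a::differential_ring poly \<Rightarrow> 'a poly \<Rightarrow> 'a poly" where
  "skew_mult p q = (\<Sum>i\<le>degree p. smult (coeff p i) ((y_times ^^ i) q))"

instantiation skew_poly :: (differential_ring) "{zero, one, plus, uminus, minus, times}"
begin

definition "0 = Abs_skew_poly 0"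
definition "1 = Abs_skew_poly 1"
definition "p + q = Abs_skew_poly (left_coeffs p + left_coeffs q)"
definition "- p = Abs_skew_poly (- left_coeffs p)"
definition "p - q = Abs_skew_poly (left_coeffs p - left_coeffs q)"
definition "p * q = Abs_skew_poly (skew_mult (left_coeffs p) (left_coeffs q))"

instance ..

end

definition skew_const :: "'a::differential_ring \<Rightarrow> 'a skew_poly" where
  "skew_const a = Abs_skew_poly [:a:]"

definition skew_Y :: "'a::differential_ring skew_poly" where
  "skew_Y = Abs_skew_poly [:0, 1:]"

lemma y_times_add: "y_times (p + q) = y_times p + y_times q"
  by (rule poly_eqI) (simp add: y_times_def coeff_map_poly pd_add coeff_pCons split: nat.split)

lemma y_times_smult: "y_times (smult a p) = smult a (y_times p) + smult (pd a) p"
  by (rule poly_eqI) (simp add: y_times_def coeff_map_poly pd_mult coeff_pCons algebra_simps split: nat.split)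

lemma y_times_0 [simp]: "y_times 0 = 0"
  by (simp add: y_times_def)

lemma y_times_pow_0 [simp]: "(y_times ^^ i) 0 = 0"
  by (induction i) auto

lemma y_times_pow_add: "(y_times ^^ i) (p + q) = (y_times ^^ i) p + (y_times ^^ i) q"
  by (induction i) (auto simp: y_times_add)

lemma y_times_sum: "y_times (\<Sum>i\<in>A. f i) = (\<Sum>i\<in>A. y_times (f i))"
  by (induction A rule: infinite_finite_induct) (auto simp: y_times_add)

lemma skew_mult_bound:
  assumes "degree p \<le> n"
  shows "skew_mult p q = (\<Sum>i\<le>n. smult (coeff p i) ((y_times ^^ i) q))"
  unfolding skew_mult_def
  by (rule sum.mono_neutral_left) (use assms in \<open>auto simp: coeff_eq_0\<close>)

lemma smult_sum_right: "smult c (\<Sum>i\<in>A. f i) = (\<Sum>i\<in>A. smult c (f i))"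
  by (induction A rule: infinite_finite_induct) (auto simp: smult_add_right)

lemma skew_mult_0_left: "skew_mult 0 q = 0"
  by (simp add: skew_mult_def)

lemma skew_mult_0_right: "skew_mult p 0 = 0"
  by (simp add: skew_mult_def)

lemma skew_mult_add_left: "skew_mult (p + q) r = skew_mult p r + skew_mult q r"
proof -
  define n where "n = max (degree p) (degree q)"
  have "degree p \<le> n" "degree q \<le> n" "degree (p + q) \<le> n"
    by (auto simp: n_def degree_add_le_max)
  then show ?thesis by (simp add: skew_mult_bound smult_add_left sum.distrib)
qed

lemma skew_mult_add_right: "skew_mult p (q + r) = skew_mult p q + skew_mult p r"
  by (simp add: skew_mult_def y_times_pow_add smult_add_right sum.distrib)

lemma skew_mult_smult: "skew_mult (smult a p) q = smult a (skew_mult p q)"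
proof -
  have "degree (smult a p) \<le> degree p" by (rule degree_smult_le)
  then show ?thesis
    by (simp add: skew_mult_bound[of _ "degree p"] smult_sum_right)
qed

lemma skew_mult_pCons_0: "skew_mult (pCons 0 p) q = y_times (skew_mult p q) - skew_mult (map_poly pd p) q"
proof -
  have d: "degree (pCons 0 p) \<le> Suc (degree p)" by (rule degree_pCons_le)
  have d': "degree (map_poly pd p) \<le> degree p" by (rule map_poly_degree_leq)
  have "skew_mult (pCons 0 p) q = (\<Sum>i\<le>degree p. smult (coeff p i) (y_times ((y_times ^^ i) q)))"
    unfolding skew_mult_bound[OF d] by (subst sum.atMost_Suc_shift) simp
  also have "\<dots> = (\<Sum>i\<le>degree p. y_times (smult (coeff p i) ((y_times ^^ i) q))
      - smult (pd (coeff p i)) ((y_times ^^ i) q))"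
    by (simp add: y_times_smult)
  also have "\<dots> = y_times (skew_mult p q) - skew_mult (map_poly pd p) q"
    unfolding skew_mult_bound[OF d'] skew_mult_def[of p]
    by (simp add: y_times_sum sum_subtractf coeff_map_poly)
  finally show ?thesis .
qed

lemma skew_mult_y_times: "skew_mult (y_times p) q = y_times (skew_mult p q)"
  by (simp add: y_times_def[of p] skew_mult_add_left skew_mult_pCons_0)

lemma skew_mult_y_times_pow: "skew_mult ((y_times ^^ i) p) q = (y_times ^^ i) (skew_mult p q)"
  by (induction i) (auto simp: skew_mult_y_times)

lemma skew_mult_sum_left: "skew_mult (\<Sum>i\<in>A. f i) q = (\<Sum>i\<in>A. skew_mult (f i) q)"
  by (induction A rule: infinite_finite_induct) (auto simp: skew_mult_add_left skew_mult_0_left)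

lemma skew_mult_assoc: "skew_mult (skew_mult p q) r = skew_mult p (skew_mult q r)"
  by (subst (2) skew_mult_def, subst (1) skew_mult_def)
     (simp add: skew_mult_sum_left skew_mult_smult skew_mult_y_times_pow skew_mult_def[of p])

lemma skew_mult_1_left: "skew_mult 1 q = q"
  by (simp add: skew_mult_def)

lemma y_times_pow_1: "(y_times ^^ i) 1 = monom 1 i"
proof (induction i)
  case (Suc i)
  have "map_poly pd (monom 1 i) = (0 :: 'a poly)"
    by (rule poly_eqI) (simp add: coeff_map_poly)
  with Suc show ?case by (simp add: y_times_def monom_Suc)
qed simp

lemma skew_mult_1_right: "skew_mult p 1 = p"
  using poly_as_sum_of_monoms[of p] by (simp add: skew_mult_def y_times_pow_1 smult_monom)

instance skew_poly :: (differential_ring) ring_1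
  by standard
     (simp_all add: skew_poly_eq_iff zero_skew_poly_def one_skew_poly_def plus_skew_poly_def
       uminus_skew_poly_def minus_skew_poly_def times_skew_poly_def skew_mult_assoc
       skew_mult_add_left skew_mult_add_right skew_mult_1_left skew_mult_1_right add.assoc add.commute)

lemma skew_Y_commutation: "skew_Y * skew_const p = skew_const p * skew_Y + skew_const (pd p)"
  by (simp add: skew_poly_eq_iff plus_skew_poly_def times_skew_poly_def skew_Y_def skew_const_def
      skew_mult_def y_times_def map_poly_pCons)

lemma y_times_pow_lead:
  assumes "degree q \<le> m"
  shows "degree ((y_times ^^ i) q) \<le> m + i \<and> coeff ((y_times ^^ i) q) (m + i) = coeff q m"
proof (induction i)
  case (Suc i)
  let ?r = "(y_times ^^ i) q"
  have c: "coeff (y_times ?r) k = (case k of 0 \<Rightarrow> 0 | Suc j \<Rightarrow> coeff ?r j) + pd (coeff ?r k)" for k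
    by (simp add: y_times_def coeff_map_poly coeff_pCons)
  have z: "coeff ?r k = 0" if "k > m + i" for k
    using that Suc by (intro coeff_eq_0) auto
  have "degree (y_times ?r) \<le> Suc (m + i)"
    by (rule degree_le) (auto simp: c z split: nat.split)
  moreover have "coeff (y_times ?r) (Suc (m + i)) = coeff q m"
    using Suc by (simp add: c z)
  ultimately show ?case by simp
qed (use assms in auto)

lemma skew_mult_lead:
  assumes p: "degree p \<le> n" and q: "degree q \<le> m"
  shows "degree (skew_mult p q) \<le> n + m" and "coeff (skew_mult p q) (n + m) = coeff p n * coeff q m"
proof -
  have d: "degree ((y_times ^^ i) q) \<le> m + i" "coeff ((y_times ^^ i) q) (m + i) = coeff q m" for i
    using y_times_pow_lead[OF q] by auto
  have le: "degree (smult (coeff p i) ((y_times ^^ i) q)) \<le> m + i" for i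
    using d(1) degree_smult_le order_trans by blast
  show "degree (skew_mult p q) \<le> n + m"
    unfolding skew_mult_bound[OF p]
  proof (rule degree_sum_le)
    fix i assume "i \<in> {..n}"
    with le[of i] show "degree (smult (coeff p i) ((y_times ^^ i) q)) \<le> n + m" by (simp del: degree_smult_eq)
  qed simp
  have "coeff (skew_mult p q) (n + m) = (\<Sum>i\<le>n. coeff p i * coeff ((y_times ^^ i) q) (n + m))"
    unfolding skew_mult_bound[OF p] by (simp add: coeff_sum)
  also have "\<dots> = (\<Sum>i\<in>{n}. coeff p i * coeff ((y_times ^^ i) q) (n + m))"
  proof (rule sum.mono_neutral_right)
    show "\<forall>i\<in>{..n} - {n}. coeff p i * coeff ((y_times ^^ i) q) (n + m) = 0"
    proof
      fix i assume "i \<in> {..n} - {n}"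
      hence "degree ((y_times ^^ i) q) < n + m" using d(1)[of i] by auto
      thus "coeff p i * coeff ((y_times ^^ i) q) (n + m) = 0" by (simp add: coeff_eq_0)
    qed
  qed auto
  also have "\<dots> = coeff p n * coeff q m" using d(2)[of n] by (simp add: add.commute)
  finally show "coeff (skew_mult p q) (n + m) = coeff p n * coeff q m" .
qed

class right_ore_domain = ring_1_no_zero_divisors +
  assumes right_ore: "a \<noteq> 0 \<Longrightarrow> b \<noteq> 0 \<Longrightarrow> \<exists>u v. a * u = b * v \<and> a * u \<noteq> 0"

lemma skew_poly_no_zero_divisors:
  fixes a b :: "'a::differential_field skew_poly"
  assumes "a \<noteq> 0" "b \<noteq> 0" shows "a * b \<noteq> 0"
proof -
  let ?p = "left_coeffs a" and ?q = "left_coeffs b"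
  from assms have "?p \<noteq> 0" "?q \<noteq> 0" by (auto simp: skew_poly_eq_iff zero_skew_poly_def)
  hence "coeff (skew_mult ?p ?q) (degree ?p + degree ?q) \<noteq> 0"
    by (subst skew_mult_lead(2)) auto
  hence "skew_mult ?p ?q \<noteq> 0" by (metis coeff_0)
  thus ?thesis by (simp add: skew_poly_eq_iff zero_skew_poly_def times_skew_poly_def)
qed

instance skew_poly :: (differential_field) ring_1_no_zero_divisors
  by standard (rule skew_poly_no_zero_divisors)

lemma skew_poly_reduce:
  fixes a b :: "'a::differential_field skew_poly"
  assumes "a \<noteq> 0" "b \<noteq> 0" "degree (left_coeffs b) \<le> degree (left_coeffs a)"
  obtains c where "a - b * c = 0 \<or> degree (left_coeffs (a - b * c)) < degree (left_coeffs a)"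
proof -
  let ?p = "left_coeffs a" and ?q = "left_coeffs b"
  let ?m = "degree ?q" and ?k = "degree ?p - degree ?q"
  let ?h = "monom (lead_coeff ?p / lead_coeff ?q) ?k"
  define c where "c = Abs_skew_poly ?h"
  let ?r = "left_coeffs (a - b * c)"
  have n: "?m + ?k = degree ?p" using assms by simp
  have q0: "lead_coeff ?q \<noteq> 0" using assms by (auto simp: skew_poly_eq_iff zero_skew_poly_def)
  have r: "?r = ?p - skew_mult ?q ?h"
    by (simp add: minus_skew_poly_def times_skew_poly_def c_def)
  have h: "degree ?h \<le> ?k" by (rule degree_monom_le)
  have "degree (skew_mult ?q ?h) \<le> degree ?p"
    using skew_mult_lead(1)[OF order_refl h, of ?q] n by simp
  hence le: "degree ?r \<le> degree ?p" unfolding r by (intro degree_diff_le) auto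
  have "coeff (skew_mult ?q ?h) (degree ?p) = lead_coeff ?p"
    using skew_mult_lead(2)[OF order_refl h, of ?q] n q0 by simp
  hence co: "coeff ?r (degree ?p) = 0" unfolding r by simp
  have "?r = 0 \<or> degree ?r < degree ?p"
  proof (cases "degree ?r = degree ?p")
    case True
    with co show ?thesis by (metis leading_coeff_0_iff)
  qed (use le in auto)
  hence "a - b * c = 0 \<or> degree ?r < degree ?p"
    by (metis skew_poly_eq_iff zero_skew_poly_def left_coeffs_inverse')
  with that show ?thesis by blast
qed

lemma skew_poly_right_ore:
  fixes a b :: "'a::differential_field skew_poly"
  assumes "a \<noteq> 0" "b \<noteq> 0"
  shows "\<exists>u v. a * u = b * v \<and> a * u \<noteq> 0"
  using assms
proof (induction "degree (left_coeffs a) + degree (left_coeffs b)" arbitrary: a b rule: less_induct)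
  case less
  have main: "\<exists>u v. a * u = b * v \<and> a * u \<noteq> 0"
    if ab: "a \<noteq> 0" "b \<noteq> 0" "degree (left_coeffs b) \<le> degree (left_coeffs a)"
      and IH: "\<And>a'. a' \<noteq> 0 \<Longrightarrow> degree (left_coeffs a') < degree (left_coeffs a) \<Longrightarrow>
        \<exists>u v. a' * u = b * v \<and> a' * u \<noteq> 0" for a b :: "'a skew_poly"
  proof -
    obtain c where c: "a - b * c = 0 \<or> degree (left_coeffs (a - b * c)) < degree (left_coeffs a)"
      using skew_poly_reduce[OF ab] .
    show ?thesis
    proof (cases "a - b * c = 0")
      case True
      hence "a * 1 = b * c \<and> a * 1 \<noteq> 0" using ab by simp
      then show ?thesis by blast
    next
      case False
      with c IH obtain u v where uv: "(a - b * c) * u = b * v" "(a - b * c) * u \<noteq> 0" by blast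
      have "a * u = (a - b * c) * u + b * (c * u)" by (simp add: left_diff_distrib mult.assoc)
      also have "\<dots> = b * (v + c * u)" using uv(1) by (simp add: distrib_left)
      finally have "a * u = b * (v + c * u)" .
      moreover have "u \<noteq> 0" using uv(2) by auto
      hence "a * u \<noteq> 0" using ab by simp
      ultimately show ?thesis by blast
    qed
  qed
  show ?case
  proof (cases "degree (left_coeffs b) \<le> degree (left_coeffs a)")
    case True
    show ?thesis
      by (rule main[OF less.prems True], rule less.hyps) (use less.prems in auto)
  next
    case False
    have "\<exists>u v. b * u = a * v \<and> b * u \<noteq> 0"
      by (rule main[OF less.prems(2,1)], use False in simp, rule less.hyps) (use less.prems in auto)
    then show ?thesis by metis
  qed
qed

instance skew_poly :: (differential_field) right_ore_domain
  by standard (rule skew_poly_right_ore)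

(* The quotient division ring: (a, b) stands for the right fraction a b^(-1). *)
definition ore_rel :: "'a::right_ore_domain \<times> 'a \<Rightarrow> 'a \<times> 'a \<Rightarrow> bool" where
  "ore_rel = (\<lambda>(a, b) (c, d). b \<noteq> 0 \<and> d \<noteq> 0 \<and> (\<exists>u v. b * u = d * v \<and> b * u \<noteq> 0 \<and> a * u = c * v))"

lemma ore_rel_iff: "ore_rel (a, b) (c, d) \<longleftrightarrow>
    b \<noteq> 0 \<and> d \<noteq> 0 \<and> (\<exists>u v. b * u = d * v \<and> b * u \<noteq> 0 \<and> a * u = c * v)"
  by (simp add: ore_rel_def)

lemma ore_rel_refl: "b \<noteq> 0 \<Longrightarrow> ore_rel (a, b) (a, b)"
  unfolding ore_rel_iff by (intro conjI exI[of _ 1]) auto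

lemma part_equivp_ore_rel: "part_equivp (ore_rel :: 'a::right_ore_domain \<times> 'a \<Rightarrow> _)"
proof (rule part_equivpI)
  show "\<exists>x. ore_rel x (x :: 'a \<times> 'a)" using ore_rel_refl[of 1 1] by auto
  show "symp (ore_rel :: 'a \<times> 'a \<Rightarrow> _)"
  proof (rule sympI, clarify)
    fix a b c d :: 'a
    assume 1: "ore_rel (a, b) (c, d)"
    then obtain u v where "b * u = d * v" "b * u \<noteq> 0" "a * u = c * v" unfolding ore_rel_iff by blast
    then show "ore_rel (c, d) (a, b)" using 1 unfolding ore_rel_iff by metis
  qed
  show "transp (ore_rel :: 'a \<times> 'a \<Rightarrow> _)"
  proof (rule transpI, clarify)
    fix a b c d e f :: 'a
    assume 1: "ore_rel (a, b) (c, d)" and 2: "ore_rel (c, d) (e, f)"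
    from 1 obtain u v where uv: "b * u = d * v" "b * u \<noteq> 0" "a * u = c * v" unfolding ore_rel_iff by blast
    from 2 obtain s t where st: "d * s = f * t" "d * s \<noteq> 0" "c * s = e * t" unfolding ore_rel_iff by blast
    from uv st have "v \<noteq> 0" "s \<noteq> 0" by auto
    then obtain p q where pq: "v * p = s * q" "v * p \<noteq> 0" using right_ore by blast
    have "b * (u * p) = d * (v * p)" using uv(1) by (simp flip: mult.assoc)
    moreover have "\<dots> = f * (t * q)" unfolding pq(1) using st(1) by (simp flip: mult.assoc)
    moreover have "a * (u * p) = c * (v * p)" using uv(3) by (simp flip: mult.assoc)
    moreover have "\<dots> = e * (t * q)" unfolding pq(1) using st(3) by (simp flip: mult.assoc)
    moreover have "d * (v * p) \<noteq> 0" using pq(2) 1 by (auto simp: ore_rel_iff)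
    ultimately show "ore_rel (a, b) (e, f)" using 1 2 unfolding ore_rel_iff by metis
  qed
qed

quotient_type (overloaded) 'a ore_frac = "'a::right_ore_domain \<times> 'a" / partial: ore_rel
  by (rule part_equivp_ore_rel)

definition ore_fract :: "'a::right_ore_domain \<Rightarrow> 'a \<Rightarrow> 'a ore_frac" where
  "ore_fract a b = abs_ore_frac (a, b)"

instantiation ore_frac :: (right_ore_domain) "{zero, one, plus, uminus, minus, times, inverse}"
begin

definition "0 = ore_fract 0 1"

definition "1 = ore_fract 1 1"

definition "q + r = (THE s. \<exists>a b d. d \<noteq> 0 \<and> q = ore_fract a d \<and> r = ore_fract b d \<and> s = ore_fract (a + b) d)"

definition "- q = (THE s. \<exists>a b. b \<noteq> 0 \<and> q = ore_fract a b \<and> s = ore_fract (- a) b)"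

definition "q - r = q + - (r :: 'a ore_frac)"

definition "q * r = (THE s. \<exists>a b c d u v. b \<noteq> 0 \<and> d \<noteq> 0 \<and> v \<noteq> 0 \<and>
    q = ore_fract a b \<and> r = ore_fract c d \<and> b * u = c * v \<and> s = ore_fract (a * u) (d * v))"

definition "inverse q = (if q = 0 then 0
    else (THE s. \<exists>a b. a \<noteq> 0 \<and> b \<noteq> 0 \<and> q = ore_fract a b \<and> s = ore_fract b a))"

definition "q div r = q * inverse (r :: 'a ore_frac)"

instance ..

end

definition ore_embed :: "'a::right_ore_domain \<Rightarrow> 'a ore_frac" where
  "ore_embed a = ore_fract a 1"

lemma ore_fract_eq_iff:
  "b \<noteq> 0 \<Longrightarrow> d \<noteq> 0 \<Longrightarrow> ore_fract a b = ore_fract c d \<longleftrightarrow>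
    (\<exists>u v. b * u = d * v \<and> b * u \<noteq> 0 \<and> a * u = c * v)"
  using Quotient3_rel[OF Quotient3_ore_frac, of "(a, b)" "(c, d)"] ore_rel_refl[of b a] ore_rel_refl[of d c]
  by (simp add: ore_fract_def ore_rel_iff)

lemma ore_fract_cases:
  obtains a b where "b \<noteq> 0" "q = ore_fract a b"
proof -
  obtain x where x: "ore_rel x x" "q = abs_ore_frac x"
    by (metis Quotient3_abs_rep[OF Quotient3_ore_frac] Quotient3_rep_reflp[OF Quotient3_ore_frac])
  obtain a b where "x = (a, b)" by (cases x)
  with x that show ?thesis by (auto simp: ore_fract_def ore_rel_iff)
qed

lemma ore_fract_cancel:
  assumes "b \<noteq> 0" "u \<noteq> 0" shows "ore_fract (a * u) (b * u) = ore_fract a b"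
proof -
  have "b * u \<noteq> 0" "b * u * 1 = b * u \<and> b * u * 1 \<noteq> 0 \<and> a * u * 1 = a * u" using assms by auto
  with assms(1) show ?thesis by (subst ore_fract_eq_iff) blast+
qed

(* acts q d c says q d = c, see acts_iff_mult below. *)
definition acts :: "'a::right_ore_domain ore_frac \<Rightarrow> 'a \<Rightarrow> 'a \<Rightarrow> bool" where
  "acts q d c \<longleftrightarrow> (if d = 0 then c = 0 else q = ore_fract c d)"

lemma acts_mult: "acts q d c \<Longrightarrow> acts q (d * u) (c * u)"
  by (auto simp: acts_def ore_fract_cancel split: if_splits)

lemma acts_fract: "b \<noteq> 0 \<Longrightarrow> acts (ore_fract a b) b a"
  by (simp add: acts_def)

lemma acts_fun:
  assumes "acts q d c" "acts q d c'" shows "c = c'"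
proof (cases "d = 0")
  case False
  with assms have "ore_fract c d = ore_fract c' d" by (simp add: acts_def)
  with False obtain u v where "d * u = d * v" "d * u \<noteq> 0" "c * u = c' * v" unfolding ore_fract_eq_iff[OF False False] by blast
  with False show ?thesis by simp
qed (use assms in \<open>simp add: acts_def\<close>)

lemma acts_ex: obtains u c where "u \<noteq> 0" "acts q (d * u) c"
proof (cases "d = 0")
  case True
  with that[of 1 0] show ?thesis by (simp add: acts_def)
next
  case False
  obtain a b where ab: "b \<noteq> 0" "q = ore_fract a b" by (rule ore_fract_cases)
  with False obtain u v where uv: "d * u = b * v" "d * u \<noteq> 0" using right_ore by blast
  have "acts q (b * v) (a * v)" unfolding ab(2) by (rule acts_mult[OF acts_fract[OF ab(1)]])
  moreover have "u \<noteq> 0" using uv by auto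
  ultimately show ?thesis using that uv by metis
qed

lemma acts_cancel:
  assumes "acts q (d * u) (c * u)" "u \<noteq> 0" shows "acts q d c"
  using assms by (auto simp: acts_def ore_fract_cancel split: if_splits)

lemma acts_witness:
  assumes "b \<noteq> 0" "acts (ore_fract a b) d c"
  obtains t s where "t \<noteq> 0" "d * t = b * s" "c * t = a * s"
proof (cases "d = 0")
  case True
  with that[of 1 0] assms show ?thesis by (simp add: acts_def)
next
  case False
  with assms have "ore_fract a b = ore_fract c d" by (simp add: acts_def)
  with assms(1) False obtain s t where st: "b * s = d * t" "b * s \<noteq> 0" "a * s = c * t"
    unfolding ore_fract_eq_iff[OF assms(1) False] by blast
  then have "t \<noteq> 0" by auto
  with st show ?thesis by (intro that[of t s]) auto
qed

lemma acts_add_right: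
  assumes "acts q d c" "acts q d' c'" shows "acts q (d + d') (c + c')"
proof -
  obtain a b where ab: "b \<noteq> 0" "q = ore_fract a b" by (rule ore_fract_cases)
  obtain t s where t: "t \<noteq> 0" "d * t = b * s" "c * t = a * s"
    using assms(1) ab acts_witness by metis
  obtain t' s' where t': "t' \<noteq> 0" "d' * t' = b * s'" "c' * t' = a * s'"
    using assms(2) ab acts_witness by metis
  obtain w w' where w: "t * w = t' * w'" "t * w \<noteq> 0" using t(1) t'(1) right_ore by blast
  have "(d + d') * (t * w) = d * t * w + d' * (t * w)" by (simp add: distrib_right mult.assoc)
  also have "\<dots> = b * (s * w + s' * w')"
    unfolding w(1) by (simp only: t t' distrib_left flip: mult.assoc)
  finally have 1: "(d + d') * (t * w) = b * (s * w + s' * w')" .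
  have "(c + c') * (t * w) = c * t * w + c' * (t * w)" by (simp add: distrib_right mult.assoc)
  also have "\<dots> = a * (s * w + s' * w')"
    unfolding w(1) by (simp only: t t' distrib_left flip: mult.assoc)
  finally have 2: "(c + c') * (t * w) = a * (s * w + s' * w')" .
  have "acts q ((d + d') * (t * w)) ((c + c') * (t * w))"
    unfolding 1 2 ab(2) by (rule acts_mult[OF acts_fract[OF ab(1)]])
  with w(2) show ?thesis by (rule acts_cancel[rotated])
qed

lemma acts_ex1: obtains d c where "d \<noteq> 0" "acts q d c"
  using ore_fract_cases[of q] acts_fract by metis

lemma acts_eqI: "d \<noteq> 0 \<Longrightarrow> acts q d c \<Longrightarrow> acts r d c \<Longrightarrow> q = r"
  by (simp add: acts_def)

lemma acts_zero: "acts 0 d 0"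
proof (cases "d = 0")
  case False
  then have "ore_fract (0 * d) (1 * d) = ore_fract 0 1" by (intro ore_fract_cancel) auto
  then show ?thesis by (simp add: acts_def zero_ore_frac_def)
qed (simp add: acts_def)

lemma acts_embed: "acts (ore_embed a) d (a * d)"
proof (cases "d = 0")
  case False
  then have "ore_fract (a * d) (1 * d) = ore_fract a 1" by (intro ore_fract_cancel) auto
  then show ?thesis by (simp add: acts_def ore_embed_def)
qed (simp add: acts_def)

lemma acts_one: "acts 1 d d"
  using acts_embed[of 1 d] by (simp add: ore_embed_def one_ore_frac_def)

lemma acts_common:
  assumes "d \<noteq> 0" "d' \<noteq> 0" "acts q d c" "acts q d' c'" "d * u = d' * u'"
  shows "c * u = c' * u'"
  using acts_mult[OF assms(3), of u] acts_mult[OF assms(4), of u'] assms(5) acts_fun by metis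

lemma acts_fract_eqI:
  assumes "d \<noteq> 0" "d' \<noteq> 0" "\<And>u u'. d * u = d' * u' \<Longrightarrow> c * u = c' * u'"
  shows "ore_fract c d = ore_fract c' d'"
proof -
  obtain u u' where "d * u = d' * u'" "d * u \<noteq> 0" using assms right_ore by blast
  with assms(3) show ?thesis unfolding ore_fract_eq_iff[OF assms(1,2)] by blast
qed

lemma acts_add:
  assumes qa: "acts q d a" and rb: "acts r d b" shows "acts (q + r) d (a + b)"
proof (cases "d = 0")
  case False
  have "q + r = ore_fract (a + b) d"
    unfolding plus_ore_frac_def
  proof (rule the_equality)
    show "\<exists>a' b' d'. d' \<noteq> 0 \<and> q = ore_fract a' d' \<and> r = ore_fract b' d' \<and> ore_fract (a + b) d = ore_fract (a' + b') d'"
      using assms False by (auto simp: acts_def)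
  next
    fix s assume "\<exists>a' b' d'. d' \<noteq> 0 \<and> q = ore_fract a' d' \<and> r = ore_fract b' d' \<and> s = ore_fract (a' + b') d'"
    then obtain a' b' d' where d': "d' \<noteq> 0" and qr: "q = ore_fract a' d'" "r = ore_fract b' d'"
      and s: "s = ore_fract (a' + b') d'" by blast
    have q': "acts q d' a'" and r': "acts r d' b'" using d' qr by (auto simp: acts_fract)
    show "s = ore_fract (a + b) d"
      unfolding s
    proof (rule acts_fract_eqI[OF d' False])
      fix u u' assume e: "d' * u = d * u'"
      show "(a' + b') * u = (a + b) * u'"
        using acts_common[OF d' False q' qa e] acts_common[OF d' False r' rb e]
        by (simp add: distrib_right)
    qed
  qed
  then show ?thesis using False by (simp add: acts_def)
qed (use assms in \<open>simp add: acts_def\<close>)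

lemma acts_uminus:
  assumes qa: "acts q d a" shows "acts (- q) d (- a)"
proof (cases "d = 0")
  case False
  have "- q = ore_fract (- a) d"
    unfolding uminus_ore_frac_def
  proof (rule the_equality)
    show "\<exists>a' d'. d' \<noteq> 0 \<and> q = ore_fract a' d' \<and> ore_fract (- a) d = ore_fract (- a') d'"
      using assms False by (auto simp: acts_def)
  next
    fix s assume "\<exists>a' d'. d' \<noteq> 0 \<and> q = ore_fract a' d' \<and> s = ore_fract (- a') d'"
    then obtain a' d' where d': "d' \<noteq> 0" and q: "q = ore_fract a' d'" and s: "s = ore_fract (- a') d'" by blast
    have q': "acts q d' a'" using d' q by (auto simp: acts_fract)
    show "s = ore_fract (- a) d"
      unfolding s
      by (rule acts_fract_eqI[OF d' False]) (use acts_common[OF d' False q' qa] in simp)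
  qed
  then show ?thesis using False by (simp add: acts_def)
qed (use assms in \<open>simp add: acts_def\<close>)

lemma acts_times:
  assumes rc: "acts r d c" and qe: "acts q c e" shows "acts (q * r) d e"
proof (cases "d = 0")
  case True
  then show ?thesis using assms by (simp add: acts_def)
next
  case False
  have "q * r = ore_fract e d"
    unfolding times_ore_frac_def
  proof (rule the_equality)
    obtain a b where ab: "b \<noteq> 0" "q = ore_fract a b" by (rule ore_fract_cases)
    show "\<exists>a b c' d' u v. b \<noteq> 0 \<and> d' \<noteq> 0 \<and> v \<noteq> 0 \<and> q = ore_fract a b \<and> r = ore_fract c' d' \<and>
        b * u = c' * v \<and> ore_fract e d = ore_fract (a * u) (d' * v)"
    proof (cases "c = 0")
      case True
      hence "e = 0" using qe by (simp add: acts_def)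
      hence "ore_fract e d = ore_fract (a * 0) (d * 1)" by simp
      moreover have "r = ore_fract c d" using rc False by (simp add: acts_def)
      moreover have "b * 0 = c * 1" using True by simp
      ultimately show ?thesis using ab False by (metis one_neq_zero)
    next
      case c: False
      hence "q = ore_fract e c" using qe by (simp add: acts_def)
      moreover have "r = ore_fract c d" using rc False by (simp add: acts_def)
      moreover have "c * 1 = c * 1" by simp
      moreover have "ore_fract e d = ore_fract (e * 1) (d * 1)" by simp
      ultimately show ?thesis using c False by (metis one_neq_zero)
    qed
  next
    fix s assume "\<exists>a b c' d' u v. b \<noteq> 0 \<and> d' \<noteq> 0 \<and> v \<noteq> 0 \<and> q = ore_fract a b \<and> r = ore_fract c' d' \<and>
        b * u = c' * v \<and> s = ore_fract (a * u) (d' * v)"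
    then obtain a b c' d' u v where h: "b \<noteq> 0" "d' \<noteq> 0" "v \<noteq> 0" "q = ore_fract a b" "r = ore_fract c' d'"
        "b * u = c' * v" and s: "s = ore_fract (a * u) (d' * v)" by blast
    have d'v: "d' * v \<noteq> 0" using h by simp
    have r': "acts r (d' * v) (c' * v)" using h acts_mult[OF acts_fract] by metis
    have q': "acts q (c' * v) (a * u)" using h acts_mult[OF acts_fract] by metis
    show "s = ore_fract e d"
      unfolding s
    proof (rule acts_fract_eqI[OF d'v False])
      fix x y assume "d' * v * x = d * y"
      with acts_common[OF d'v False r' rc] have "c' * v * x = c * y" .
      moreover have "acts q (c' * v * x) (a * u * x)" "acts q (c * y) (e * y)"
        using acts_mult q' qe by blast+
      ultimately show "a * u * x = e * y" using acts_fun by metis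
    qed
  qed
  then show ?thesis using False by (simp add: acts_def)
qed

lemma acts_inverse:
  assumes "q \<noteq> 0" "acts q d a" shows "acts (inverse q) a d"
proof -
  have a0: "a = 0 \<longleftrightarrow> d = 0"
    using assms acts_zero[of d] by (auto simp: acts_def split: if_splits)
  show ?thesis
  proof (cases "d = 0")
    case False
    have "(THE s. \<exists>a b. a \<noteq> 0 \<and> b \<noteq> 0 \<and> q = ore_fract a b \<and> s = ore_fract b a) = ore_fract d a"
    proof (rule the_equality)
      show "\<exists>a' d'. a' \<noteq> 0 \<and> d' \<noteq> 0 \<and> q = ore_fract a' d' \<and> ore_fract d a = ore_fract d' a'"
        using assms False a0 by (auto simp: acts_def)
    next
      fix s assume "\<exists>a' d'. a' \<noteq> 0 \<and> d' \<noteq> 0 \<and> q = ore_fract a' d' \<and> s = ore_fract d' a'"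
      then obtain a' d' where h: "a' \<noteq> 0" "d' \<noteq> 0" "q = ore_fract a' d'" and s: "s = ore_fract d' a'" by blast
      have q': "acts q d' a'" using h by (auto simp: acts_fract)
      from assms h False a0 have "ore_fract a d = ore_fract a' d'" by (simp add: acts_def)
      then obtain u v where "d * u = d' * v" "d * u \<noteq> 0" "a * u = a' * v"
        unfolding ore_fract_eq_iff[OF False h(2)] by blast
      moreover have "a * u \<noteq> 0" using False a0 calculation(2) by auto
      ultimately show "s = ore_fract d a" unfolding s
        using h False a0 by (subst ore_fract_eq_iff) metis+
    qed
    then have "inverse q = ore_fract d a" using assms(1) by (simp add: inverse_ore_frac_def)
    then show ?thesis using False a0 by (simp add: acts_def)
  qed (use a0 in \<open>simp add: acts_def\<close>)
qed

lemma acts_ex2: obtains d a b where "d \<noteq> 0" "acts q d a" "acts r d b"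
proof -
  obtain d0 a0 where 1: "d0 \<noteq> 0" "acts q d0 a0" by (rule acts_ex1)
  obtain u b where 2: "u \<noteq> 0" "acts r (d0 * u) b" by (rule acts_ex)
  show ?thesis using that[of "d0 * u" "a0 * u" b] 1 2 acts_mult by auto
qed

lemma acts_ex3: obtains d a b c where "d \<noteq> 0" "acts p d a" "acts q d b" "acts r d c"
proof -
  obtain d0 a0 b0 where 1: "d0 \<noteq> 0" "acts p d0 a0" "acts q d0 b0" by (rule acts_ex2)
  obtain u c where 2: "u \<noteq> 0" "acts r (d0 * u) c" by (rule acts_ex)
  show ?thesis using that[of "d0 * u" "a0 * u" "b0 * u" c] 1 2 acts_mult by auto
qed

instance ore_frac :: (right_ore_domain) division_ring
proof
  fix p q r :: "'a ore_frac"
  obtain d a b c where d: "d \<noteq> 0" and abc: "acts p d a" "acts q d b" "acts r d c" by (rule acts_ex3)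
  show "p + q + r = p + (q + r)"
    using acts_add[OF acts_add[OF abc(1,2)] abc(3)] acts_add[OF abc(1) acts_add[OF abc(2,3)]]
    by (intro acts_eqI[OF d]) (auto simp: add.assoc)
  show "p + q = q + p"
    using acts_add[OF abc(1,2)] acts_add[OF abc(2,1)]
    by (intro acts_eqI[OF d]) (auto simp: add.commute)
  show "0 + p = p"
    using acts_add[OF acts_zero abc(1)] abc(1) by (intro acts_eqI[OF d]) auto
  show "- p + p = 0"
    using acts_add[OF acts_uminus[OF abc(1)] abc(1)] acts_zero by (intro acts_eqI[OF d]) auto
  show "p - q = p + - q" by (rule minus_ore_frac_def)
  show "1 * p = p"
    using acts_times[OF abc(1) acts_one] abc(1) by (intro acts_eqI[OF d]) auto
  show "p * 1 = p"
    using acts_times[OF acts_one abc(1)] abc(1) by (intro acts_eqI[OF d]) auto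
  have "acts 1 1 (1::'a)" "acts 0 1 (0::'a)" by (rule acts_one acts_zero)+
  thus "(0 :: 'a ore_frac) \<noteq> 1" using acts_fun one_neq_zero by metis
  show "p * q * r = p * (q * r)"
  proof -
    obtain u b' where u: "u \<noteq> 0" "acts q (c * u) b'" by (rule acts_ex)
    obtain v a' where v: "v \<noteq> 0" "acts p (b' * v) a'" by (rule acts_ex)
    have 1: "acts r (d * u * v) (c * u * v)" by (intro acts_mult abc)
    have 2: "acts q (c * u * v) (b' * v)" by (intro acts_mult u)
    have "d * u * v \<noteq> 0" using d u v by simp
    then show ?thesis
      using acts_times[OF 1 acts_times[OF 2 v(2)]] acts_times[OF acts_times[OF 1 2] v(2)]
      by (intro acts_eqI)
  qed
  show "(p + q) * r = p * r + q * r"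
  proof -
    obtain u a' where u: "u \<noteq> 0" "acts p (c * u) a'" by (rule acts_ex)
    obtain v b' where v: "v \<noteq> 0" "acts q (c * u * v) b'" by (rule acts_ex)
    have 1: "acts r (d * u * v) (c * u * v)" by (intro acts_mult abc)
    have 2: "acts p (c * u * v) (a' * v)" by (intro acts_mult u)
    have "d * u * v \<noteq> 0" using d u v by simp
    then show ?thesis
      using acts_times[OF 1 acts_add[OF 2 v(2)]] acts_add[OF acts_times[OF 1 2] acts_times[OF 1 v(2)]]
      by (intro acts_eqI)
  qed
  show "p * (q + r) = p * q + p * r"
  proof -
    obtain u x where u: "u \<noteq> 0" "acts p (b * u) x" by (rule acts_ex)
    obtain v y where v: "v \<noteq> 0" "acts p (c * u * v) y" by (rule acts_ex)
    have q: "acts q (d * u * v) (b * u * v)" and r: "acts r (d * u * v) (c * u * v)"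
      by (intro acts_mult abc)+
    have x: "acts p (b * u * v) (x * v)" by (intro acts_mult u)
    have "acts (q + r) (d * u * v) (b * u * v + c * u * v)" by (rule acts_add[OF q r])
    from acts_times[OF this acts_add_right[OF x v(2)]] acts_add[OF acts_times[OF q x] acts_times[OF r v(2)]]
    show ?thesis by (rule acts_eqI[rotated]) (use d u v in simp)
  qed
next
  fix p q :: "'a ore_frac"
  show "p div q = p * inverse q" by (rule divide_ore_frac_def)
  show "inverse (0 :: 'a ore_frac) = 0" by (simp add: inverse_ore_frac_def)
  assume p: "p \<noteq> 0"
  obtain d a where d: "d \<noteq> 0" "acts p d a" by (rule acts_ex1)
  have a: "acts (inverse p) a d" by (rule acts_inverse[OF p d(2)])
  show "inverse p * p = 1"
    by (rule acts_eqI[OF d(1) acts_times[OF d(2) a] acts_one])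
  have "a \<noteq> 0"
    using d acts_zero[of d] p by (auto simp: acts_def split: if_splits)
  thus "p * inverse p = 1"
    by (rule acts_eqI[OF _ acts_times[OF a d(2)] acts_one])
qed

lemma ore_embed_eq_iff: "ore_embed a = ore_embed b \<longleftrightarrow> a = b"
  using acts_embed[of a 1] acts_embed[of b 1] acts_fun by fastforce

lemma ore_embed_0: "ore_embed 0 = 0"
  by (simp add: ore_embed_def zero_ore_frac_def)

lemma ore_embed_1: "ore_embed 1 = 1"
  by (simp add: ore_embed_def one_ore_frac_def)

lemma ore_embed_add: "ore_embed (a + b) = ore_embed a + ore_embed b"
  using acts_embed[of "a + b" 1] acts_add[OF acts_embed[of a 1] acts_embed[of b 1]]
  by (intro acts_eqI[of 1 _ "a + b"]) auto

lemma ore_embed_mult: "ore_embed (a * b) = ore_embed a * ore_embed b"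
  using acts_embed[of "a * b" 1] acts_times[OF acts_embed[of b 1] acts_embed[of a "b * 1"]]
  by (intro acts_eqI[of 1 _ "a * b"]) auto

lemma acts_iff_mult: "acts q d c \<longleftrightarrow> q * ore_embed d = ore_embed c"
proof
  assume "acts q d c"
  from acts_times[OF acts_embed[of d 1], of q c] this acts_embed[of c 1]
  show "q * ore_embed d = ore_embed c" by (intro acts_eqI[of 1 _ c]) auto
next
  assume e: "q * ore_embed d = ore_embed c"
  obtain u e' where u: "u \<noteq> 0" "acts q (d * u) e'" by (rule acts_ex)
  from acts_times[OF acts_embed[of d u] u(2)] have "acts (ore_embed c) u e'" unfolding e .
  hence "e' = c * u" using acts_embed acts_fun by blast
  with u show "acts q d c" using acts_cancel by metis
qed

lemma ore_fract_eq_divide: "b \<noteq> 0 \<Longrightarrow> ore_fract a b = ore_embed a * inverse (ore_embed b)"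
proof -
  assume b: "b \<noteq> 0"
  hence "ore_embed b \<noteq> 0" by (metis ore_embed_0 ore_embed_eq_iff)
  moreover have "ore_fract a b * ore_embed b = ore_embed a" using acts_fract[OF b] by (simp add: acts_iff_mult)
  ultimately show ?thesis by (metis mult.assoc mult.right_neutral right_inverse)
qed

(* totally ordered groups, not assumed commutative *)
class linordered_group_add = group_add + linorder +
  assumes add_le_left: "a \<le> b \<Longrightarrow> c + a \<le> c + b"
    and add_le_right: "a \<le> b \<Longrightarrow> a + c \<le> b + c"

subclass (in linordered_ab_group_add) linordered_group_add
  by standard (simp_all add: add_left_mono add_right_mono)

datatype 'g value_inf = Value 'g | Infinity

instantiation value_inf :: (linorder) linorder
begin

definition "x \<le> y \<longleftrightarrow> (case y of Infinity \<Rightarrow> True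
    | Value b \<Rightarrow> (case x of Infinity \<Rightarrow> False | Value a \<Rightarrow> a \<le> b))"

definition "x < (y :: 'a value_inf) \<longleftrightarrow> x \<le> y \<and> \<not> y \<le> x"

instance
  by standard (auto simp: less_eq_value_inf_def less_value_inf_def split: value_inf.splits)

end

instantiation value_inf :: (plus) plus
begin

definition "x + y = (case (x, y) of (Value a, Value b) \<Rightarrow> Value (a + b) | _ \<Rightarrow> Infinity)"

instance ..

end

lemma value_inf_simps [simp]:
  "Value a + Value b = Value (a + b)" "Infinity + x = Infinity" "x + Infinity = Infinity"
  "Value a \<le> Value b \<longleftrightarrow> a \<le> b" "y \<le> Infinity" "\<not> Infinity \<le> Value a"
  "Value a < Value b \<longleftrightarrow> a < b" "Value a < Infinity" "\<not> Infinity < y"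
  by (auto simp: plus_value_inf_def less_eq_value_inf_def less_value_inf_def split: value_inf.splits)

definition valuation :: "('a::ring_1 \<Rightarrow> 'g::linordered_group_add value_inf) \<Rightarrow> bool" where
  "valuation v \<longleftrightarrow> (\<forall>a. v a = Infinity \<longleftrightarrow> a = 0) \<and> (\<forall>a b. v (a * b) = v a + v b) \<and>
     (\<forall>a b. min (v a) (v b) \<le> v (a + b))"

definition value_group :: "('a \<Rightarrow> 'g value_inf) \<Rightarrow> 'g set" where
  "value_group v = {g. \<exists>a. v a = Value g}"

definition valuation_ring :: "('d::division_ring \<Rightarrow> 'g::linordered_group_add value_inf) \<Rightarrow> 'd ring" where
  "valuation_ring v = \<lparr>carrier = {a. v a \<ge> Value 0}, mult = (*), one = 1, zero = 0, add = (+)\<rparr>"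

definition valuation_ideal :: "('d::division_ring \<Rightarrow> 'g::linordered_group_add value_inf) \<Rightarrow> 'd set" where
  "valuation_ideal v = {a. v a > Value 0}"

definition residue_ring :: "('d::division_ring \<Rightarrow> 'g::linordered_group_add value_inf) \<Rightarrow> 'd set ring" where
  "residue_ring v = valuation_ring v Quot valuation_ideal v"

definition real_ring :: "real ring" where
  "real_ring = \<lparr>carrier = UNIV, mult = (*), one = 1, zero = 0, add = (+)\<rparr>"

(* The first conjunct is triviality on the reals (embedded by iota); the second says that the
   natural map from the reals to the residue division ring is an isomorphism. *)
definition residue_field_real ::
  "(real \<Rightarrow> 'd::division_ring) \<Rightarrow> ('d \<Rightarrow> 'g::linordered_group_add value_inf) \<Rightarrow> bool" where
  "residue_field_real \<iota> v \<longleftrightarrow> (\<forall>c. c \<noteq> 0 \<longrightarrow> v (\<iota> c) = Value 0) \<and>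
     (\<lambda>c. valuation_ideal v +>\<^bsub>valuation_ring v\<^esub> \<iota> c) \<in> ring_iso real_ring (residue_ring v)"

definition strongly_abelian :: "('d::division_ring \<Rightarrow> 'g::linordered_group_add value_inf) \<Rightarrow> bool" where
  "strongly_abelian v \<longleftrightarrow> (\<forall>a b. a \<noteq> 0 \<longrightarrow> b \<noteq> 0 \<longrightarrow> v (a * b - b * a) > v (a * b))"

(* the unique extension to the quotient division ring, see val_extension_ex1 *)
definition val_extension ::
  "('a::right_ore_domain \<Rightarrow> 'g::linordered_group_add value_inf) \<Rightarrow> 'a ore_frac \<Rightarrow> 'g value_inf" where
  "val_extension v = (THE w. valuation w \<and> (\<forall>a. w (ore_embed a) = v a))"

lemma val_extension_ex1:
  fixes v :: "'a::right_ore_domain \<Rightarrow> 'g::linordered_group_add value_inf"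
  assumes v: "valuation v"
  shows "\<exists>!w. valuation w \<and> (\<forall>a. w (ore_embed a) = v a)"
proof (rule ex_ex1I)
  define \<nu> where "\<nu> a = (THE g. v a = Value g)" for a
  have \<nu>: "v a = Value (\<nu> a)" if "a \<noteq> 0" for a
  proof -
    from that v have "v a \<noteq> Infinity" by (simp add: valuation_def)
    then obtain g where "v a = Value g" by (cases "v a") auto
    thus ?thesis by (simp add: \<nu>_def)
  qed
  have v0: "v 0 = Infinity" using v by (simp add: valuation_def)
  have \<nu>m: "\<nu> (a * b) = \<nu> a + \<nu> b" if "a \<noteq> 0" "b \<noteq> 0" for a b
  proof -
    have "v (a * b) = v a + v b" using v by (simp add: valuation_def)
    with that show ?thesis by (simp add: \<nu>)
  qed
  have nz: "c \<noteq> 0" if "acts q d c" "d \<noteq> 0" "q \<noteq> 0" for q :: "'a ore_frac" and d c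
    using that acts_zero[of d] by (auto simp: acts_def split: if_splits)
  define w where "w q = (if q = 0 then Infinity else
      (THE x. \<exists>d c. d \<noteq> 0 \<and> acts q d c \<and> x = Value (\<nu> c - \<nu> d)))" for q
  have w: "w q = Value (\<nu> c - \<nu> d)" if h: "q \<noteq> 0" "d \<noteq> 0" "acts q d c" for q d c
  proof -
    have "(THE x. \<exists>d c. d \<noteq> 0 \<and> acts q d c \<and> x = Value (\<nu> c - \<nu> d)) = Value (\<nu> c - \<nu> d)"
    proof (rule the_equality)
      fix x assume "\<exists>d c. d \<noteq> 0 \<and> acts q d c \<and> x = Value (\<nu> c - \<nu> d)"
      then obtain d' c' where h': "d' \<noteq> 0" "acts q d' c'" and x: "x = Value (\<nu> c' - \<nu> d')" by blast
      obtain u u' where u: "d * u = d' * u'" "d * u \<noteq> 0" using h h' right_ore by blast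
      have c: "c * u = c' * u'" by (rule acts_common[OF h(2) h'(1) h(3) h'(2) u(1)])
      have n: "c \<noteq> 0" "c' \<noteq> 0" "u \<noteq> 0" "u' \<noteq> 0" using h h' nz u by auto
      have cancel: "\<nu> (c * u) - \<nu> (d * u) = \<nu> c - \<nu> d" if "c \<noteq> 0" "d \<noteq> 0" "u \<noteq> 0" for c d u
        using that by (simp add: \<nu>m diff_conv_add_uminus minus_add add.assoc del: add_uminus_conv_diff)
      have "\<nu> c' - \<nu> d' = \<nu> (c' * u') - \<nu> (d' * u')" using cancel n h' by simp
      also have "\<dots> = \<nu> c - \<nu> d" using cancel n h unfolding c[symmetric] u(1)[symmetric] by simp
      finally show "x = Value (\<nu> c - \<nu> d)" by (simp add: x)
    qed (use h in blast)
    with h show ?thesis by (simp add: w_def)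
  qed
  have "valuation w"
    unfolding valuation_def
  proof (intro conjI allI)
    fix p :: "'a ore_frac"
    obtain d c where "d \<noteq> 0" "acts p d c" by (rule acts_ex1)
    thus "w p = Infinity \<longleftrightarrow> p = 0" using w by (cases "p = 0") (auto simp: w_def)
  next
    fix p q :: "'a ore_frac"
    show "w (p * q) = w p + w q"
    proof (cases "p = 0 \<or> q = 0")
      case True
      then show ?thesis by (auto simp: w_def)
    next
      case False
      obtain d0 c0 where 0: "d0 \<noteq> 0" "acts q d0 c0" by (rule acts_ex1)
      obtain u e where u: "u \<noteq> 0" "acts p (c0 * u) e" by (rule acts_ex)
      define d c where "d = d0 * u" and "c = c0 * u"
      have q: "acts q d c" unfolding d_def c_def by (intro acts_mult 0)
      have p: "acts p c e" using u by (simp add: c_def)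
      have d: "d \<noteq> 0" using 0 u by (simp add: d_def)
      have c: "c \<noteq> 0" using nz[OF q d] False by simp
      have "w (p * q) = Value (\<nu> e - \<nu> d)" using False by (intro w acts_times[OF q p] d) auto
      also have "\<dots> = w p + w q" using w[OF _ c p] w[OF _ d q] False
        by (simp add: algebra_simps)
      finally show ?thesis .
    qed
  next
    fix p q :: "'a ore_frac"
    show "min (w p) (w q) \<le> w (p + q)"
    proof (cases "p = 0 \<or> q = 0 \<or> p + q = 0")
      case True
      then show ?thesis by (auto simp: w_def)
    next
      case False
      obtain d a b where d: "d \<noteq> 0" and p: "acts p d a" and q: "acts q d b" by (rule acts_ex2)
      have s: "acts (p + q) d (a + b)" by (rule acts_add[OF p q])
      have n: "a \<noteq> 0" "b \<noteq> 0" "a + b \<noteq> 0" using nz d p q s False by blast+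
      have "min (v a) (v b) \<le> v (a + b)" using v by (simp add: valuation_def)
      hence "\<nu> a \<le> \<nu> (a + b) \<or> \<nu> b \<le> \<nu> (a + b)" using n by (auto simp: \<nu> min_def split: if_splits)
      hence "\<nu> a - \<nu> d \<le> \<nu> (a + b) - \<nu> d \<or> \<nu> b - \<nu> d \<le> \<nu> (a + b) - \<nu> d"
        using add_le_right[of _ _ "- \<nu> d"] by auto
      then show ?thesis using w[OF _ d p] w[OF _ d q] w[OF _ d s] False by (auto simp: min_le_iff_disj)
    qed
  qed
  moreover have "w (ore_embed a) = v a" for a
  proof (cases "a = 0")
    case True
    then show ?thesis by (simp add: ore_embed_0 w_def v0)
  next
    case False
    hence "ore_embed a \<noteq> 0" by (metis ore_embed_0 ore_embed_eq_iff)
    moreover have "\<nu> 1 = 0"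
    proof -
      have "\<nu> 1 + \<nu> 1 = \<nu> 1 + 0" using \<nu>m[of 1 1] by simp
      thus ?thesis by (simp only: add_left_cancel)
    qed
    ultimately show ?thesis using w[of "ore_embed a" 1 a] acts_embed[of a 1] False by (simp add: \<nu>)
  qed
  ultimately show "\<exists>w. valuation w \<and> (\<forall>a. w (ore_embed a) = v a)" by blast
next
  fix w w' :: "'a ore_frac \<Rightarrow> 'g value_inf"
  assume w: "valuation w \<and> (\<forall>a. w (ore_embed a) = v a)" and w': "valuation w' \<and> (\<forall>a. w' (ore_embed a) = v a)"
  show "w = w'"
  proof
    fix q :: "'a ore_frac"
    obtain d c where d: "d \<noteq> 0" and "acts q d c" by (rule acts_ex1)
    hence e: "q * ore_embed d = ore_embed c" by (simp add: acts_iff_mult)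
    have "w q + v d = v c" "w' q + v d = v c"
      using w w' e unfolding valuation_def by metis+
    moreover from v d have "v d \<noteq> Infinity" by (simp add: valuation_def)
    ultimately show "w q = w' q"
      by (cases "w q"; cases "w' q"; cases "v d"; cases "v c") auto
  qed
qed

lemma
  assumes "valuation v"
  shows valuation_val_extension: "valuation (val_extension v)"
    and val_extension_embed: "val_extension v (ore_embed a) = v a"
  using theI'[OF val_extension_ex1[OF assms]] unfolding val_extension_def by auto

definition real_const :: "real \<Rightarrow> puiseux skew_poly ore_frac" where
  "real_const c = ore_embed (skew_const (pmonom c 0))"

definition puiseux_X :: puiseux where
  "puiseux_X = pmonom 1 (- 1)"

lemma pcoeff_pmonom: "pcoeff (pmonom c q) = (\<lambda>p. if p = q then c else 0)"
proof -
  obtain a b where ab: "quotient_of q = (a, b)" by (cases "quotient_of q")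
  have b: "b > 0" using quotient_of_denom_pos[OF ab] .
  have "nat b > 0" "q = rat_of_int a / rat_of_nat (nat b)" using b quotient_of_div[OF ab] by simp_all
  hence "(\<lambda>p. if p = q then c else 0) \<in> {f :: rat \<Rightarrow> real. \<exists>(n::nat) (m::int). n > 0 \<and>
      (\<forall>q. f q \<noteq> 0 \<longrightarrow> (\<exists>k\<ge>m. q = of_int k / of_nat n))}"
    unfolding mem_Collect_eq by (metis order_refl)
  thus ?thesis unfolding pmonom_def by (rule Abs_puiseux_inverse)
qed

lemma pd_puiseux_X: "pd puiseux_X = 1"
  by (rule puiseux_eqI) (simp add: pd_puiseux_def puiseux_X_def pcoeff_pderivative pcoeff_pmonom pcoeff_1)

lemma skew_Y_X: "skew_Y * skew_const puiseux_X - skew_const puiseux_X * skew_Y = 1"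
  by (simp add: skew_Y_commutation pd_puiseux_X) (simp add: skew_const_def one_skew_poly_def one_pCons)

(* Only the entries r i and gamma i with i >= 1 are used. *)
primrec zseq :: "(nat \<Rightarrow> rat) \<Rightarrow> (nat \<Rightarrow> real) \<Rightarrow> nat \<Rightarrow> puiseux skew_poly" where
  "zseq r \<gamma> 0 = skew_Y"
| "zseq r \<gamma> (Suc i) = zseq r \<gamma> i - skew_const (pmonom (\<gamma> (Suc i)) (r (Suc i)))"

(* The embedding phi of the rationals identifies the rational number q with the value phi q. *)
definition prescribed_valuation ::
  "(nat \<Rightarrow> rat) \<Rightarrow> (nat \<Rightarrow> real) \<Rightarrow> (rat \<Rightarrow> 'g) \<Rightarrow> (puiseux skew_poly \<Rightarrow> 'g::linordered_group_add value_inf) \<Rightarrow> bool" where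
  "prescribed_valuation r \<gamma> \<phi> v \<longleftrightarrow> valuation v \<and> residue_field_real real_const (val_extension v) \<and>
     v (skew_const puiseux_X) = Value (\<phi> (- 1)) \<and> (\<forall>i. v (zseq r \<gamma> i) = Value (\<phi> (r (Suc i))))"

definition ordered_embedding :: "('g::linordered_group_add \<Rightarrow> 'h::linordered_group_add) \<Rightarrow> bool" where
  "ordered_embedding \<phi> \<longleftrightarrow> strict_mono \<phi> \<and> (\<forall>p q. \<phi> (p + q) = \<phi> p + \<phi> q)"

end

(* Order Puiseux series by their lowest exponent in 1/x.  Every f in R[y;d/dx] can be expanded in
   powers of z_i; weighting z_i by r_(i+1), let d_i be the degree of the initial form of f.  Since
   d/dx raises the order by 1 > r_(i+1), initial forms multiply commutatively.  Passing from z_i to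
   z_(i+1) never increases d_i, and d_(i+1) = d_i = d > 0 forces the initial form to be
   c (T - gamma_(i+1))^d, so its coefficient at T^(d-1) is nonzero and r_(i+1) lies in (1/N)Z, where N
   is a common denominator of the exponents in the coefficients of f.  Then z_(i+1) keeps all exponents
   in (1/N)Z, and were d_i > 0 for all i, all later r_i would lie in (1/N)Z, which is impossible for a
   strictly increasing sequence bounded by 1.  So eventually a single monomial c x^(-a) dominates
   the expansion of f, and v(f) = a is the only possible choice.  Every nonzero quotient is likewise a
   monomial up to terms of higher value, and monomials commute; this gives the residue field and
   strong abelianness.  For uniqueness one also needs that a valuation with real residue field
   agrees with the order on Puiseux series: if e = e_0 + ... with e_0 > 0 had positive value, then
   e - e_0/2 would be a square whose residue is -e_0/2 < 0. *)

theory Submission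
  imports Defs
begin

section \<open>The order of a Puiseux series\<close>

text \<open>A lower bound instead of an order function: the zero series satisfies every bound, so
  sums and products need no case split.\<close>

definition ord_ge :: "puiseux \<Rightarrow> rat \<Rightarrow> bool" where
  "ord_ge f a \<longleftrightarrow> (\<forall>q<a. pcoeff f q = 0)"

lemma ord_ge_0 [simp]: "ord_ge 0 a"
  by (simp add: ord_ge_def pcoeff_0)

lemma ord_ge_add: "ord_ge f a \<Longrightarrow> ord_ge g a \<Longrightarrow> ord_ge (f + g) a"
  by (simp add: ord_ge_def pcoeff_add)

lemma ord_ge_mono: "ord_ge f a \<Longrightarrow> b \<le> a \<Longrightarrow> ord_ge f b"
  by (auto simp: ord_ge_def)

lemma ord_ge_D: "ord_ge f a \<Longrightarrow> pcoeff f q \<noteq> 0 \<Longrightarrow> a \<le> q"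
  by (auto simp: ord_ge_def not_less)

lemma ord_ge_pmonom: "ord_ge (pmonom c q) a \<longleftrightarrow> c = 0 \<or> a \<le> q"
  by (auto simp: ord_ge_def pcoeff_pmonom)

lemma pcoeff_mult_vanish:
  assumes "\<And>p. pcoeff f p \<noteq> 0 \<Longrightarrow> pcoeff g (q - p) = 0"
  shows "pcoeff (f * g) q = 0"
proof -
  have "{p. pcoeff f p \<noteq> 0 \<and> pcoeff g (q - p) \<noteq> 0} = {}" using assms by blast
  then show ?thesis by (simp only: pcoeff_mult sum.empty)
qed

lemma ord_ge_mult: 
  assumes "ord_ge f a" "ord_ge g b" shows "ord_ge (f * g) (a + b)"
  unfolding ord_ge_def
proof (intro allI impI pcoeff_mult_vanish)
  fix q p assume q: "q < a + b" "pcoeff f p \<noteq> 0"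
  hence "a \<le> p" using assms ord_ge_D by blast
  hence "q - p < b" using q by linarith
  with assms show "pcoeff g (q - p) = 0" by (simp add: ord_ge_def)
qed

text \<open>In the convolution an index \<open>p\<close> contributes only if \<open>p\<close> is at
  least \<open>a\<close> and \<open>a + b - p\<close> at least \<open>b\<close>, which leaves
  \<open>p = a\<close>.\<close>

lemma pcoeff_mult_lead:
  assumes "ord_ge f a" "ord_ge g b"
  shows "pcoeff (f * g) (a + b) = pcoeff f a * pcoeff g b"
proof -
  have "pcoeff (f * g) (a + b) = (\<Sum>p | pcoeff f p \<noteq> 0 \<and> pcoeff g (a + b - p) \<noteq> 0. pcoeff f p * pcoeff g (a + b - p))"
    by (rule pcoeff_mult)
  also have "\<dots> = (\<Sum>p\<in>{a}. pcoeff f p * pcoeff g (a + b - p))"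
  proof (rule sum.mono_neutral_left)
    show "{p. pcoeff f p \<noteq> 0 \<and> pcoeff g (a + b - p) \<noteq> 0} \<subseteq> {a}"
    proof clarify
      fix p assume p: "pcoeff f p \<noteq> 0" "pcoeff g (a + b - p) \<noteq> 0"
      hence "a \<le> p" "b \<le> a + b - p" using assms ord_ge_D by blast+
      thus "p = a" by linarith
    qed
  qed auto
  finally show ?thesis by simp
qed

text \<open>The derivative of x^(-q) is a multiple of x^(-q-1). This gain of 1 exceeds every slope
  used below and makes the noncommutativity harmless.\<close>

lemma ord_ge_pd: "ord_ge f a \<Longrightarrow> ord_ge (pd f) (a + 1)"
  by (simp add: ord_ge_def pd_puiseux_def pcoeff_pderivative)

lemma puiseux_order:
  assumes "f \<noteq> 0" obtains a where "ord_ge f a" "pcoeff f a \<noteq> 0"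
proof -
  obtain n F where n: "n > 0" "f = lau n F" by (rule lau1)
  with assms have F: "F \<noteq> 0" by (auto simp: zero_lau)
  let ?a = "rat_of_int (fls_subdegree F) / rat_of_nat n"
  have "ord_ge f ?a" unfolding ord_ge_def
  proof (intro allI impI)
    fix q assume q: "q < ?a"
    from n(1) show "pcoeff f q = 0"
    proof (cases rule: lau_cases[of n q])
      case (1 k)
      hence "k < fls_subdegree F" using q n by (simp add: divide_less_cancel)
      with 1 n show ?thesis by (simp add: pcoeff_lau lau_fun_of_int)
    qed (use n in \<open>simp add: pcoeff_lau\<close>)
  qed
  moreover have "pcoeff f ?a \<noteq> 0"
    using n F by (simp add: pcoeff_lau lau_fun_of_int nth_fls_subdegree_nonzero)
  ultimately show ?thesis by (rule that)
qed

lemma pmonom_mult: "pmonom c a * pmonom d b = pmonom (c * d) (a + b)"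
proof (rule puiseux_eqI)
  fix q
  show "pcoeff (pmonom c a * pmonom d b) q = pcoeff (pmonom (c * d) (a + b)) q"
  proof (cases "q = a + b")
    case True
    then show ?thesis using pcoeff_mult_lead[of "pmonom c a" a "pmonom d b" b]
      by (simp add: ord_ge_pmonom pcoeff_pmonom)
  next
    case False
    have "pcoeff (pmonom c a * pmonom d b) q = 0"
      by (rule pcoeff_mult_vanish) (use False in \<open>auto simp: pcoeff_pmonom split: if_splits\<close>)
    with False show ?thesis by (simp add: pcoeff_pmonom)
  qed
qed

lemma pmonom_0 [simp]: "pmonom 0 a = 0"
  by (rule puiseux_eqI) (simp add: pcoeff_pmonom pcoeff_0)

lemma pmonom_eq_0_iff: "pmonom c a = 0 \<longleftrightarrow> c = 0"
  by (metis pmonom_0 pcoeff_pmonom pcoeff_0)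

lemma pmonom_1 [simp]: "pmonom 1 0 = 1"
  by (rule puiseux_eqI) (simp add: pcoeff_pmonom pcoeff_1)

lemma pmonom_add: "pmonom (c + d) a = pmonom c a + pmonom d a"
  by (rule puiseux_eqI) (simp add: pcoeff_pmonom pcoeff_add)

text \<open>For a suitable \<open>n\<close> the series is a formal power series in x^(-1/n) with
  positive constant term, so the formal square root of power series applies.\<close>

lemma puiseux_sqrt:
  assumes "ord_ge f 0" "pcoeff f 0 > 0"
  obtains g where "g * g = f"
proof -
  obtain n F where n: "n > 0" "f = lau n F" by (rule lau1)
  have nth: "fls_nth F k = pcoeff f (of_int k / of_nat n)" for k
    using n by (simp add: pcoeff_lau lau_fun_of_int)
  have neg: "fls_nth F k = 0" if "k < 0" for k
    using assms(1) n that unfolding nth ord_ge_def by (simp add: divide_neg_pos)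
  have sub: "fls_subdegree F \<ge> 0"
    using neg[of "fls_subdegree F"] nth_fls_subdegree_nonzero[of F] by (cases "F = 0") force+
  define P where "P = fls_regpart F"
  have F: "F = fps_to_fls P" using sub by (simp add: P_def fls_regpart_to_fls_trivial)
  have "fps_nth P 0 > 0" using assms(2) nth[of 0] by (simp add: P_def)
  \<comment> \<open>Positivity of the constant term supplies its real square root; the index 1 in
    \<open>power_radical\<close> stands for the exponent \<open>Suc 1\<close>.\<close>
  hence "fps_radical root 2 P ^ 2 = P"
    using power_radical[of P root 1] real_root_pow_pos2[of 2 "fps_nth P 0"] by (simp add: numeral_2_eq_2)
  hence "fps_to_fls (fps_radical root 2 P) * fps_to_fls (fps_radical root 2 P) = F"
    by (simp add: F power2_eq_square flip: fls_times_fps_to_fls)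
  with n that[of "lau n (fps_to_fls (fps_radical root 2 P))"] show ?thesis
    by (simp add: mult_lau)
qed

section \<open>Common denominators of exponents\<close>

definition denom_dvd :: "nat \<Rightarrow> puiseux \<Rightarrow> bool" where
  "denom_dvd N f \<longleftrightarrow> (\<forall>q. pcoeff f q \<noteq> 0 \<longrightarrow> of_nat N * q \<in> \<int>)"

lemma denom_dvd_0 [simp]: "denom_dvd N 0"
  by (simp add: denom_dvd_def pcoeff_0)

lemma denom_dvd_add: "denom_dvd N f \<Longrightarrow> denom_dvd N g \<Longrightarrow> denom_dvd N (f + g)"
  unfolding denom_dvd_def pcoeff_add by (metis add_0)

lemma denom_dvd_mult:
  assumes "denom_dvd N f" "denom_dvd N g" shows "denom_dvd N (f * g)"
  unfolding denom_dvd_def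
proof (intro allI impI)
  fix q assume "pcoeff (f * g) q \<noteq> 0"
  then obtain p where "pcoeff f p \<noteq> 0" "pcoeff g (q - p) \<noteq> 0" using pcoeff_mult_vanish by blast
  hence "of_nat N * p \<in> \<int>" "of_nat N * (q - p) \<in> \<int>" using assms by (auto simp: denom_dvd_def)
  hence "of_nat N * p + of_nat N * (q - p) \<in> \<int>" by (rule Ints_add)
  thus "of_nat N * q \<in> \<int>" by (simp add: algebra_simps)
qed

lemma denom_dvd_pd:
  assumes "denom_dvd N f" shows "denom_dvd N (pd f)"
  unfolding denom_dvd_def
proof (intro allI impI)
  fix q assume "pcoeff (pd f) q \<noteq> 0"
  hence "of_nat N * (q - 1) \<in> \<int>" using assms by (auto simp: denom_dvd_def pd_puiseux_def pcoeff_pderivative)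
  hence "of_nat N * (q - 1) + of_nat N \<in> \<int>" by (intro Ints_add) auto
  thus "of_nat N * q \<in> \<int>" by (simp add: algebra_simps)
qed

lemma denom_dvd_pmonom: "of_nat N * q \<in> \<int> \<Longrightarrow> denom_dvd N (pmonom c q)"
  by (auto simp: denom_dvd_def pcoeff_pmonom)

lemma denom_dvd_trans:
  assumes "denom_dvd N f" "N dvd M" shows "denom_dvd M f"
proof -
  from assms(2) obtain d where "M = N * d" by auto
  hence "of_nat M * q = of_nat d * (of_nat N * q)" for q :: rat by simp
  with assms(1) show ?thesis by (metis denom_dvd_def Ints_mult Ints_of_nat)
qed

lemma denom_dvd_ex: obtains N where "N > 0" "denom_dvd N f"
proof -
  obtain n F where n: "n > 0" "f = lau n F" by (rule lau1)
  hence "denom_dvd n f"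
    by (auto simp: denom_dvd_def pcoeff_lau lau_fun_def mult.commute split: if_splits)
  with n that show ?thesis by blast
qed

lemma denom_dvd_poly:
  fixes P :: "puiseux poly"
  obtains N where "N > 0" "\<And>k. denom_dvd N (coeff P k)"
proof -
  have "\<exists>N>0. \<forall>k. denom_dvd N (coeff P k)"
  proof (induction P)
    case 0
    show ?case by (auto intro: exI[of _ 1])
  next
    case (pCons a P)
    then obtain N where N: "N > 0" "\<forall>k. denom_dvd N (coeff P k)" by blast
    obtain M where M: "M > 0" "denom_dvd M a" by (rule denom_dvd_ex)
    have "denom_dvd (M * N) (coeff (pCons a P) k)" for k
      using N M by (auto simp: coeff_pCons intro: denom_dvd_trans split: nat.split)
    with N M show ?case by (intro exI[of _ "M * N"]) auto
  qed
  with that show ?thesis by blast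
qed

section \<open>Coefficients and translations in the Ore extension\<close>

abbreviation scoeff :: "'a::zero skew_poly \<Rightarrow> nat \<Rightarrow> 'a" where
  "scoeff f \<equiv> coeff (left_coeffs f)"

lemma skew_poly_eqI: "(\<And>k. scoeff f k = scoeff g k) \<Longrightarrow> f = g"
  by (simp add: skew_poly_eq_iff poly_eq_iff)

lemma scoeff_0 [simp]: "scoeff 0 k = 0"
  by (simp add: zero_skew_poly_def)

lemma scoeff_add [simp]: "scoeff (f + g) k = scoeff f k + scoeff g k"
  by (simp add: plus_skew_poly_def)

lemma scoeff_diff [simp]: "scoeff (f - g) k = scoeff f k - scoeff g k"
  by (simp add: minus_skew_poly_def)

lemma scoeff_const [simp]: "scoeff (skew_const a) k = (if k = 0 then a else 0)"
  by (simp add: skew_const_def coeff_pCons split: nat.split)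

lemma scoeff_const_mult [simp]: "scoeff (skew_const a * f) k = a * scoeff f k"
  by (simp add: times_skew_poly_def skew_const_def skew_mult_def)

lemma scoeff_Y_mult: "scoeff (skew_Y * f) k = (case k of 0 \<Rightarrow> 0 | Suc j \<Rightarrow> scoeff f j) + pd (scoeff f k)"
  by (simp add: times_skew_poly_def skew_Y_def skew_mult_def y_times_def coeff_map_poly coeff_pCons)

text \<open>The coefficients of powers of y are constants with derivative zero, so y^i y is y^(i+1)
  without correction and right multiplication by y is a pure shift.\<close>

lemma scoeff_mult_Y [simp]: "scoeff (f * skew_Y) k = (case k of 0 \<Rightarrow> 0 | Suc j \<Rightarrow> scoeff f j)"
proof -
  have "(y_times ^^ i) [:0, 1:] = (monom 1 (Suc i) :: 'a poly)" for i
  proof -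
    have "y_times 1 = ([:0, 1:] :: 'a poly)" using y_times_pow_1[of 1] by (simp add: monom_Suc one_pCons)
    then show ?thesis using y_times_pow_1[of "Suc i", where 'a='a] by (simp add: funpow_swap1)
  qed
  hence "skew_mult (left_coeffs f) [:0, 1:] = (\<Sum>i\<le>degree (left_coeffs f). monom (scoeff f i) (Suc i))"
    by (simp add: skew_mult_def smult_monom)
  also have "\<dots> = pCons 0 (\<Sum>i\<le>degree (left_coeffs f). monom (scoeff f i) i)"
    by (rule poly_eqI) (simp add: coeff_sum coeff_pCons split: nat.split)
  finally show ?thesis
    by (simp add: times_skew_poly_def skew_Y_def poly_as_sum_of_monoms coeff_pCons)
qed

lemma scoeff_Y [simp]: "scoeff skew_Y k = (if k = 1 then 1 else 0)"
  by (auto simp: skew_Y_def coeff_pCons split: nat.split)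

lemma skew_const_0 [simp]: "skew_const 0 = 0"
  and skew_const_1: "skew_const 1 = 1"
  and skew_const_add: "skew_const (a + b) = skew_const a + skew_const b"
  and skew_const_diff: "skew_const (a - b) = skew_const a - skew_const b"
  and skew_const_mult: "skew_const (a * b) = skew_const a * skew_const b"
  by (rule skew_poly_eqI; simp add: one_skew_poly_def)+

lemma skew_const_eq_0_iff: "skew_const a = 0 \<longleftrightarrow> a = 0"
  by (metis scoeff_const scoeff_0 skew_const_0)

text \<open>A factor y split off on the right shifts the left coefficients without involving the
  derivation, so this is induction over the coefficient list.\<close>

lemma skew_poly_horner_induct [case_names 0 horner]:
  assumes "P 0" and step: "\<And>a g. P g \<Longrightarrow> P (skew_const a + g * skew_Y)"
  shows "P (f :: 'a::differential_ring skew_poly)"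
proof -
  have "P (Abs_skew_poly p)" for p
  proof (induction p)
    case 0
    show ?case using assms(1) by (simp add: zero_skew_poly_def)
  next
    case (pCons a p)
    have "Abs_skew_poly (pCons a p) = skew_const a + Abs_skew_poly p * skew_Y"
      by (rule skew_poly_eqI) (simp add: coeff_pCons split: nat.split)
    with step pCons show ?case by simp
  qed
  from this[of "left_coeffs f"] show ?thesis by (simp add: left_coeffs_inverse)
qed

text \<open>The substitution of y + s for y, by Horner's scheme. Since y = (y - s) + s, the
  coefficients of \<open>translate s f\<close> are those of the expansion of \<open>f\<close> in
  powers of y - s.\<close>

definition translate :: "'a::differential_ring \<Rightarrow> 'a skew_poly \<Rightarrow> 'a skew_poly" where
  "translate s f = fold_coeffs (\<lambda>a g. skew_const a + g * (skew_Y + skew_const s)) (left_coeffs f) 0"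

lemma translate_0 [simp]: "translate s 0 = 0"
  by (simp add: translate_def zero_skew_poly_def)

lemma translate_horner:
  "translate s (skew_const a + g * skew_Y) = skew_const a + translate s g * (skew_Y + skew_const s)"
proof -
  have "left_coeffs (skew_const a + g * skew_Y) = pCons a (left_coeffs g)"
    by (rule poly_eqI) (simp only: scoeff_add scoeff_const scoeff_mult_Y coeff_pCons split: nat.split, simp)
  moreover have "left_coeffs g = 0 \<longleftrightarrow> g = 0" 
    by (simp add: skew_poly_eq_iff zero_skew_poly_def)
  \<comment> \<open>\<open>fold_coeffs\<close> unfolds \<open>pCons a p\<close> only if
    \<open>a\<close> or \<open>p\<close> is nonzero; in the remaining case both sides are
    zero.\<close>
  ultimately show ?thesis
    by (cases "a = 0 \<and> g = 0") (auto simp: translate_def)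
qed

lemma translate_const [simp]: "translate s (skew_const a) = skew_const a"
  using translate_horner[of s a 0] by simp

lemma translate_Y [simp]: "translate s skew_Y = skew_Y + skew_const s"
  using translate_horner[of s 0 1] translate_const[of s 1] by (simp add: skew_const_1)

lemma translate_add: "translate s (f + g) = translate s f + translate s g"
proof (induction f arbitrary: g rule: skew_poly_horner_induct)
  case (horner a f)
  \<comment> \<open>The second summand is also put into Horner form; the induction rule serves here
    as a case distinction.\<close>
  have "\<exists>b g'. g = skew_const b + g' * skew_Y"
    by (induction g rule: skew_poly_horner_induct) (metis skew_const_0 mult_zero_left add_0, blast)
  then obtain b g' where g: "g = skew_const b + g' * skew_Y" by blast
  have "skew_const a + f * skew_Y + g = skew_const (a + b) + (f + g') * skew_Y"
    by (simp add: g skew_const_add distrib_right)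
  then show ?case
    by (simp only: g translate_horner horner) (simp add: skew_const_add distrib_right)
qed simp

lemma translate_const_mult: "translate s (skew_const a * f) = skew_const a * translate s f"
proof (induction f rule: skew_poly_horner_induct)
  case (horner b f)
  have "skew_const a * (skew_const b + f * skew_Y) = skew_const (a * b) + (skew_const a * f) * skew_Y"
    by (simp add: skew_const_mult distrib_left mult.assoc)
  then show ?case
    by (simp only: translate_horner horner) (simp add: skew_const_mult distrib_left mult.assoc)
qed simp

lemma skew_const_commute: "skew_const a * skew_const b = skew_const b * skew_const a"
  by (metis mult.commute skew_const_mult)

text \<open>Since s commutes with every coefficient a, (y + s) a = a (y + s) + a', the same rule
  that y satisfies. This makes the substitution multiplicative.\<close>

lemma translate_Y_mult: "translate s (skew_Y * f) = (skew_Y + skew_const s) * translate s f"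
proof (induction f rule: skew_poly_horner_induct)
  case (horner b f)
  have "skew_Y * (skew_const b + f * skew_Y) = skew_const (pd b) + (skew_const b + skew_Y * f) * skew_Y"
    by (simp add: distrib_left distrib_right skew_Y_commutation mult.assoc[symmetric])
  hence "translate s (skew_Y * (skew_const b + f * skew_Y)) = skew_const (pd b) +
      (skew_const b + (skew_Y + skew_const s) * translate s f) * (skew_Y + skew_const s)"
    by (simp only: translate_horner translate_add[of s "skew_const b"] translate_const horner)
  then show ?case
    by (simp add: translate_horner skew_Y_commutation distrib_left distrib_right mult.assoc skew_const_commute[of s b])
qed simp

text \<open>The last factor y of the left operand is moved over to \<open>g\<close>, so the
  induction needs \<open>g\<close> arbitrary.\<close>

lemma translate_mult: "translate s (f * g) = translate s f * translate s g"
proof (induction f arbitrary: g rule: skew_poly_horner_induct)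
  case (horner a f)
  have "(skew_const a + f * skew_Y) * g = skew_const a * g + f * (skew_Y * g)"
    by (simp add: distrib_right mult.assoc)
  then show ?case
    by (simp add: translate_horner translate_add translate_const_mult horner translate_Y_mult distrib_right mult.assoc)
qed simp

text \<open>Translations form an action of the additive group of coefficients; in particular
  translation by -s undoes translation by s.\<close>

lemma translate_translate: "translate s (translate t f) = translate (s + t) f"
proof (induction f rule: skew_poly_horner_induct)
  case (horner a f)
  then show ?case
    by (simp add: translate_horner translate_add translate_mult skew_const_add add.assoc)
qed simp

lemma translate_by_0 [simp]: "translate 0 f = f"
  by (induction f rule: skew_poly_horner_induct) (simp_all add: translate_horner)

lemma translate_eq_0_iff: "translate s f = 0 \<longleftrightarrow> f = 0"
  by (metis translate_0 translate_translate translate_by_0 left_minus)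

lemma translate_diff: "translate s (f - g) = translate s f - translate s g"
  by (metis translate_add diff_add_cancel add_diff_cancel_right')

lemma degree_left_coeffs_horner:
  assumes "degree (left_coeffs (skew_const a + g * skew_Y)) \<le> Suc d"
  shows "degree (left_coeffs g) \<le> d"
proof (rule degree_le, intro allI impI)
  fix k assume "d < k"
  hence "scoeff (skew_const a + g * skew_Y) (Suc k) = 0" using assms by (intro coeff_eq_0) simp
  thus "scoeff g k = 0" by simp
qed

text \<open>As for a binomial, (y + s)^d = y^d + d s y^(d-1) plus terms of degree at most d - 2;
  derivatives of s occur only among the latter.\<close>

lemma translate_lead:
  assumes "degree (left_coeffs f) \<le> d"
  shows "degree (left_coeffs (translate s f)) \<le> d"
    and "scoeff (translate s f) d = scoeff f d"
    and "d > 0 \<Longrightarrow> scoeff (translate s f) (d - 1) = scoeff f (d - 1) + of_nat d * s * scoeff f d"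
proof -
  have "degree (left_coeffs (translate s f)) \<le> d \<and> scoeff (translate s f) d = scoeff f d \<and>
    (d > 0 \<longrightarrow> scoeff (translate s f) (d - 1) = scoeff f (d - 1) + of_nat d * s * scoeff f d)"
    using assms
  proof (induction f arbitrary: d rule: skew_poly_horner_induct)
    case 0
    have "left_coeffs 0 = (0 :: 'a poly)" by (simp add: zero_skew_poly_def)
    then show ?case by simp
  next
    case (horner a f)
    show ?case
    proof (cases d)
      case 0
      have "f = 0"
      proof (rule skew_poly_eqI)
        fix k
        have "scoeff (skew_const a + f * skew_Y) (Suc k) = 0"
          using horner.prems 0 by (intro coeff_eq_0) simp
        thus "scoeff f k = scoeff 0 k" by simp
      qed
      moreover have "left_coeffs (skew_const a) = [:a:]" by (simp add: skew_const_def)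
      ultimately show ?thesis using 0 by simp
    next
      case (Suc e)
      have d: "degree (left_coeffs f) \<le> e"
        using horner.prems unfolding Suc by (rule degree_left_coeffs_horner)
      note IH = horner.IH[OF d]
      \<comment> \<open>Moving s to the left past powers of y creates derivatives of s in lower
        degrees only, so the top coefficient is just multiplied by s.\<close>
      let ?h = "translate s f"
      have s: "degree (left_coeffs (?h * skew_const s)) \<le> e" "scoeff (?h * skew_const s) e = scoeff ?h e * s"
        using skew_mult_lead[of "left_coeffs ?h" e "[:s:]" 0] IH by (simp_all add: times_skew_poly_def skew_const_def)
      have z: "scoeff ?h k = 0" "scoeff (?h * skew_const s) k = 0" if "k > e" for k
        using that IH s(1) by (auto intro: coeff_eq_0)
      have t: "translate s (skew_const a + f * skew_Y) = skew_const a + ?h * skew_Y + ?h * skew_const s"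
        by (simp add: translate_horner distrib_left add.assoc)
      have "degree (left_coeffs (translate s (skew_const a + f * skew_Y))) \<le> d"
        unfolding t by (rule degree_le) (auto simp: z Suc split: nat.split)
      moreover have "scoeff (translate s (skew_const a + f * skew_Y)) d = scoeff (skew_const a + f * skew_Y) d"
        using IH by (simp add: t Suc z)
      moreover have "scoeff (translate s (skew_const a + f * skew_Y)) e
          = scoeff (skew_const a + f * skew_Y) e + of_nat d * s * scoeff (skew_const a + f * skew_Y) d"
        using IH s(2) by (cases e) (simp_all add: t Suc algebra_simps)
      ultimately show ?thesis by (simp add: Suc)
    qed
  qed
  thus "degree (left_coeffs (translate s f)) \<le> d" "scoeff (translate s f) d = scoeff f d"
    "d > 0 \<Longrightarrow> scoeff (translate s f) (d - 1) = scoeff f (d - 1) + of_nat d * s * scoeff f d"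
    by blast+
qed

section \<open>Initial forms\<close>

text \<open>The weight of x^(-a) y^k is a + k \<rho>, the value it has once y is given the value
  \<rho>.\<close>

definition weight_ge :: "rat \<Rightarrow> rat \<Rightarrow> puiseux skew_poly \<Rightarrow> bool" where
  "weight_ge \<rho> \<alpha> f \<longleftrightarrow> (\<forall>k. ord_ge (scoeff f k) (\<alpha> - of_nat k * \<rho>))"

lemma weight_ge_0 [simp]: "weight_ge \<rho> \<alpha> 0"
  by (simp add: weight_ge_def)

lemma weight_ge_add: "weight_ge \<rho> \<alpha> f \<Longrightarrow> weight_ge \<rho> \<alpha> g \<Longrightarrow> weight_ge \<rho> \<alpha> (f + g)"
  by (simp add: weight_ge_def ord_ge_add)

lemma weight_ge_diff: "weight_ge \<rho> \<alpha> f \<Longrightarrow> weight_ge \<rho> \<alpha> g \<Longrightarrow> weight_ge \<rho> \<alpha> (f - g)"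
  by (simp add: weight_ge_def ord_ge_def pcoeff_minus)

lemma weight_ge_mono: "weight_ge \<rho> \<alpha> f \<Longrightarrow> \<beta> \<le> \<alpha> \<Longrightarrow> weight_ge \<rho> \<beta> f"
  unfolding weight_ge_def by (meson diff_right_mono ord_ge_mono)

lemma weight_ge_mono_slope:
  assumes "weight_ge \<rho> \<alpha> f" "\<rho> \<le> \<rho>'" shows "weight_ge \<rho>' \<alpha> f"
  unfolding weight_ge_def
proof
  fix k
  have "of_nat k * \<rho> \<le> of_nat k * \<rho>'" using assms(2) by (intro mult_left_mono) auto
  thus "ord_ge (scoeff f k) (\<alpha> - of_nat k * \<rho>')"
    using assms(1) unfolding weight_ge_def by (meson diff_left_mono ord_ge_mono)
qed

lemma weight_ge_const: "weight_ge \<rho> \<alpha> (skew_const a) \<longleftrightarrow> ord_ge a \<alpha>"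
  by (auto simp: weight_ge_def)

lemma weight_ge_Y: "\<alpha> \<le> \<rho> \<Longrightarrow> weight_ge \<rho> \<alpha> skew_Y"
  using ord_ge_pmonom[of 1 0] by (simp add: weight_ge_def)

lemma weight_ge_const_mult:
  assumes "ord_ge a \<alpha>" "weight_ge \<rho> \<beta> f" shows "weight_ge \<rho> (\<alpha> + \<beta>) (skew_const a * f)"
  using assms ord_ge_mult by (simp add: weight_ge_def add_diff_eq[symmetric])

text \<open>In y p y^k = p y^(k+1) + p' y^k the first term gains \<rho> in weight and the second
  gains 1, so \<rho> at most 1 is what the bound asks for.\<close>

lemma weight_ge_Y_mult:
  assumes "weight_ge \<rho> \<beta> f" "\<rho> \<le> 1" shows "weight_ge \<rho> (\<rho> + \<beta>) (skew_Y * f)"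
  unfolding weight_ge_def scoeff_Y_mult
proof
  fix k
  have f: "ord_ge (scoeff f j) (\<beta> - of_nat j * \<rho>)" for j using assms(1) by (simp add: weight_ge_def)
  have "ord_ge (pd (scoeff f k)) (\<beta> - of_nat k * \<rho> + 1)" by (rule ord_ge_pd[OF f])
  hence "ord_ge (pd (scoeff f k)) (\<rho> + \<beta> - of_nat k * \<rho>)" by (rule ord_ge_mono) (use assms in simp)
  moreover have "ord_ge (case k of 0 \<Rightarrow> 0 | Suc j \<Rightarrow> scoeff f j) (\<rho> + \<beta> - of_nat k * \<rho>)"
    using f by (simp add: algebra_simps split: nat.split)
  ultimately show "ord_ge ((case k of 0 \<Rightarrow> 0 | Suc j \<Rightarrow> scoeff f j) + pd (scoeff f k)) (\<rho> + \<beta> - of_nat k * \<rho>)"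
    by (rule ord_ge_add[rotated])
qed

lemma weight_ge_horner:
  "weight_ge \<rho> \<alpha> (skew_const a + g * skew_Y) \<longleftrightarrow> ord_ge a \<alpha> \<and> weight_ge \<rho> (\<alpha> - \<rho>) g"
proof
  assume h: "weight_ge \<rho> \<alpha> (skew_const a + g * skew_Y)"
  have "ord_ge (scoeff (skew_const a + g * skew_Y) k) (\<alpha> - of_nat k * \<rho>)" for k
    using h by (simp only: weight_ge_def)
  from this[of 0] this[of "Suc _"] show "ord_ge a \<alpha> \<and> weight_ge \<rho> (\<alpha> - \<rho>) g"
    by (simp add: weight_ge_def algebra_simps)
qed (auto simp: weight_ge_def algebra_simps split: nat.split)

text \<open>The factor y again passes from the left operand to the right one: the bound for
  \<open>f\<close> drops by \<rho> and that for \<open>g\<close> rises by \<rho>.\<close>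

lemma weight_ge_mult:
  assumes "weight_ge \<rho> \<alpha> f" "weight_ge \<rho> \<beta> g" "\<rho> \<le> 1"
  shows "weight_ge \<rho> (\<alpha> + \<beta>) (f * g)"
  using assms(1,2)
proof (induction f arbitrary: \<alpha> \<beta> g rule: skew_poly_horner_induct)
  case (horner a f)
  have "weight_ge \<rho> ((\<alpha> - \<rho>) + (\<rho> + \<beta>)) (f * (skew_Y * g))"
    using horner.prems by (intro horner.IH weight_ge_Y_mult assms) (auto simp: weight_ge_horner)
  moreover have "weight_ge \<rho> (\<alpha> + \<beta>) (skew_const a * g)"
    using horner.prems by (intro weight_ge_const_mult) (auto simp: weight_ge_horner)
  ultimately show ?case using weight_ge_add by (simp add: distrib_right mult.assoc)
qed simp

text \<open>The new variable y + s still has weight at least \<rho>, because s has order at least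
  \<rho>.\<close>

lemma weight_ge_translate:
  assumes "weight_ge \<rho> \<alpha> f" "ord_ge s \<rho>" "\<rho> \<le> 1"
  shows "weight_ge \<rho> \<alpha> (translate s f)"
  using assms(1)
proof (induction f arbitrary: \<alpha> rule: skew_poly_horner_induct)
  case (horner a f)
  have "weight_ge \<rho> ((\<alpha> - \<rho>) + \<rho>) (translate s f * (skew_Y + skew_const s))"
    using horner assms
    by (intro weight_ge_mult weight_ge_add weight_ge_Y) (auto simp: weight_ge_horner weight_ge_const)
  then show ?case using horner.prems
    by (simp add: translate_horner weight_ge_add weight_ge_const weight_ge_horner)
qed simp

text \<open>The coefficient of \<open>T\<^sup>k\<close> in the initial form of \<open>f\<close>, where \<open>y\<close> stands for \<open>T x\<^sup>-\<^sup>\<rho>\<close>.\<close>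

definition initial_coeff :: "rat \<Rightarrow> rat \<Rightarrow> puiseux skew_poly \<Rightarrow> nat \<Rightarrow> real" where
  "initial_coeff \<rho> \<alpha> f k = pcoeff (scoeff f k) (\<alpha> - of_nat k * \<rho>)"

lemma initial_coeff_add: "initial_coeff \<rho> \<alpha> (f + g) k = initial_coeff \<rho> \<alpha> f k + initial_coeff \<rho> \<alpha> g k"
  by (simp add: initial_coeff_def pcoeff_add)

lemma initial_coeff_weight_gt: "weight_ge \<rho> \<beta> f \<Longrightarrow> \<alpha> < \<beta> \<Longrightarrow> initial_coeff \<rho> \<alpha> f k = 0"
  by (auto simp: initial_coeff_def weight_ge_def ord_ge_def)

text \<open>The left side bounds the order of the coefficient of y^k from below, and the right side
  is an exponent occurring in it. This compares the initial forms of one element for two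
  slopes.\<close>

lemma weight_geD:
  "weight_ge \<rho> \<alpha> f \<Longrightarrow> initial_coeff \<rho>' \<alpha>' f k \<noteq> 0 \<Longrightarrow> \<alpha> - of_nat k * \<rho> \<le> \<alpha>' - of_nat k * \<rho>'"
  unfolding initial_coeff_def weight_ge_def by (blast intro: ord_ge_D)

lemma ord_ge_improve:
  assumes "ord_ge f a" "pcoeff f a = 0" obtains b where "b > a" "ord_ge f b"
proof (cases "f = 0")
  case True
  with that[of "a + 1"] show ?thesis by simp
next
  case False
  then obtain b where b: "ord_ge f b" "pcoeff f b \<noteq> 0" by (rule puiseux_order)
  with assms have "b > a" by (metis ord_ge_D order.not_eq_order_implies_strict)
  with b that show ?thesis by blast
qed

text \<open>If the initial form vanishes, each of the finitely many coefficients admits a strictly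
  better bound, and the minimum of the gains is still positive.\<close>

lemma weight_ge_improve:
  assumes "weight_ge \<rho> \<alpha> f" "\<And>k. initial_coeff \<rho> \<alpha> f k = 0"
  obtains \<beta> where "\<beta> > \<alpha>" "weight_ge \<rho> \<beta> f"
proof -
  have "\<exists>\<beta>>\<alpha>. weight_ge \<rho> \<beta> f" using assms
  proof (induction f arbitrary: \<alpha> rule: skew_poly_horner_induct)
    case 0
    show ?case by (auto intro: exI[of _ "\<alpha> + 1"])
  next
    case (horner a f)
    have "initial_coeff \<rho> (\<alpha> - \<rho>) f k = 0" for k
      using horner.prems(2)[of "Suc k"] by (simp add: initial_coeff_def algebra_simps)
    moreover have "weight_ge \<rho> (\<alpha> - \<rho>) f" using horner.prems(1) by (simp add: weight_ge_horner)
    ultimately obtain \<beta>1 where 1: "\<beta>1 > \<alpha> - \<rho>" "weight_ge \<rho> \<beta>1 f" using horner.IH by blast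
    have "ord_ge a \<alpha>" "pcoeff a \<alpha> = 0"
      using horner.prems(1) horner.prems(2)[of 0] by (auto simp: weight_ge_horner initial_coeff_def)
    then obtain \<beta>0 where 0: "\<beta>0 > \<alpha>" "ord_ge a \<beta>0" by (rule ord_ge_improve)
    let ?\<beta> = "min \<beta>0 (\<beta>1 + \<rho>)"
    have "?\<beta> - \<rho> \<le> \<beta>1" by simp
    with 1 have "weight_ge \<rho> (?\<beta> - \<rho>) f" using weight_ge_mono by blast
    moreover have "ord_ge a ?\<beta>" using 0 ord_ge_mono by auto
    moreover have "?\<beta> > \<alpha>" using 0 1 by auto
    ultimately show ?case unfolding weight_ge_horner by blast
  qed
  with that show ?thesis by blast
qed

text \<open>The degree in T of the initial form; the nonzero coefficient makes \<alpha> the exact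
  weight. A relation is used because zero has neither degree nor weight.\<close>

definition initial_degree :: "rat \<Rightarrow> rat \<Rightarrow> puiseux skew_poly \<Rightarrow> nat \<Rightarrow> bool" where
  "initial_degree \<rho> \<alpha> f d \<longleftrightarrow> weight_ge \<rho> \<alpha> f \<and> initial_coeff \<rho> \<alpha> f d \<noteq> 0 \<and>
     (\<forall>k>d. initial_coeff \<rho> \<alpha> f k = 0)"

lemma initial_degree_exists:
  assumes "f \<noteq> 0" obtains \<alpha> d where "initial_degree \<rho> \<alpha> f d"
proof -
  let ?S = "{k. scoeff f k \<noteq> 0}"
  have "?S \<subseteq> {..degree (left_coeffs f)}" by (auto intro: le_degree)
  hence fin: "finite ?S" by (rule finite_subset) simp
  have ne: "?S \<noteq> {}" using assms skew_poly_eqI[of f 0] by auto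
  have "\<forall>k. \<exists>a. scoeff f k \<noteq> 0 \<longrightarrow> ord_ge (scoeff f k) a \<and> pcoeff (scoeff f k) a \<noteq> 0"
    using puiseux_order by metis
  from choice[OF this] obtain \<nu> where \<nu>: "\<And>k. scoeff f k \<noteq> 0 \<Longrightarrow> ord_ge (scoeff f k) (\<nu> k)"
    "\<And>k. scoeff f k \<noteq> 0 \<Longrightarrow> pcoeff (scoeff f k) (\<nu> k) \<noteq> 0" by blast
  define \<alpha> where "\<alpha> = Min ((\<lambda>k. \<nu> k + of_nat k * \<rho>) ` ?S)"
  have le: "\<alpha> \<le> \<nu> k + of_nat k * \<rho>" if "k \<in> ?S" for k
    unfolding \<alpha>_def using fin that by (intro Min_le) auto
  have "\<alpha> \<in> (\<lambda>k. \<nu> k + of_nat k * \<rho>) ` ?S" unfolding \<alpha>_def using fin ne by (intro Min_in) auto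
  then obtain k0 where k0: "k0 \<in> ?S" "\<alpha> = \<nu> k0 + of_nat k0 * \<rho>" by blast
  have w: "weight_ge \<rho> \<alpha> f" unfolding weight_ge_def
  proof
    fix k
    show "ord_ge (scoeff f k) (\<alpha> - of_nat k * \<rho>)"
    proof (cases "k \<in> ?S")
      case True
      with le[of k] have "\<alpha> - of_nat k * \<rho> \<le> \<nu> k" by simp
      with \<nu>(1)[of k] True show ?thesis using ord_ge_mono by blast
    qed simp
  qed
  let ?I = "{k. initial_coeff \<rho> \<alpha> f k \<noteq> 0}"
  have "?I \<subseteq> ?S" by (auto simp: initial_coeff_def pcoeff_0)
  hence finI: "finite ?I" using fin by (rule finite_subset)
  have "k0 \<in> ?I" using k0 \<nu>(2) by (auto simp: initial_coeff_def)
  hence "Max ?I \<in> ?I" using finI by (intro Max_in) auto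
  then obtain d where d: "d = Max ?I" "initial_coeff \<rho> \<alpha> f d \<noteq> 0" by blast
  have "initial_coeff \<rho> \<alpha> f k = 0" if "k > d" for k
    using Max_ge[OF finI, of k] that unfolding d(1) by (meson mem_Collect_eq not_le)
  hence "initial_degree \<rho> \<alpha> f d" using w d(2) unfolding initial_degree_def by blast
  then show ?thesis by (rule that)
qed

text \<open>On its two top coefficients, translation acts on the initial form as the substitution of
  T + c for T, with c the coefficient of x^(-\<rho>) in \<open>s\<close>.\<close>

lemma initial_coeff_translate:
  assumes w: "weight_ge \<rho> \<alpha> f" and z: "\<And>k. k > d \<Longrightarrow> initial_coeff \<rho> \<alpha> f k = 0"
    and s: "ord_ge s \<rho>" and \<rho>: "\<rho> \<le> 1"
  shows "k > d \<Longrightarrow> initial_coeff \<rho> \<alpha> (translate s f) k = 0"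
    and "initial_coeff \<rho> \<alpha> (translate s f) d = initial_coeff \<rho> \<alpha> f d"
    and "d > 0 \<Longrightarrow> initial_coeff \<rho> \<alpha> (translate s f) (d - 1)
      = initial_coeff \<rho> \<alpha> f (d - 1) + of_nat d * pcoeff s \<rho> * initial_coeff \<rho> \<alpha> f d"
proof -
  \<comment> \<open>Above degree \<open>d\<close> every term of \<open>f\<close> has strictly larger
    weight. Cutting these terms off leaves the initial form of the translate unchanged and makes
    \<open>translate_lead\<close> applicable.\<close>
  define g where "g = Abs_skew_poly (poly_cutoff (Suc d) (left_coeffs f))"
  have g: "scoeff g k = (if k \<le> d then scoeff f k else 0)" for k
    by (simp add: g_def coeff_poly_cutoff less_Suc_eq_le)
  have wg: "weight_ge \<rho> \<alpha> g" using w by (simp add: weight_ge_def g)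
  have "weight_ge \<rho> \<alpha> (f - g)" using w by (simp add: weight_ge_def g)
  moreover have "initial_coeff \<rho> \<alpha> (f - g) k = 0" for k
    using z[of k] by (simp add: initial_coeff_def g pcoeff_0)
  ultimately obtain \<beta> where \<beta>: "\<beta> > \<alpha>" "weight_ge \<rho> \<beta> (f - g)" by (rule weight_ge_improve)
  hence "weight_ge \<rho> \<beta> (translate s (f - g))" by (intro weight_ge_translate s \<rho>)
  hence t: "initial_coeff \<rho> \<alpha> (translate s f) k = initial_coeff \<rho> \<alpha> (translate s g) k" for k
    using initial_coeff_add[of \<rho> \<alpha> "translate s (f - g)" "translate s g" k] initial_coeff_weight_gt \<beta>(1)
    by (simp add: translate_diff)
  have d: "degree (left_coeffs g) \<le> d" by (rule degree_le) (simp add: g)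
  note l = translate_lead[OF d, of s]
  show "initial_coeff \<rho> \<alpha> (translate s f) k = 0" if "k > d"
    unfolding t using l(1) that by (simp add: initial_coeff_def coeff_eq_0 pcoeff_0)
  show "initial_coeff \<rho> \<alpha> (translate s f) d = initial_coeff \<rho> \<alpha> f d"
    by (simp add: t) (simp add: initial_coeff_def l g)
  assume d0: "d > 0"
  \<comment> \<open>The integer factor is written as a monomial of order 0, so that
    \<open>pcoeff_mult_lead\<close> covers it too.\<close>
  have c: "of_nat n * a = pmonom (of_nat n) 0 * a" for n a
  proof -
    have "of_nat n = pmonom (of_nat n) 0" by (induction n) (simp_all add: pmonom_add)
    thus ?thesis by simp
  qed
  \<comment> \<open>The exponent is split into the order bounds of the three factors d, s and the
    coefficient of y^d.\<close>
  have e: "\<alpha> - of_nat (d - 1) * \<rho> = 0 + \<rho> + (\<alpha> - of_nat d * \<rho>)"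
    using d0 by (simp add: of_nat_diff algebra_simps)
  have o: "ord_ge (scoeff f d) (\<alpha> - of_nat d * \<rho>)" using w by (simp add: weight_ge_def)
  have p: "ord_ge (pmonom (of_nat d) 0) 0" by (simp add: ord_ge_pmonom)
  have "pcoeff (of_nat d * s * scoeff f d) (\<alpha> - of_nat (d - 1) * \<rho>)
      = of_nat d * pcoeff s \<rho> * initial_coeff \<rho> \<alpha> f d"
    unfolding e c
    by (subst pcoeff_mult_lead[OF ord_ge_mult[OF p s] o], subst pcoeff_mult_lead[OF p s])
      (simp add: pcoeff_pmonom initial_coeff_def)
  thus "initial_coeff \<rho> \<alpha> (translate s f) (d - 1)
      = initial_coeff \<rho> \<alpha> f (d - 1) + of_nat d * pcoeff s \<rho> * initial_coeff \<rho> \<alpha> f d"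
    unfolding t unfolding initial_coeff_def l(3)[OF d0] by (simp add: g pcoeff_add)
qed

text \<open>A steeper slope favours lower powers of y, so the degree cannot grow. If it stays at
  \<open>d\<close>, the translated initial form has no term in T^(d-1); the translation formula then
  makes the original coefficient there -d c times the top one, with c as in
  \<open>initial_coeff_translate\<close>.\<close>

lemma initial_degree_translate:
  assumes f: "initial_degree \<rho> \<alpha> f d" and s: "ord_ge s \<rho>" and \<rho>: "\<rho> < \<rho>'" "\<rho> \<le> 1"
  obtains \<alpha>' d' where "initial_degree \<rho>' \<alpha>' (translate s f) d'" "d' \<le> d"
    "d' = d \<Longrightarrow> 0 < d \<Longrightarrow> pcoeff s \<rho> \<noteq> 0 \<Longrightarrow> initial_coeff \<rho> \<alpha> f (d - 1) \<noteq> 0"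
proof -
  let ?h = "translate s f"
  have fw: "weight_ge \<rho> \<alpha> f" and fd: "initial_coeff \<rho> \<alpha> f d \<noteq> 0"
    and fk: "\<And>k. k > d \<Longrightarrow> initial_coeff \<rho> \<alpha> f k = 0" using f by (auto simp: initial_degree_def)
  note t = initial_coeff_translate[OF fw fk s \<rho>(2)]
  have hw: "weight_ge \<rho> \<alpha> ?h" by (intro weight_ge_translate fw s \<rho>)
  have hd: "initial_coeff \<rho> \<alpha> ?h d \<noteq> 0" using t(2) fd by simp
  hence "?h \<noteq> 0" by (auto simp: initial_coeff_def pcoeff_0)
  then obtain \<alpha>' d' where h: "initial_degree \<rho>' \<alpha>' ?h d'" by (rule initial_degree_exists)
  hence hw': "weight_ge \<rho>' \<alpha>' ?h" and hd': "initial_coeff \<rho>' \<alpha>' ?h d' \<noteq> 0" by (auto simp: initial_degree_def)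
  \<comment> \<open>With \<delta> = \<rho>' - \<rho>, the next two facts say that \<alpha>' -
    \<alpha> is at most d \<delta> and at least d' \<delta>.\<close>
  have 1: "\<alpha>' - of_nat d * \<rho>' \<le> \<alpha> - of_nat d * \<rho>" using weight_geD[OF hw' hd] .
  have 2: "\<alpha> - of_nat d' * \<rho> \<le> \<alpha>' - of_nat d' * \<rho>'" using weight_geD[OF hw hd'] .
  have "d' \<le> d"
  proof (rule ccontr)
    assume "\<not> d' \<le> d"
    hence "initial_coeff \<rho> \<alpha> ?h d' = 0" using t(1) by simp
    hence "\<alpha> - of_nat d' * \<rho> \<noteq> \<alpha>' - of_nat d' * \<rho>'" using hd' unfolding initial_coeff_def by auto
    with 2 have "of_nat d' * (\<rho>' - \<rho>) < \<alpha>' - \<alpha>" by (simp add: algebra_simps)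
    also have "\<dots> \<le> of_nat d * (\<rho>' - \<rho>)" using 1 by (simp add: algebra_simps)
    finally show False using \<rho> \<open>\<not> d' \<le> d\<close> by simp
  qed
  moreover have "initial_coeff \<rho> \<alpha> f (d - 1) \<noteq> 0" if "d' = d" "0 < d" "pcoeff s \<rho> \<noteq> 0"
  proof
    assume "initial_coeff \<rho> \<alpha> f (d - 1) = 0"
    \<comment> \<open>A nonzero term in degree d - 1 would bound \<alpha>' - \<alpha> by (d - 1)
      \<delta>, below the d \<delta> that d' = d requires.\<close>
    hence "initial_coeff \<rho> \<alpha> ?h (d - 1) \<noteq> 0" using t(3) fd that by simp
    from weight_geD[OF hw' this] 2 show False using \<rho> that by (simp add: of_nat_diff algebra_simps)
  qed
  ultimately show ?thesis by (rule that[OF h])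
qed

section \<open>Denominators under translation\<close>

definition scoeffs_denom_dvd :: "nat \<Rightarrow> puiseux skew_poly \<Rightarrow> bool" where
  "scoeffs_denom_dvd N f \<longleftrightarrow> (\<forall>k. denom_dvd N (scoeff f k))"

lemma scoeffs_denom_dvd_horner:
  "scoeffs_denom_dvd N (skew_const a + g * skew_Y) \<longleftrightarrow> denom_dvd N a \<and> scoeffs_denom_dvd N g"
proof
  assume h: "scoeffs_denom_dvd N (skew_const a + g * skew_Y)"
  have "denom_dvd N (scoeff (skew_const a + g * skew_Y) k)" for k
    using h by (simp only: scoeffs_denom_dvd_def)
  from this[of 0] this[of "Suc _"] show "denom_dvd N a \<and> scoeffs_denom_dvd N g"
    by (simp add: scoeffs_denom_dvd_def)
qed (auto simp: scoeffs_denom_dvd_def split: nat.split)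

lemma scoeffs_denom_dvd_add:
  "scoeffs_denom_dvd N f \<Longrightarrow> scoeffs_denom_dvd N g \<Longrightarrow> scoeffs_denom_dvd N (f + g)"
  by (simp add: scoeffs_denom_dvd_def denom_dvd_add)

text \<open>Moving \<open>s\<close> past y replaces it by its derivative, whose exponents are
  shifted by an integer; hence \<open>s\<close> is arbitrary in the induction.\<close>

lemma scoeffs_denom_dvd_mult_const:
  assumes "scoeffs_denom_dvd N f" "denom_dvd N s"
  shows "scoeffs_denom_dvd N (f * skew_const s)"
  using assms
proof (induction f arbitrary: s rule: skew_poly_horner_induct)
  case (horner a f)
  have "(skew_const a + f * skew_Y) * skew_const s
      = (skew_const (a * s) + (f * skew_const s) * skew_Y) + f * skew_const (pd s)"
    by (simp add: distrib_left distrib_right mult.assoc skew_Y_commutation skew_const_mult add.assoc)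
  then show ?case using horner
    by (simp add: scoeffs_denom_dvd_add scoeffs_denom_dvd_horner denom_dvd_mult denom_dvd_pd)
qed simp

lemma scoeffs_denom_dvd_translate:
  assumes "scoeffs_denom_dvd N f" "denom_dvd N s"
  shows "scoeffs_denom_dvd N (translate s f)"
  using assms(1)
proof (induction f rule: skew_poly_horner_induct)
  case (horner a f)
  have "translate s (skew_const a + f * skew_Y)
      = (skew_const a + translate s f * skew_Y) + translate s f * skew_const s"
    by (simp add: translate_horner distrib_left add.assoc)
  then show ?case using horner assms(2)
    by (simp add: scoeffs_denom_dvd_add scoeffs_denom_dvd_horner scoeffs_denom_dvd_mult_const)
qed simp

section \<open>The limit valuation\<close>

locale puiseux_pseudo_sequence =
  fixes r :: "nat \<Rightarrow> rat" and \<gamma> :: "nat \<Rightarrow> real"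
  assumes r_strict: "strict_mono_on {1..} r"
    and r_limit: "(\<lambda>i. real_of_rat (r i)) \<longlonglongrightarrow> 1"
    and \<gamma>_nonzero: "\<forall>i\<ge>1. \<gamma> i \<noteq> 0"
begin

text \<open>The value prescribed for z_i, and thus the weight given to the variable at stage
  \<open>i\<close>.\<close>

abbreviation slope :: "nat \<Rightarrow> rat" where
  "slope i \<equiv> r (Suc i)"

lemma slope_less: "i < j \<Longrightarrow> slope i < slope j"
  using r_strict by (auto simp: strict_mono_on_def)

text \<open>The limit yields only a weak bound; applied to the next term it becomes strict by
  monotonicity.\<close>

lemma slope_less_1: "slope i < 1"
proof -
  have "real_of_rat (slope (Suc i)) \<le> real_of_rat (r n)" if "n \<ge> Suc (Suc i)" for n
  proof -
    from Suc_le_D[OF that] obtain m where m: "n = Suc m" by blast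
    with that slope_less[of "Suc i" m] show ?thesis by (cases "m = Suc i") (auto simp: of_rat_less_eq)
  qed
  hence "real_of_rat (slope (Suc i)) \<le> 1"
    by (intro LIMSEQ_le_const[OF r_limit]) blast
  hence "slope (Suc i) \<le> 1" by simp
  with slope_less[of i "Suc i"] show ?thesis by simp
qed

text \<open>Multiplied by \<open>N\<close>, the slopes would be strictly increasing integers below
  \<open>N\<close>.\<close>

lemma slope_denominators_unbounded:
  assumes N: "N > 0" and int: "\<And>i. i \<ge> k \<Longrightarrow> of_nat N * slope i \<in> \<int>"
  shows False
proof -
  define t where "t i = \<lfloor>of_nat N * slope (k + i)\<rfloor>" for i
  have t: "of_int (t i) = of_nat N * slope (k + i)" for i
    using int[of "k + i"] by (auto simp: t_def elim!: Ints_cases)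
  have step: "t i + 1 \<le> t (Suc i)" for i
  proof -
    have "rat_of_int (t i) < of_int (t (Suc i))"
      unfolding t using slope_less[of "k + i" "k + Suc i"] N by simp
    thus ?thesis by simp
  qed
  have lower: "t 0 + int i \<le> t i" for i
  proof (induction i)
    case (Suc i)
    with step[of i] show ?case by simp
  qed simp
  have upper: "t i < int N" for i
  proof -
    have "rat_of_int (t i) < of_int (int N)"
      unfolding t using slope_less_1[of "k + i"] N by simp
    thus ?thesis by linarith
  qed
  from lower[of "nat (int N - t 0)"] upper[of 0] upper[of "nat (int N - t 0)"] show False by simp
qed

section \<open>Expansions in powers of z_i\<close>

definition partial_sum :: "nat \<Rightarrow> puiseux" where
  "partial_sum i = (\<Sum>j<i. pmonom (\<gamma> (Suc j)) (slope j))"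

lemma partial_sum_Suc: "partial_sum (Suc i) = pmonom (\<gamma> (Suc i)) (slope i) + partial_sum i"
  by (simp add: partial_sum_def add.commute)

lemma zseq_eq: "zseq r \<gamma> i = skew_Y - skew_const (partial_sum i)"
proof (induction i)
  case 0
  show ?case by (simp add: partial_sum_def)
next
  case (Suc i)
  then show ?case by (simp add: partial_sum_Suc skew_const_add algebra_simps)
qed

text \<open>If \<open>f = \<Sum>\<^sub>k p\<^sub>k z\<^sub>i\<^sup>k\<close> then \<open>expansion i f = \<Sum>\<^sub>k p\<^sub>k y\<^sup>k\<close>.\<close>

definition expansion :: "nat \<Rightarrow> puiseux skew_poly \<Rightarrow> puiseux skew_poly" where
  "expansion i = translate (partial_sum i)"

lemma expansion_Suc: "expansion (Suc i) f = translate (pmonom (\<gamma> (Suc i)) (slope i)) (expansion i f)"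
  by (simp add: expansion_def translate_translate partial_sum_Suc)

lemma expansion_const: "expansion i (skew_const a) = skew_const a"
  by (simp add: expansion_def)

lemma expansion_zseq: "expansion i (zseq r \<gamma> i) = skew_Y"
  by (simp add: expansion_def zseq_eq translate_diff)

text \<open>The monomial added at stage \<open>n\<close> has order \<open>slope n\<close>, so the
  translation respects weights of slope \<open>n\<close>; raising the slope afterwards can only
  raise weights.\<close>

lemma weight_ge_expansion_mono:
  assumes "weight_ge (slope i) \<alpha> (expansion i f)" "i \<le> j"
  shows "weight_ge (slope j) \<alpha> (expansion j f)"
  using assms(2)
proof (induction j rule: dec_induct)
  case (step n)
  have "weight_ge (slope n) \<alpha> (expansion (Suc n) f)"
    unfolding expansion_Suc using step.IH slope_less_1[of n]
    by (intro weight_ge_translate) (auto simp: ord_ge_pmonom)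
  then show ?case using slope_less[of n "Suc n"] by (auto intro: weight_ge_mono_slope)
qed (rule assms)

text \<open>A bound reached at one stage persists at all later ones, so two bounds can always be
  compared at a common stage.\<close>

definition value_ge :: "rat \<Rightarrow> puiseux skew_poly \<Rightarrow> bool" where
  "value_ge \<alpha> f \<longleftrightarrow> (\<exists>i. weight_ge (slope i) \<alpha> (expansion i f))"

lemma value_ge_common:
  assumes "value_ge \<alpha> f" "value_ge \<beta> g"
  obtains i where "weight_ge (slope i) \<alpha> (expansion i f)" "weight_ge (slope i) \<beta> (expansion i g)"
proof -
  from assms obtain i j where "weight_ge (slope i) \<alpha> (expansion i f)" "weight_ge (slope j) \<beta> (expansion j g)"
    unfolding value_ge_def by blast
  with that[of "max i j"] weight_ge_expansion_mono show ?thesis by (meson max.cobounded1 max.cobounded2)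
qed

lemma value_ge_add: "value_ge \<alpha> f \<Longrightarrow> value_ge \<alpha> g \<Longrightarrow> value_ge \<alpha> (f + g)"
  by (erule (1) value_ge_common) (auto simp: value_ge_def expansion_def translate_add intro: weight_ge_add)

lemma value_ge_diff: "value_ge \<alpha> f \<Longrightarrow> value_ge \<alpha> g \<Longrightarrow> value_ge \<alpha> (f - g)"
  by (erule (1) value_ge_common) (auto simp: value_ge_def expansion_def translate_diff intro: weight_ge_diff)

lemma value_ge_mult:
  assumes "value_ge \<alpha> f" "value_ge \<beta> g" shows "value_ge (\<alpha> + \<beta>) (f * g)"
proof -
  obtain i where "weight_ge (slope i) \<alpha> (expansion i f)" "weight_ge (slope i) \<beta> (expansion i g)"
    using assms by (rule value_ge_common)
  hence "weight_ge (slope i) (\<alpha> + \<beta>) (expansion i f * expansion i g)"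
    using slope_less_1[of i] by (intro weight_ge_mult) auto
  thus ?thesis by (auto simp: value_ge_def expansion_def translate_mult)
qed

lemma value_ge_mono: "value_ge \<alpha> f \<Longrightarrow> \<beta> \<le> \<alpha> \<Longrightarrow> value_ge \<beta> f"
  by (auto simp: value_ge_def intro: weight_ge_mono)

lemma value_ge_const: "value_ge \<alpha> (skew_const a) \<longleftrightarrow> ord_ge a \<alpha>"
  by (simp add: value_ge_def expansion_const weight_ge_const)

lemma value_ge_zseq: "value_ge (slope i) (zseq r \<gamma> i)"
  by (auto simp: value_ge_def expansion_zseq intro!: exI[of _ i] weight_ge_Y)

section \<open>Leading monomials\<close>

abbreviation skew_monom :: "real \<Rightarrow> rat \<Rightarrow> puiseux skew_poly" where
  "skew_monom c \<alpha> \<equiv> skew_const (pmonom c \<alpha>)"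

text \<open>Here \<open>c\<close> is the residue that f / x^(-\<alpha>) will have.\<close>

definition leading :: "puiseux skew_poly \<Rightarrow> real \<Rightarrow> rat \<Rightarrow> bool" where
  "leading f c \<alpha> \<longleftrightarrow> c \<noteq> 0 \<and> (\<exists>\<beta>>\<alpha>. value_ge \<beta> (f - skew_monom c \<alpha>))"

lemma leading_value_ge:
  assumes "leading f c \<alpha>" shows "value_ge \<alpha> f"
proof -
  from assms obtain \<beta> where "\<beta> > \<alpha>" "value_ge \<beta> (f - skew_monom c \<alpha>)" by (auto simp: leading_def)
  hence "value_ge \<alpha> (f - skew_monom c \<alpha>)" by (auto intro: value_ge_mono)
  from value_ge_add[OF this, of "skew_monom c \<alpha>"] show ?thesis by (simp add: value_ge_const ord_ge_pmonom)
qed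

text \<open>A larger bound for \<open>f\<close> would carry over to the monomial, the difference of
  \<open>f\<close> and the remainder, against the order of that monomial.\<close>

lemma leading_value_le:
  assumes "leading f c \<alpha>" "value_ge \<mu> f" shows "\<mu> \<le> \<alpha>"
proof -
  from assms(1) obtain \<beta> where \<beta>: "\<beta> > \<alpha>" "value_ge \<beta> (f - skew_monom c \<alpha>)" and c: "c \<noteq> 0"
    by (auto simp: leading_def)
  have "value_ge (min \<mu> \<beta>) (f - (f - skew_monom c \<alpha>))"
    by (rule value_ge_diff) (use assms(2) \<beta>(2) in \<open>auto elim: value_ge_mono\<close>)
  hence "min \<mu> \<beta> \<le> \<alpha>" using c by (simp add: value_ge_const ord_ge_pmonom)
  with \<beta>(1) show ?thesis by (simp add: min_le_iff_disj)
qed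

lemma leading_unique: "leading f c \<alpha> \<Longrightarrow> leading f c' \<alpha>' \<Longrightarrow> \<alpha> = \<alpha>'"
  by (meson leading_value_ge leading_value_le order_antisym)

lemma not_leading_0: "\<not> leading 0 c \<alpha>"
proof
  assume "leading 0 c \<alpha>"
  moreover have "value_ge (\<alpha> + 1) 0" by (simp add: value_ge_def expansion_def)
  ultimately have "\<alpha> + 1 \<le> \<alpha>" by (rule leading_value_le)
  thus False by simp
qed

lemma leading_monom: "c \<noteq> 0 \<Longrightarrow> leading (skew_monom c \<alpha>) c \<alpha>"
  by (auto simp: leading_def value_ge_def expansion_def intro!: exI[of _ "\<alpha> + 1"])

text \<open>The remainder is z_(i+1), whose value is at least the larger slope of the next
  stage.\<close>

lemma leading_zseq: "leading (zseq r \<gamma> i) (\<gamma> (Suc i)) (slope i)"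
  using value_ge_zseq[of "Suc i"] slope_less[of i "Suc i"] \<gamma>_nonzero by (auto simp: leading_def)

text \<open>With leading monomials m and n, f g - m n = (f - m) g + m (g - n), and both terms have
  larger value.\<close>

lemma leading_mult:
  assumes f: "leading f c \<alpha>" and g: "leading g d \<beta>"
  shows "leading (f * g) (c * d) (\<alpha> + \<beta>)"
proof -
  from f obtain \<alpha>' where \<alpha>: "\<alpha>' > \<alpha>" "value_ge \<alpha>' (f - skew_monom c \<alpha>)" by (auto simp: leading_def)
  from g obtain \<beta>' where \<beta>: "\<beta>' > \<beta>" "value_ge \<beta>' (g - skew_monom d \<beta>)" by (auto simp: leading_def)
  let ?\<mu> = "min (\<alpha>' + \<beta>) (\<alpha> + \<beta>')"
  have "value_ge (\<alpha>' + \<beta>) ((f - skew_monom c \<alpha>) * g)"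
    by (rule value_ge_mult[OF \<alpha>(2) leading_value_ge[OF g]])
  moreover have "value_ge (\<alpha> + \<beta>') (skew_monom c \<alpha> * (g - skew_monom d \<beta>))"
    using \<beta> by (intro value_ge_mult) (auto simp: value_ge_const ord_ge_pmonom)
  ultimately have "value_ge ?\<mu> ((f - skew_monom c \<alpha>) * g + skew_monom c \<alpha> * (g - skew_monom d \<beta>))"
    by (intro value_ge_add) (auto elim: value_ge_mono)
  also have "(f - skew_monom c \<alpha>) * g + skew_monom c \<alpha> * (g - skew_monom d \<beta>)
      = f * g - skew_monom (c * d) (\<alpha> + \<beta>)"
    by (simp add: algebra_simps flip: skew_const_mult pmonom_mult)
  finally have "value_ge ?\<mu> (f * g - skew_monom (c * d) (\<alpha> + \<beta>))" .
  moreover have "?\<mu> > \<alpha> + \<beta>" using \<alpha> \<beta> by simp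
  moreover have "c * d \<noteq> 0" using f g by (simp add: leading_def)
  ultimately show ?thesis unfolding leading_def by blast
qed

text \<open>The least degree over all stages can drop no further. Were it positive, its persistence
  would confine all later slopes to one fixed denominator.\<close>

lemma initial_degree_0_eventually:
  assumes "f \<noteq> 0" obtains i \<alpha> where "initial_degree (slope i) \<alpha> (expansion i f) 0"
proof -
  let ?P = "\<lambda>d. \<exists>i \<alpha>. initial_degree (slope i) \<alpha> (expansion i f) d"
  have "expansion 0 f \<noteq> 0" using assms by (simp add: expansion_def translate_eq_0_iff)
  hence ex: "\<exists>d. ?P d" by (rule initial_degree_exists) blast
  define d where "d = (LEAST d. ?P d)"
  have d: "?P d" unfolding d_def by (rule LeastI_ex[OF ex])
  have d_min: "d \<le> d'" if "?P d'" for d' unfolding d_def using Least_le[of ?P, OF that] .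
  from d obtain k \<alpha> where k: "initial_degree (slope k) \<alpha> (expansion k f) d" by blast
  have "d = 0"
  proof (rule ccontr)
    assume "d \<noteq> 0"
    \<comment> \<open>By minimality of \<open>d\<close> the degree cannot fall, so the case of equal
      degrees in \<open>initial_degree_translate\<close> applies.\<close>
    have next_stage: "(\<exists>\<alpha>'. initial_degree (slope (Suc i)) \<alpha>' (expansion (Suc i) f) d) \<and>
        initial_coeff (slope i) \<alpha> (expansion i f) (d - 1) \<noteq> 0"
      if i: "initial_degree (slope i) \<alpha> (expansion i f) d" for i \<alpha>
    proof -
      let ?s = "pmonom (\<gamma> (Suc i)) (slope i)"
      have s: "ord_ge ?s (slope i)" "pcoeff ?s (slope i) \<noteq> 0"
        using \<gamma>_nonzero by (auto simp: ord_ge_pmonom pcoeff_pmonom)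
      obtain \<alpha>' d' where h: "initial_degree (slope (Suc i)) \<alpha>' (expansion (Suc i) f) d'" "d' \<le> d"
        "d' = d \<Longrightarrow> initial_coeff (slope i) \<alpha> (expansion i f) (d - 1) \<noteq> 0"
        using initial_degree_translate[OF i s(1), of "slope (Suc i)"] slope_less[of i "Suc i"] slope_less_1[of i] s(2) \<open>d \<noteq> 0\<close>
        unfolding expansion_Suc by (metis lessI less_imp_le neq0_conv)
      from h(1) d_min have "d \<le> d'" by blast
      with h have "d' = d" by simp
      with h show ?thesis by blast
    qed
    obtain N where N: "N > 0" "scoeffs_denom_dvd N (expansion k f)"
      using denom_dvd_poly[of "left_coeffs (expansion k f)"] unfolding scoeffs_denom_dvd_def by metis
    \<comment> \<open>Two neighbouring coefficients of the initial form are nonzero; their exponents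
      have denominator \<open>N\<close> and differ by the slope.\<close>
    have slope_int: "of_nat N * slope i \<in> \<int>"
      if deg: "initial_degree (slope i) \<alpha> (expansion i f) d" and den: "scoeffs_denom_dvd N (expansion i f)" for i \<alpha>
    proof -
      have "of_nat N * (\<alpha> - of_nat j * slope i) \<in> \<int>" if "initial_coeff (slope i) \<alpha> (expansion i f) j \<noteq> 0" for j
        using den that by (simp add: scoeffs_denom_dvd_def denom_dvd_def initial_coeff_def)
      hence "of_nat N * (\<alpha> - of_nat (d - 1) * slope i) - of_nat N * (\<alpha> - of_nat d * slope i) \<in> \<int>"
        using next_stage[OF deg] deg by (intro Ints_diff) (auto simp: initial_degree_def)
      thus ?thesis using \<open>d \<noteq> 0\<close> by (simp add: of_nat_diff algebra_simps)
    qed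
    have inv: "(\<exists>\<alpha>. initial_degree (slope i) \<alpha> (expansion i f) d) \<and> scoeffs_denom_dvd N (expansion i f)"
      if "i \<ge> k" for i using that
    proof (induction i rule: dec_induct)
      case base
      then show ?case using k N by blast
    next
      case (step n)
      then obtain \<alpha> where \<alpha>: "initial_degree (slope n) \<alpha> (expansion n f) d" by blast
      \<comment> \<open>The slope at stage \<open>n\<close> has denominator \<open>N\<close>, so the
        monomial used for translating does not enlarge \<open>N\<close>.\<close>
      have "scoeffs_denom_dvd N (expansion (Suc n) f)" unfolding expansion_Suc
        using step.IH slope_int[OF \<alpha>] by (intro scoeffs_denom_dvd_translate denom_dvd_pmonom) auto
      with next_stage[OF \<alpha>] show ?case by blast
    qed
    show False
      by (rule slope_denominators_unbounded[OF N(1), of k]) (use inv slope_int in blast)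
  qed
  with k show ?thesis by (intro that[of k \<alpha>]) simp
qed

text \<open>Initial degree 0 means that the initial form is a constant; subtracting the
  corresponding monomial kills it, which raises the weight strictly.\<close>

lemma leading_exists:
  assumes "f \<noteq> 0" obtains c \<alpha> where "leading f c \<alpha>"
proof -
  obtain i \<alpha> where i: "initial_degree (slope i) \<alpha> (expansion i f) 0"
    using assms by (rule initial_degree_0_eventually)
  define c where "c = initial_coeff (slope i) \<alpha> (expansion i f) 0"
  have c: "c \<noteq> 0" using i by (simp add: c_def initial_degree_def)
  let ?g = "f - skew_monom c \<alpha>"
  have g: "expansion i ?g = expansion i f - skew_monom c \<alpha>"
    by (simp add: expansion_def translate_diff)
  have "weight_ge (slope i) \<alpha> (expansion i ?g)"
    unfolding g using i by (intro weight_ge_diff) (auto simp: initial_degree_def weight_ge_const ord_ge_pmonom)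
  moreover have "initial_coeff (slope i) \<alpha> (expansion i ?g) k = 0" for k
  proof (cases k)
    case 0
    then show ?thesis unfolding g by (simp add: initial_coeff_def c_def pcoeff_minus pcoeff_pmonom)
  next
    case (Suc j)
    with i have "initial_coeff (slope i) \<alpha> (expansion i f) k = 0" by (simp add: initial_degree_def)
    with Suc show ?thesis unfolding g by (simp add: initial_coeff_def del: of_nat_Suc)
  qed
  ultimately obtain \<beta> where "\<beta> > \<alpha>" "weight_ge (slope i) \<beta> (expansion i ?g)" by (rule weight_ge_improve)
  with c have "leading f c \<alpha>" unfolding leading_def value_ge_def by blast
  then show ?thesis by (rule that)
qed

section \<open>The value function and its axioms\<close>

definition limit_valuation :: "puiseux skew_poly \<Rightarrow> rat value_inf" where
  "limit_valuation f = (if f = 0 then Infinity else Value (THE \<alpha>. \<exists>c. leading f c \<alpha>))"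

lemma limit_valuation_eq:
  assumes "leading f c \<alpha>" shows "limit_valuation f = Value \<alpha>"
proof -
  have "(THE \<alpha>. \<exists>c. leading f c \<alpha>) = \<alpha>"
    using assms leading_unique by (intro the_equality) blast+
  moreover have "f \<noteq> 0" using assms not_leading_0 by blast
  ultimately show ?thesis by (simp add: limit_valuation_def)
qed

lemma value_ge_iff: "value_ge \<mu> f \<longleftrightarrow> Value \<mu> \<le> limit_valuation f"
proof (cases "f = 0")
  case True
  then show ?thesis by (simp add: limit_valuation_def value_ge_def expansion_def)
next
  case False
  then obtain c \<alpha> where l: "leading f c \<alpha>" by (rule leading_exists)
  show ?thesis unfolding limit_valuation_eq[OF l] value_inf_simps
    by (metis leading_value_ge[OF l] leading_value_le[OF l] value_ge_mono)
qed

lemma valuation_limit_valuation: "valuation limit_valuation"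
  unfolding valuation_def
proof (intro conjI allI)
  fix f g :: "puiseux skew_poly"
  show "limit_valuation f = Infinity \<longleftrightarrow> f = 0"
    by (simp add: limit_valuation_def)
  show "limit_valuation (f * g) = limit_valuation f + limit_valuation g"
  proof (cases "f = 0 \<or> g = 0")
    case True
    then show ?thesis by (auto simp: limit_valuation_def)
  next
    case False
    then obtain c \<alpha> d \<beta> where "leading f c \<alpha>" "leading g d \<beta>" by (metis leading_exists)
    with leading_mult[OF this] show ?thesis by (simp add: limit_valuation_eq)
  qed
  show "min (limit_valuation f) (limit_valuation g) \<le> limit_valuation (f + g)"
  proof (cases "min (limit_valuation f) (limit_valuation g)")
    case (Value \<mu>)
    hence "Value \<mu> \<le> limit_valuation f" "Value \<mu> \<le> limit_valuation g"
      by (metis min.cobounded1, metis min.cobounded2)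
    thus ?thesis unfolding Value by (simp only: value_ge_add flip: value_ge_iff)
  next
    case Infinity
    hence "limit_valuation f = Infinity" "limit_valuation g = Infinity"
      by (auto simp: min_def split: if_splits) (metis value_inf_simps(5) order_antisym)+
    hence "f + g = 0" by (auto simp: limit_valuation_def split: if_splits)
    then show ?thesis by (simp add: limit_valuation_def)
  qed
qed

end

section \<open>Valuations and their residue rings\<close>

lemma add_strict_left:
  fixes a b c :: "'g::linordered_group_add" shows "a < b \<Longrightarrow> c + a < c + b"
  using add_le_left[of a b c] by (auto simp: less_le)

lemma add_strict_right:
  fixes a b c :: "'g::linordered_group_add" shows "a < b \<Longrightarrow> a + c < b + c"
  using add_le_right[of a b c] by (auto simp: less_le)

text \<open>Multiples are list sums because the group need not be commutative; strict translation
  invariance on both sides replaces one summand at a time.\<close>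

lemma multiple_strict_mono:
  fixes a b :: "'g::linordered_group_add"
  assumes "a < b" shows "sum_list (replicate (Suc n) a) < sum_list (replicate (Suc n) b)"
proof (induction n)
  case (Suc n)
  have "a + sum_list (replicate (Suc n) a) < a + sum_list (replicate (Suc n) b)"
    using Suc by (rule add_strict_left)
  also have "\<dots> < b + sum_list (replicate (Suc n) b)" using assms by (rule add_strict_right)
  finally show ?case by simp
qed (use assms in simp)

lemma multiple_inject:
  fixes a b :: "'g::linordered_group_add"
  assumes "sum_list (replicate (Suc n) a) = sum_list (replicate (Suc n) b)" shows "a = b"
  using assms multiple_strict_mono[of a b n] multiple_strict_mono[of b a n]
  by (metis less_irrefl linorder_neqE)

lemma double_eq_0: "(a::'g::linordered_group_add) + a = 0 \<Longrightarrow> a = 0"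
  using multiple_inject[of 1 a 0] by simp

text \<open>Taking multiples is injective in a totally ordered group, so division is unique there
  and the value at -1 determines the map. It is -1 because of the normalization at x.\<close>

lemma additive_rat_unique:
  fixes f g :: "rat \<Rightarrow> 'g::linordered_group_add"
  assumes f: "\<And>p q. f (p + q) = f p + f q" and g: "\<And>p q. g (p + q) = g p + g q"
    and eq: "f (- 1) = g (- 1)"
  shows "f q = g q"
proof -
  have zero: "h 0 = 0" and mult: "h (of_nat n * q) = sum_list (replicate n (h q))"
    and neg: "h (- q) = - h q"
    if h: "\<And>p q. h (p + q) = h p + h q" for h :: "rat \<Rightarrow> 'g" and n q
  proof -
    show 0: "h 0 = 0" using h[of 0 0] by (metis add_0_right add_left_cancel)
    show "h (of_nat n * q) = sum_list (replicate n (h q))"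
      by (induction n) (simp_all add: 0 h distrib_right)
    show "h (- q) = - h q" using h[of "- q" q] 0 by (simp add: eq_neg_iff_add_eq_0)
  qed
  have nat: "f (- of_nat n) = g (- of_nat n)" for n
    using mult[OF f, of n "- 1"] mult[OF g, of n "- 1"] eq by simp
  have int: "f (of_int k) = g (of_int k)" for k
  proof (cases "k \<le> 0")
    case True
    with nat[of "nat (- k)"] show ?thesis by simp
  next
    case False
    with nat[of "nat k"] show ?thesis by (simp add: neg[OF f] neg[OF g])
  qed
  obtain a b where ab: "quotient_of q = (a, b)" by (cases "quotient_of q")
  have b: "b > 0" using quotient_of_denom_pos[OF ab] .
  then obtain n where n: "b = int (Suc n)" by (metis Suc_pred zero_less_imp_eq_int)
  have "of_nat (Suc n) * q = of_int a" using quotient_of_div[OF ab] by (simp add: n)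
  hence "sum_list (replicate (Suc n) (f q)) = sum_list (replicate (Suc n) (g q))"
    using mult[OF f, of "Suc n" q] mult[OF g, of "Suc n" q] int[of a] by metis
  thus ?thesis by (rule multiple_inject)
qed

lemma
  fixes a b :: "'g::linordered_group_add"
  shows value_inf_add_mono_le: "Value a \<le> x \<Longrightarrow> Value b \<le> y \<Longrightarrow> Value (a + b) \<le> x + y"
    and value_inf_add_mono_less_le: "Value a < x \<Longrightarrow> Value b \<le> y \<Longrightarrow> Value (a + b) < x + y"
    and value_inf_add_mono_le_less: "Value a \<le> x \<Longrightarrow> Value b < y \<Longrightarrow> Value (a + b) < x + y"
proof -
  show "Value a \<le> x \<Longrightarrow> Value b \<le> y \<Longrightarrow> Value (a + b) \<le> x + y"
    by (cases x; cases y) (auto intro: order_trans[OF add_le_right add_le_left])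
  show "Value a < x \<Longrightarrow> Value b \<le> y \<Longrightarrow> Value (a + b) < x + y"
    by (cases x; cases y) (auto intro: less_le_trans[OF add_strict_right add_le_left])
  show "Value a \<le> x \<Longrightarrow> Value b < y \<Longrightarrow> Value (a + b) < x + y"
    by (cases x; cases y) (auto intro: le_less_trans[OF add_le_right add_strict_left])
qed

context
  fixes v :: "'a::ring_1 \<Rightarrow> 'g::linordered_group_add value_inf"
  assumes v: "valuation v"
begin

lemma val_eq_Infinity: "v a = Infinity \<longleftrightarrow> a = 0"
  using v by (simp add: valuation_def)

lemma val_mult: "v (a * b) = v a + v b"
  using v by (simp add: valuation_def)

lemma val_add_ge: "x \<le> v a \<Longrightarrow> x \<le> v b \<Longrightarrow> x \<le> v (a + b)"
  by (rule order_trans[of _ "min (v a) (v b)"]) (use v in \<open>simp_all add: valuation_def\<close>)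

lemma val_add_gt: "x < v a \<Longrightarrow> x < v b \<Longrightarrow> x < v (a + b)"
  by (rule less_le_trans[of _ "min (v a) (v b)"]) (use v in \<open>simp_all add: valuation_def\<close>)

lemma val_cases: assumes "a \<noteq> 0" obtains g where "v a = Value g"
proof (cases "v a")
  case Infinity
  with assms val_eq_Infinity show ?thesis by blast
qed (rule that)

lemma val_1: "v 1 = Value 0"
proof -
  obtain g where g: "v 1 = Value g" by (rule val_cases[OF one_neq_zero])
  with val_mult[of 1 1] have "g + g = g + 0" by simp
  hence "g = 0" by (simp only: add_left_cancel)
  with g show ?thesis by simp
qed

lemma val_uminus: "v (- a) = v a"
proof -
  obtain g where g: "v (- 1) = Value g" by (rule val_cases[of "- 1"]) auto
  have "v (- 1) + v (- 1) = Value 0" using val_mult[of "- 1" "- 1"] val_1 by simp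
  with g have "v (- 1) = Value 0" using double_eq_0[of g] by simp
  with val_mult[of "- 1" a] show ?thesis by (cases "v a") auto
qed

lemma val_diff_gt: "x < v a \<Longrightarrow> x < v b \<Longrightarrow> x < v (a - b)"
  using val_add_gt[of x a "- b"] val_uminus by simp

text \<open>If \<open>b\<close> had the larger value, then so would \<open>a\<close>, being the
  difference of \<open>b\<close> and \<open>b - a\<close>.\<close>

lemma val_eq_of_diff_gt:
  assumes "v a < v (b - a)" shows "v b = v a"
proof (rule antisym)
  show "v a \<le> v b" using val_add_ge[of "v a" "b - a" a] assms by simp
  show "v b \<le> v a"
  proof (rule ccontr)
    assume "\<not> v b \<le> v a"
    hence "v a < v b" by simp
    from val_diff_gt[OF this assms] show False by simp
  qed
qed

end

section \<open>The valuation ring, its ideal and the residue ring\<close>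

lemma ring_valuation_ring:
  assumes v: "valuation v" shows "ring (valuation_ring v)"
proof (rule ringI)
  show "abelian_group (valuation_ring v)"
  proof (rule abelian_groupI)
    show "\<exists>y\<in>carrier (valuation_ring v). y \<oplus>\<^bsub>valuation_ring v\<^esub> x = \<zero>\<^bsub>valuation_ring v\<^esub>"
      if "x \<in> carrier (valuation_ring v)" for x
      by (rule bexI[of _ "- x"]) (use that val_uminus[OF v, of x] in \<open>simp_all add: valuation_ring_def\<close>)
  qed (use val_add_ge[OF v] val_eq_Infinity[OF v] in \<open>auto simp: valuation_ring_def add.assoc add.commute\<close>,
      metis value_inf_simps(5))
  show "monoid (valuation_ring v)"
    using val_mult[OF v] value_inf_add_mono_le[of 0 _ 0] val_1[OF v]
    by (intro monoidI) (auto simp: valuation_ring_def mult.assoc)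
qed (auto simp: valuation_ring_def algebra_simps)

lemma ideal_valuation_ideal:
  assumes v: "valuation v" shows "ideal (valuation_ideal v) (valuation_ring v)"
proof (rule idealI[OF ring_valuation_ring[OF v]])
  interpret ring "valuation_ring v" by (rule ring_valuation_ring[OF v])
  show "subgroup (valuation_ideal v) (add_monoid (valuation_ring v))"
  proof (rule add.subgroupI)
    have zero: "v 0 = Infinity" using val_eq_Infinity[OF v] by blast
    show "valuation_ideal v \<subseteq> carrier (valuation_ring v)"
      by (auto simp: valuation_ideal_def valuation_ring_def)
    show "valuation_ideal v \<noteq> {}" using zero by (auto simp: valuation_ideal_def intro!: exI[of _ 0])
    show "\<ominus>\<^bsub>valuation_ring v\<^esub> a \<in> valuation_ideal v" if "a \<in> valuation_ideal v" for a
    proof -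
      have "\<ominus>\<^bsub>valuation_ring v\<^esub> a = - a"
        using that val_uminus[OF v, of a] by (intro minus_equality) (auto simp: valuation_ideal_def valuation_ring_def)
      with that show ?thesis using val_uminus[OF v] by (simp add: valuation_ideal_def)
    qed
    show "a \<oplus>\<^bsub>valuation_ring v\<^esub> b \<in> valuation_ideal v"
      if "a \<in> valuation_ideal v" "b \<in> valuation_ideal v" for a b
      using that val_add_gt[OF v] by (auto simp: valuation_ideal_def valuation_ring_def)
  qed
qed (use val_mult[OF v] value_inf_add_mono_less_le[of 0 _ 0] value_inf_add_mono_le_less[of 0 _ 0] in
    \<open>auto simp: valuation_ideal_def valuation_ring_def\<close>)

lemma residue_coset:
  "valuation_ideal v +>\<^bsub>valuation_ring v\<^esub> a = {h + a | h. v h > Value 0}"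
  by (auto simp: a_r_coset_def' valuation_ring_def valuation_ideal_def)

lemma carrier_residue_ring:
  "carrier (residue_ring v) = {valuation_ideal v +>\<^bsub>valuation_ring v\<^esub> a | a. v a \<ge> Value 0}"
  by (auto simp: residue_ring_def FactRing_def A_RCOSETS_def' valuation_ring_def)

text \<open>By surjectivity the coset of \<open>a\<close>, which contains \<open>a\<close>, is the
  coset of some real.\<close>

lemma residue_field_realD:
  assumes "residue_field_real \<iota> v" "valuation v" "Value 0 \<le> v a"
  shows "\<exists>c. Value 0 < v (a - \<iota> c)"
proof -
  have "(\<lambda>c. valuation_ideal v +>\<^bsub>valuation_ring v\<^esub> \<iota> c) ` UNIV = carrier (residue_ring v)"
    using assms(1) by (auto simp: residue_field_real_def ring_iso_def bij_betw_def real_ring_def)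
  moreover have "valuation_ideal v +>\<^bsub>valuation_ring v\<^esub> a \<in> carrier (residue_ring v)"
    using assms(3) unfolding carrier_residue_ring by blast
  ultimately obtain c where "{h + a | h. v h > Value 0} = {h + \<iota> c | h. v h > Value 0}"
    unfolding residue_coset by (metis (no_types, lifting) imageE)
  moreover have "a \<in> {h + a | h. v h > Value 0}"
    using val_eq_Infinity[OF assms(2), of 0] by (auto intro!: exI[of _ 0])
  ultimately obtain h where "a = h + \<iota> c" "v h > Value 0" by blast
  thus ?thesis by (auto intro: exI[of _ c])
qed

text \<open>Injectivity follows from triviality on the reals. For surjectivity only elements of
  value 0 need an assumption, since positive value means residue 0.\<close>

lemma residue_field_realI:
  assumes v: "valuation v"
    and \<iota>: "\<And>c d. \<iota> (c + d) = \<iota> c + \<iota> d" "\<And>c d. \<iota> (c * d) = \<iota> c * \<iota> d" "\<iota> 1 = 1"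
    and triv: "\<And>c. c \<noteq> 0 \<Longrightarrow> v (\<iota> c) = Value 0"
    and res: "\<And>a. v a = Value 0 \<Longrightarrow> \<exists>c. Value 0 < v (a - \<iota> c)"
  shows "residue_field_real \<iota> v"
proof -
  let ?V = "valuation_ring v" and ?I = "valuation_ideal v"
  interpret ideal ?I ?V by (rule ideal_valuation_ideal[OF v])
  have \<iota>0: "\<iota> 0 = 0" using \<iota>(1)[of 0 0] by simp
  have zero: "v 0 = Infinity" using val_eq_Infinity[OF v] by blast
  have ge: "v (\<iota> c) \<ge> Value 0" for c using triv[of c] \<iota>0 zero by (cases "c = 0") auto
  have "\<iota> \<in> ring_hom real_ring ?V"
    using \<iota> ge by (auto simp: ring_hom_def real_ring_def valuation_ring_def)
  from ring_hom_trans[OF this rcos_ring_hom]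
  have hom: "(\<lambda>c. ?I +>\<^bsub>?V\<^esub> \<iota> c) \<in> ring_hom real_ring (residue_ring v)"
    by (simp add: residue_ring_def comp_def)
  have inj: "c = d" if "?I +>\<^bsub>?V\<^esub> \<iota> c = ?I +>\<^bsub>?V\<^esub> \<iota> d" for c d
  proof (rule ccontr)
    assume "c \<noteq> d"
    have "\<iota> c \<in> ?I +>\<^bsub>?V\<^esub> \<iota> c" unfolding residue_coset using zero by (auto intro!: exI[of _ 0])
    hence "\<iota> c \<in> {h + \<iota> d | h. v h > Value 0}" unfolding that residue_coset[of v "\<iota> d"] .
    then obtain h where h: "\<iota> c = h + \<iota> d" "v h > Value 0" by blast
    have "h = \<iota> (c - d)" using h(1) \<iota>(1)[of "c - d" d] by simp
    with h(2) triv[of "c - d"] \<open>c \<noteq> d\<close> show False by simp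
  qed
  have surj: "\<exists>c. ?I +>\<^bsub>?V\<^esub> a = ?I +>\<^bsub>?V\<^esub> \<iota> c" if a: "v a \<ge> Value 0" for a
  proof -
    have "\<exists>c. Value 0 < v (a - \<iota> c)"
    proof (cases "v a = Value 0")
      case False
      with a show ?thesis by (intro exI[of _ 0]) (simp add: \<iota>0)
    qed (rule res)
    then obtain c where c: "Value 0 < v (a - \<iota> c)" by blast
    have "?I +>\<^bsub>?V\<^esub> a = ?I +>\<^bsub>?V\<^esub> \<iota> c" unfolding residue_coset
    proof (intro equalityI subsetI)
      fix x assume "x \<in> {h + a | h. Value 0 < v h}"
      then obtain h where h: "x = h + a" "Value 0 < v h" by blast
      have "x = (h + (a - \<iota> c)) + \<iota> c" using h by simp
      with val_add_gt[OF v h(2) c] show "x \<in> {h + \<iota> c | h. Value 0 < v h}" by blast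
    next
      fix x assume "x \<in> {h + \<iota> c | h. Value 0 < v h}"
      then obtain h where h: "x = h + \<iota> c" "Value 0 < v h" by blast
      have "x = (h - (a - \<iota> c)) + a" using h by simp
      with val_diff_gt[OF v h(2) c] show "x \<in> {h + a | h. Value 0 < v h}" by blast
    qed
    thus ?thesis by blast
  qed
  have "bij_betw (\<lambda>c. ?I +>\<^bsub>?V\<^esub> \<iota> c) (carrier real_ring) (carrier (residue_ring v))"
    unfolding bij_betw_def
  proof
    show "inj_on (\<lambda>c. ?I +>\<^bsub>?V\<^esub> \<iota> c) (carrier real_ring)" using inj by (rule inj_onI)
    show "(\<lambda>c. ?I +>\<^bsub>?V\<^esub> \<iota> c) ` carrier real_ring = carrier (residue_ring v)"
      unfolding carrier_residue_ring using ge surj by (fastforce simp: real_ring_def)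
  qed
  with hom triv show ?thesis by (simp add: residue_field_real_def ring_iso_def)
qed

text \<open>Let c be half the constant term of \<open>e\<close>. If \<open>e\<close> had positive
  value, e - c would have residue -c, which is negative, although it is a square by
  \<open>puiseux_sqrt\<close>.\<close>

lemma puiseux_valuation_not_pos:
  fixes u :: "puiseux \<Rightarrow> 'g::linordered_group_add value_inf"
  assumes u: "valuation u"
    and triv: "\<And>c. c \<noteq> 0 \<Longrightarrow> u (pmonom c 0) = Value 0"
    and res: "\<And>a. u a = Value 0 \<Longrightarrow> \<exists>c. Value 0 < u (a - pmonom c 0)"
    and e: "ord_ge e 0" "pcoeff e 0 > 0"
  shows "\<not> Value 0 < u e"
proof
  assume pos: "Value 0 < u e"
  define c where "c = pcoeff e 0 / 2"
  have c: "c > 0" using e(2) by (simp add: c_def)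
  let ?f = "e - pmonom c 0"
  have "ord_ge ?f 0" "pcoeff ?f 0 > 0"
    using e by (auto simp: ord_ge_def pcoeff_minus pcoeff_pmonom c_def)
  then obtain h where h: "h * h = ?f" by (rule puiseux_sqrt)
  have "u (- pmonom c 0) < u (?f - - pmonom c 0)"
    using pos triv[of c] c val_uminus[OF u] by simp
  from val_eq_of_diff_gt[OF u this] have "u ?f = Value 0" using triv[of c] c val_uminus[OF u] by simp
  hence "u h + u h = Value 0" using val_mult[OF u, of h h] h by simp
  hence uh: "u h = Value 0" using double_eq_0 by (cases "u h") simp_all
  then obtain d where d: "Value 0 < u (h - pmonom d 0)" using res by blast
  have "Value 0 \<le> u (pmonom d 0)"
    using triv[of d] val_eq_Infinity[OF u, of 0] by (cases "d = 0") auto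
  hence "Value 0 \<le> u (h + pmonom d 0)" using uh by (intro val_add_ge[OF u]) auto
  with d have "Value (0 + 0) < u ((h - pmonom d 0) * (h + pmonom d 0))"
    unfolding val_mult[OF u] by (rule value_inf_add_mono_less_le)
  \<comment> \<open>With d the residue of h and h^2 = e - c, this gives the nonzero real c + d^2 a
    positive value.\<close>
  moreover have "(h - pmonom d 0) * (h + pmonom d 0) = e - pmonom (c + d * d) 0"
    using h pmonom_mult[of d 0 d 0] by (simp add: algebra_simps pmonom_add)
  ultimately have "Value 0 < u (e - pmonom (c + d * d) 0)" by simp
  from val_diff_gt[OF u pos this] have "Value 0 < u (pmonom (c + d * d) 0)" by simp
  moreover have "c + d * d \<noteq> 0" using add_pos_nonneg[OF c zero_le_square[of d]] by simp
  ultimately show False using triv by simp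
qed

text \<open>Up to sign, the previous lemma applies to \<open>e\<close> and to its inverse. Neither
  has positive value, and the two values add up to 0.\<close>

lemma puiseux_valuation_unit:
  fixes u :: "puiseux \<Rightarrow> 'g::linordered_group_add value_inf"
  assumes u: "valuation u"
    and triv: "\<And>c. c \<noteq> 0 \<Longrightarrow> u (pmonom c 0) = Value 0"
    and res: "\<And>a. u a = Value 0 \<Longrightarrow> \<exists>c. Value 0 < u (a - pmonom c 0)"
    and e: "ord_ge e 0" "pcoeff e 0 \<noteq> 0"
  shows "u e = Value 0"
proof -
  have not_pos: "\<not> Value 0 < u a" if a: "ord_ge a 0" "pcoeff a 0 \<noteq> 0" for a
  proof (cases "pcoeff a 0 > 0")
    case True
    with a show ?thesis using puiseux_valuation_not_pos[OF u triv res] by blast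
  next
    case False
    with a have "ord_ge (- a) 0" "pcoeff (- a) 0 > 0" by (auto simp: ord_ge_def pcoeff_uminus)
    hence "\<not> Value 0 < u (- a)" using puiseux_valuation_not_pos[OF u triv res] by blast
    thus ?thesis by (simp add: val_uminus[OF u])
  qed
  have e0: "e \<noteq> 0" using e by (auto simp: pcoeff_0)
  hence "inverse e \<noteq> 0" by simp
  then obtain a where a: "ord_ge (inverse e) a" "pcoeff (inverse e) a \<noteq> 0" by (rule puiseux_order)
  have "pcoeff (e * inverse e) (0 + a) \<noteq> 0" using pcoeff_mult_lead[OF e(1) a(1)] e a by simp
  hence "a = 0" using e0 by (simp add: pcoeff_1 split: if_splits)
  with a have "\<not> Value 0 < u (inverse e)" by (intro not_pos) auto
  moreover have "u e + u (inverse e) = Value 0"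
    using val_mult[OF u, of e "inverse e"] e0 val_1[OF u] by simp
  moreover obtain g where g: "u e = Value g" using val_cases[OF u e0] .
  moreover obtain g' where "u (inverse e) = Value g'" using val_cases[OF u \<open>inverse e \<noteq> 0\<close>] .
  ultimately have "g + g' = 0" "\<not> 0 < g'" "\<not> 0 < g" using not_pos[OF e] by simp_all
  with add_strict_right[of g 0 g'] have "g = 0" by (metis add_0 linorder_neqE)
  with g show ?thesis by simp
qed

text \<open>The series is x^(-a) times a series of order 0, which has value 0; the value of x^(-a)
  is additive in a and known at a = -1.\<close>

lemma puiseux_valuation_unique:
  fixes u :: "puiseux \<Rightarrow> 'g::linordered_group_add value_inf"
  assumes u: "valuation u"
    and triv: "\<And>c. c \<noteq> 0 \<Longrightarrow> u (pmonom c 0) = Value 0"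
    and res: "\<And>a. u a = Value 0 \<Longrightarrow> \<exists>c. Value 0 < u (a - pmonom c 0)"
    and \<phi>: "ordered_embedding \<phi>" and X: "u puiseux_X = Value (\<phi> (- 1))"
    and f: "ord_ge f a" "pcoeff f a \<noteq> 0"
  shows "u f = Value (\<phi> a)"
proof -
  have "\<exists>g. u (pmonom 1 q) = Value g" for q
    using val_cases[OF u, of "pmonom 1 q"] by (auto simp: pmonom_eq_0_iff)
  then obtain \<psi> where \<psi>: "\<And>q. u (pmonom 1 q) = Value (\<psi> q)" by metis
  have "\<psi> (p + q) = \<psi> p + \<psi> q" for p q
    using val_mult[OF u, of "pmonom 1 p" "pmonom 1 q"] by (simp add: pmonom_mult \<psi>)
  moreover have "\<phi> (p + q) = \<phi> p + \<phi> q" for p q using \<phi> by (simp add: ordered_embedding_def)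
  moreover have "\<psi> (- 1) = \<phi> (- 1)" using X \<psi>[of "- 1"] by (simp add: puiseux_X_def)
  ultimately have eq: "\<psi> a = \<phi> a" by (rule additive_rat_unique)
  have m: "ord_ge (pmonom 1 (- a)) (- a)" by (simp add: ord_ge_pmonom)
  let ?e = "pmonom 1 (- a) * f"
  have "ord_ge ?e (- a + a)" by (rule ord_ge_mult[OF m f(1)])
  moreover have "pcoeff ?e (- a + a) \<noteq> 0"
    unfolding pcoeff_mult_lead[OF m f(1)] using f by (simp add: pcoeff_pmonom)
  ultimately have "u ?e = Value 0" using puiseux_valuation_unit[OF u triv res] by simp
  hence "u (pmonom 1 a * ?e) = Value (\<phi> a)" unfolding val_mult[OF u] \<psi> eq by simp
  moreover have "pmonom 1 a * ?e = f" by (simp add: pmonom_mult flip: mult.assoc)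
  ultimately show ?thesis by (simp only:)
qed

section \<open>The extension to the quotient division ring\<close>

lemma ore_embed_diff: "ore_embed (a - b) = ore_embed a - ore_embed b"
  by (metis ore_embed_add add_diff_cancel_right' diff_add_cancel)

lemma ore_embed_eq_0_iff: "ore_embed a = 0 \<longleftrightarrow> a = 0"
  by (metis ore_embed_0 ore_embed_eq_iff)

text \<open>As m n = n m, the commutator is the difference of the two errors a b - m n and b a - n
  m, each of larger value than the product.\<close>

lemma val_commutator_gt:
  fixes v :: "'a::ring_1 \<Rightarrow> 'g::linordered_ab_group_add value_inf"
  assumes v: "valuation v" and comm: "m * n = n * m"
    and a: "v a = Value \<alpha>" "Value \<alpha> < v (a - m)" and b: "v b = Value \<beta>" "Value \<beta> < v (b - n)"
  shows "v (a * b) < v (a * b - b * a)"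
proof -
  have m: "v m = Value \<alpha>" and n: "v n = Value \<beta>"
    using val_eq_of_diff_gt[OF v, of a m] val_eq_of_diff_gt[OF v, of b n] val_uminus[OF v, of "a - m"]
      val_uminus[OF v, of "b - n"] a b by simp_all
  have "Value (\<alpha> + \<beta>) < v ((a - m) * b)" "Value (\<alpha> + \<beta>) < v (m * (b - n))"
    unfolding val_mult[OF v] using a b m n
    by (auto intro: value_inf_add_mono_less_le value_inf_add_mono_le_less simp del: value_inf_simps(1))
  moreover have "Value (\<beta> + \<alpha>) < v ((b - n) * a)" "Value (\<beta> + \<alpha>) < v (n * (a - m))"
    unfolding val_mult[OF v] using a b m n
    by (auto intro: value_inf_add_mono_less_le value_inf_add_mono_le_less simp del: value_inf_simps(1))
  ultimately have "Value (\<alpha> + \<beta>) < v (((a - m) * b + m * (b - n)) - ((b - n) * a + n * (a - m)))"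
    by (intro val_diff_gt[OF v] val_add_gt[OF v]) (simp_all add: add.commute)
  also have "((a - m) * b + m * (b - n)) - ((b - n) * a + n * (a - m)) = a * b - b * a"
    using comm by (simp add: algebra_simps)
  finally show ?thesis by (simp add: val_mult[OF v] a b)
qed

lemma real_const_hom:
  "real_const (c + d) = real_const c + real_const d"
  "real_const (c * d) = real_const c * real_const d"
  "real_const 1 = 1"
  using pmonom_mult[of c 0 d 0]
  by (simp_all add: real_const_def pmonom_add skew_const_add ore_embed_add skew_const_1 ore_embed_1
      flip: skew_const_mult ore_embed_mult)

text \<open>Each term a z^k of the expansion in z = y + s has at least the value predicted by its
  weight, and a sum has at least the minimum of the values.\<close>

lemma valuation_translate_ge:
  fixes w :: "puiseux skew_poly \<Rightarrow> 'g::linordered_group_add value_inf"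
  assumes w: "valuation w" and \<phi>: "\<And>p q. \<phi> (p + q) = \<phi> p + \<phi> q"
    and const: "\<And>a \<alpha>. ord_ge a \<alpha> \<Longrightarrow> Value (\<phi> \<alpha>) \<le> w (skew_const a)"
    and z: "w (skew_Y + skew_const s) = Value (\<phi> \<rho>)"
    and f: "weight_ge \<rho> \<alpha> f"
  shows "Value (\<phi> \<alpha>) \<le> w (translate s f)"
  using f
proof (induction f arbitrary: \<alpha> rule: skew_poly_horner_induct)
  case 0
  then show ?case using val_eq_Infinity[OF w, of 0] by simp
next
  case (horner a f)
  hence a: "ord_ge a \<alpha>" and "Value (\<phi> (\<alpha> - \<rho>)) \<le> w (translate s f)"
    by (simp_all add: weight_ge_horner)
  hence "Value (\<phi> (\<alpha> - \<rho>) + \<phi> \<rho>) \<le> w (translate s f * (skew_Y + skew_const s))"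
    unfolding val_mult[OF w] z by (intro value_inf_add_mono_le) simp_all
  also have "\<phi> (\<alpha> - \<rho>) + \<phi> \<rho> = \<phi> \<alpha>" by (simp flip: \<phi>)
  finally show ?case unfolding translate_horner using const[OF a] by (intro val_add_ge[OF w])
qed

section \<open>Uniqueness, residue field, value group and commutators\<close>

context puiseux_pseudo_sequence
begin

text \<open>The restriction to Puiseux series is forced, hence \<open>value_ge\<close> gives lower
  bounds for any such valuation, and the leading monomial outweighs the remainder.\<close>

lemma prescribed_valuation_leading:
  fixes w :: "puiseux skew_poly \<Rightarrow> 'g::linordered_group_add value_inf"
  assumes \<phi>: "ordered_embedding \<phi>" and w: "prescribed_valuation r \<gamma> \<phi> w" and f: "leading f c \<alpha>"
  shows "w f = Value (\<phi> \<alpha>)"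
proof -
  have v: "valuation w" and res: "residue_field_real real_const (val_extension w)"
    and X: "w (skew_const puiseux_X) = Value (\<phi> (- 1))"
    and z: "\<And>i. w (zseq r \<gamma> i) = Value (\<phi> (slope i))"
    using w by (auto simp: prescribed_valuation_def)
  have \<phi>_add: "\<phi> (p + q) = \<phi> p + \<phi> q" and \<phi>_mono: "\<phi> p < \<phi> q \<longleftrightarrow> p < q" for p q
    using \<phi> by (auto simp: ordered_embedding_def strict_mono_less)
  let ?W = "val_extension w"
  have W: "valuation ?W" and embed: "?W (ore_embed a) = w a" for a
    using valuation_val_extension[OF v] val_extension_embed[OF v] by auto
  define u where "u a = w (skew_const a)" for a
  have u: "valuation u"
    using v by (simp add: valuation_def u_def skew_const_mult skew_const_add skew_const_eq_0_iff)
  have triv: "u (pmonom c 0) = Value 0" if "c \<noteq> 0" for c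
    using res that embed[of "skew_const (pmonom c 0)"] by (simp add: residue_field_real_def real_const_def u_def)
  \<comment> \<open>The residue condition concerns the quotient division ring, but the approximating
    real is a Puiseux series, so the condition descends to the coefficients.\<close>
  have res_u: "\<exists>c. Value 0 < u (a - pmonom c 0)" if "u a = Value 0" for a
  proof -
    have "Value 0 \<le> ?W (ore_embed (skew_const a))" using that by (simp add: embed u_def)
    from residue_field_realD[OF res W this]
    obtain c where "Value 0 < ?W (ore_embed (skew_const a) - real_const c)" by blast
    hence "Value 0 < u (a - pmonom c 0)"
      by (simp add: real_const_def embed u_def skew_const_diff flip: ore_embed_diff)
    thus ?thesis by blast
  qed
  have uX: "u puiseux_X = Value (\<phi> (- 1))" using X by (simp add: u_def)
  have unique: "u f = Value (\<phi> a)" if "ord_ge f a" "pcoeff f a \<noteq> 0" for f a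
    by (rule puiseux_valuation_unique[OF u _ _ \<phi> uX that]) (fact triv res_u)+
  have const: "Value (\<phi> \<alpha>) \<le> w (skew_const a)" if a: "ord_ge a \<alpha>" for a \<alpha>
  proof (cases "a = 0")
    case True
    then show ?thesis using val_eq_Infinity[OF v, of 0] by simp
  next
    case False
    then obtain \<beta> where \<beta>: "ord_ge a \<beta>" "pcoeff a \<beta> \<noteq> 0" by (rule puiseux_order)
    from a \<beta>(2) have "\<alpha> \<le> \<beta>" by (rule ord_ge_D)
    with unique[OF \<beta>] \<phi>_mono[of \<alpha> \<beta>] show ?thesis by (auto simp: u_def less_le)
  qed
  have ge: "Value (\<phi> \<beta>) \<le> w g" if "value_ge \<beta> g" for \<beta> g
  proof -
    from that obtain i where i: "weight_ge (slope i) \<beta> (expansion i g)" by (auto simp: value_ge_def)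
    \<comment> \<open>Translating back by the negative partial sum turns the expansion into
      \<open>g\<close> as a polynomial in z_i.\<close>
    have "skew_Y + skew_const (- partial_sum i) = zseq r \<gamma> i"
      using skew_const_diff[of 0 "partial_sum i"] by (simp add: zseq_eq)
    hence "Value (\<phi> \<beta>) \<le> w (translate (- partial_sum i) (expansion i g))"
      using z[of i] by (intro valuation_translate_ge[OF v \<phi>_add const _ i]) simp_all
    thus ?thesis by (simp add: expansion_def translate_translate)
  qed
  from f obtain \<beta> where c: "c \<noteq> 0" and \<beta>: "\<alpha> < \<beta>" "value_ge \<beta> (f - skew_monom c \<alpha>)"
    by (auto simp: leading_def)
  have m: "w (skew_monom c \<alpha>) = Value (\<phi> \<alpha>)"
    using unique[of "pmonom c \<alpha>" \<alpha>] c by (simp add: u_def ord_ge_pmonom pcoeff_pmonom)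
  have "w (skew_monom c \<alpha>) < Value (\<phi> \<beta>)" using \<beta>(1) by (simp add: m \<phi>_mono)
  also have "\<dots> \<le> w (f - skew_monom c \<alpha>)" by (rule ge[OF \<beta>(2)])
  finally show ?thesis using val_eq_of_diff_gt[OF v] m by metis
qed

lemma prescribed_valuation_eq:
  fixes w :: "puiseux skew_poly \<Rightarrow> 'g::linordered_group_add value_inf"
  assumes "ordered_embedding \<phi>" "prescribed_valuation r \<gamma> \<phi> w"
  shows "w = map_value_inf \<phi> \<circ> limit_valuation"
proof
  fix f
  show "w f = (map_value_inf \<phi> \<circ> limit_valuation) f"
  proof (cases "f = 0")
    case True
    then show ?thesis using assms(2) val_eq_Infinity[of w 0]
      by (simp add: limit_valuation_def prescribed_valuation_def)
  next
    case False
    then obtain c \<alpha> where "leading f c \<alpha>" by (rule leading_exists)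
    with prescribed_valuation_leading[OF assms this] show ?thesis by (simp add: limit_valuation_eq)
  qed
qed

text \<open>For q = a d^(-1) let m be the quotient of the leading monomials. Then (q - m) d = a - m
  d, where \<open>a\<close> and m d have the same leading monomial.\<close>

lemma val_extension_limit_leading:
  assumes "q \<noteq> 0"
  obtains c \<alpha> where "val_extension limit_valuation q = Value \<alpha>"
    "Value \<alpha> < val_extension limit_valuation (q - ore_embed (skew_monom c \<alpha>))"
proof -
  let ?W = "val_extension limit_valuation"
  note v = valuation_limit_valuation
  note W = valuation_val_extension[OF v] and embed = val_extension_embed[OF v]
  obtain d a where "d \<noteq> 0" "acts q d a" by (rule acts_ex1)
  hence q: "q * ore_embed d = ore_embed a" by (simp add: acts_iff_mult)
  with assms \<open>d \<noteq> 0\<close> have "a \<noteq> 0" by (metis ore_embed_eq_0_iff mult_eq_0_iff)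
  obtain b \<beta> where d: "leading d b \<beta>" using \<open>d \<noteq> 0\<close> by (rule leading_exists)
  obtain c \<alpha> where a: "leading a c \<alpha>" using \<open>a \<noteq> 0\<close> by (rule leading_exists)
  let ?m = "skew_monom (c / b) (\<alpha> - \<beta>)"
  have "leading ?m (c / b) (\<alpha> - \<beta>)" using a d by (intro leading_monom) (auto simp: leading_def)
  from leading_mult[OF this d] have md: "leading (?m * d) c \<alpha>" using d by (simp add: leading_def)
  from a obtain \<alpha>1 where 1: "\<alpha> < \<alpha>1" "value_ge \<alpha>1 (a - skew_monom c \<alpha>)" by (auto simp: leading_def)
  from md obtain \<alpha>2 where 2: "\<alpha> < \<alpha>2" "value_ge \<alpha>2 (?m * d - skew_monom c \<alpha>)" by (auto simp: leading_def)
  have "Value \<alpha> < limit_valuation (a - skew_monom c \<alpha>)" "Value \<alpha> < limit_valuation (?m * d - skew_monom c \<alpha>)"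
    using 1 2 unfolding value_ge_iff by (auto intro: less_le_trans[rotated])
  from val_diff_gt[OF v this] have "Value \<alpha> < limit_valuation (a - ?m * d)" by simp
  moreover have "?W (q - ore_embed ?m) + ?W (ore_embed d) = limit_valuation (a - ?m * d)"
    by (simp add: q ore_embed_diff ore_embed_mult left_diff_distrib flip: val_mult[OF W] embed)
  ultimately have "Value \<alpha> < ?W (q - ore_embed ?m) + Value \<beta>"
    by (simp add: embed limit_valuation_eq[OF d])
  hence "Value (\<alpha> - \<beta>) < ?W (q - ore_embed ?m)"
    by (cases "?W (q - ore_embed ?m)") (auto simp: algebra_simps)
  moreover have "?W q + Value \<beta> = Value \<alpha>"
    using val_mult[OF W, of q "ore_embed d"] by (simp add: q embed limit_valuation_eq[OF a] limit_valuation_eq[OF d])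
  hence "?W q = Value (\<alpha> - \<beta>)" by (cases "?W q") auto
  ultimately show ?thesis using that by blast
qed

lemma residue_field_real_limit: "residue_field_real real_const (val_extension limit_valuation)"
proof -
  let ?W = "val_extension limit_valuation"
  note v = valuation_limit_valuation
  note W = valuation_val_extension[OF v] and embed = val_extension_embed[OF v]
  show ?thesis
  proof (rule residue_field_realI[OF W real_const_hom])
    show "?W (real_const c) = Value 0" if "c \<noteq> 0" for c
      by (simp add: real_const_def embed limit_valuation_eq[OF leading_monom[OF that]])
    show "\<exists>c. Value 0 < ?W (q - real_const c)" if q: "?W q = Value 0" for q
    proof -
      have "q \<noteq> 0" using q val_eq_Infinity[OF W] by force
      then obtain c \<alpha> where "?W q = Value \<alpha>" "Value \<alpha> < ?W (q - ore_embed (skew_monom c \<alpha>))"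
        by (rule val_extension_limit_leading)
      with q show ?thesis by (auto simp: real_const_def)
    qed
  qed
qed

lemma prescribed_valuation_limit: "prescribed_valuation r \<gamma> id limit_valuation"
  using valuation_limit_valuation residue_field_real_limit limit_valuation_eq[OF leading_monom[of 1 "- 1"]]
    limit_valuation_eq[OF leading_zseq]
  by (simp add: prescribed_valuation_def puiseux_X_def)

lemma value_group_limit: "value_group (val_extension limit_valuation) = UNIV"
proof -
  have "val_extension limit_valuation (ore_embed (skew_monom 1 q)) = Value q" for q
    by (simp add: val_extension_embed[OF valuation_limit_valuation] limit_valuation_eq[OF leading_monom])
  thus ?thesis by (auto simp: value_group_def)
qed

text \<open>Every nonzero quotient is close to a Puiseux monomial, and these monomials
  commute.\<close>

lemma strongly_abelian_limit: "strongly_abelian (val_extension limit_valuation)"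
  unfolding strongly_abelian_def
proof (intro allI impI)
  fix p q :: "puiseux skew_poly ore_frac" assume "p \<noteq> 0" "q \<noteq> 0"
  let ?W = "val_extension limit_valuation"
  obtain c \<alpha> where p: "?W p = Value \<alpha>" "Value \<alpha> < ?W (p - ore_embed (skew_monom c \<alpha>))"
    using \<open>p \<noteq> 0\<close> by (rule val_extension_limit_leading)
  obtain d \<beta> where q: "?W q = Value \<beta>" "Value \<beta> < ?W (q - ore_embed (skew_monom d \<beta>))"
    using \<open>q \<noteq> 0\<close> by (rule val_extension_limit_leading)
  have "ore_embed (skew_monom c \<alpha>) * ore_embed (skew_monom d \<beta>)
      = ore_embed (skew_monom d \<beta>) * ore_embed (skew_monom c \<alpha>)"
    by (simp add: skew_const_commute flip: ore_embed_mult)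
  from val_commutator_gt[OF valuation_val_extension[OF valuation_limit_valuation] this p q]
  show "?W (p * q) < ?W (p * q - q * p)" .
qed

end

text \<open>The identity embedding expresses existence and uniqueness with rational values. The
  clause on \<phi> and \<open>w\<close> extends uniqueness to every totally ordered value group,
  commutative or not, in which \<phi> identifies the rationals.\<close>

theorem mainTheorem3:
  fixes r :: "nat \<Rightarrow> rat" and \<gamma> :: "nat \<Rightarrow> real"
  assumes "strict_mono_on {1..} r"
    and "(\<lambda>i. real_of_rat (r i)) \<longlonglongrightarrow> 1"
    and "\<forall>i\<ge>1. \<gamma> i \<noteq> 0"
  shows "(\<exists>!v :: puiseux skew_poly \<Rightarrow> rat value_inf. prescribed_valuation r \<gamma> id v) \<and>
    (\<forall>v :: puiseux skew_poly \<Rightarrow> rat value_inf. prescribed_valuation r \<gamma> id v \<longrightarrow>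
      (\<forall>(\<phi> :: rat \<Rightarrow> 'g::linordered_group_add) w.
        ordered_embedding \<phi> \<and> prescribed_valuation r \<gamma> \<phi> w \<longrightarrow> w = map_value_inf \<phi> \<circ> v) \<and>
      value_group (val_extension v) = UNIV \<and>
      strongly_abelian (val_extension v))"
proof -
  interpret puiseux_pseudo_sequence r \<gamma> using assms by unfold_locales
  have "ordered_embedding (id :: rat \<Rightarrow> rat)" by (simp add: ordered_embedding_def strict_mono_def)
  from prescribed_valuation_eq[OF this]
  have unique: "v = limit_valuation" if "prescribed_valuation r \<gamma> id v" for v
    using that by (simp add: value_inf.map_id0)
  show ?thesis
    using unique prescribed_valuation_limit prescribed_valuation_eq value_group_limit strongly_abelian_limit
    by blast
qed

end
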